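(* Let $S$ be a self-adjoint restriction of $T_{\max}$ with separated boundary conditions. Let $\phi_z$, $z\in\mathbb C\setminus\{0\}$, be non-trivial solutions of $(\tau-z)u=0$ such that $\phi_z$ lies in $S$ near $a$ and, for each $c\in(a,b)$, $z\mapsto\phi_z(c)$ and $z\mapsto\phi_z^{[1]}(c)$ are real analytic in $\mathbb C\setminus\{0\}$ with at most poles at zero. Let $\theta_z$, $z\in\mathbb C\setminus\{0\}$, be solutions of $(\tau-z)u=0$ with $V(\theta_z,\phi_z)=1$ such that $z\mapsto\theta_z(c)$ and $z\mapsto\theta_z^{[1]}(c)$ are real analytic in $\mathbb C\setminus\{0\}$ with at most poles at zero. Define $M:\rho(S)\setminus\{0\}\to\mathbb C$ by requiring that $\psi_z=\theta_z+M(z)\phi_z$ lies in $S$ near $b$; this determines $M(z)$ uniquely. Then $M$ is analytic on $\rho(S)\setminus\{0\}$ and $M(z)=M(z^\ast)^\ast$ for all $z\in\rho(S)\setminus\{0\}$.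
   Context: Let $-\infty\le a<b\le\infty$ and let $\varrho,\varsigma,\chi$ be complex Borel measures on $(a,b)$, finite on compact subintervals, such that $\varrho$ is real-valued, $\varsigma$ is positive with support all of $(a,b)$, $\chi$ is positive and not identically zero, and $\varsigma(\{x\})\chi(\{x\})=\varsigma(\{x\})\varrho(\{x\})=0$ for all $x$. For such a measure $\mu$ write $\int_c^x h\,d\mu=\int_{[c,x)}h\,d\mu$ if $x>c$, $0$ if $x=c$, and $-\int_{[x,c)}h\,d\mu$ if $x<c$. $AC_{\mathrm{loc}}((a,b);\mu)$ is the set of functions $f(x)=f(c)+\int_c^xh\,d\mu$ with $h\in L^1_{\mathrm{loc}}(\mu)$, and $df/d\mu=h$. $\mathfrak D_\tau$ is the set of $f\in AC_{\mathrm{loc}}((a,b);\varsigma)$ for which $x\mapsto-\frac{df}{d\varsigma}(x)+\int_c^xf\,d\chi$ has a (unique) representative in $AC_{\mathrm{loc}}((a,b);\varrho)$. For such $f$, $\tau f$ is its Radon–Nikodym derivative with respect to $\varrho$, and $f^{[1]}=df/d\varsigma$. A solution of $(\tau-z)u=0$ is some $u\in\mathfrak D_\tau$ with $\tau u=zu$, identified with the pair $(u,zu)$. Set $V(f,g)(x)=f_\tau g^{[1]}-f^{[1]}g_\tau$ for pairs $(f,f_\tau)$ with $\tau f=f_\tau$; it is constant for two solutions of the same equation. $H^1(a,b)$ is the Hilbert space of $f\in AC_{\mathrm{loc}}((a,b);\varsigma)$ with $f\in L^2(\chi)$ and $f^{[1]}\in L^2(\varsigma)$, with inner product $\int fg^\ast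 d\chi+\int f^{[1]}(g^{[1]})^\ast d\varsigma$. "In $H^1$ near an endpoint" means the integrals are finite over a neighbourhood of it. $T_{\max}$ is the set of pairs $(f,f_\tau)$ with $\tau f=f_\tau$ and $f,f_\tau\in H^1(a,b)$. A pair lies in $T_{\max}$ near an endpoint if both components lie in $H^1$ near it; then $V(f,g)(a)=\lim_{x\to a}V(f,g)(x)$ and $V(f,g)(b)$ exist. $\tau$ is l.c. at an endpoint if for all $z\ne0$ all solutions of $(\tau-z)u=0$ lie in $H^1$ near it, and l.p. otherwise. $S=\{f\in T_{\max}:V(f,v_a^\ast)(a)=V(f,v_b^\ast)(b)=0\}$, where $v_a\in T_{\max}$ satisfies $V(v_a,v_a^\ast)(a)=0$ and $V(f,v_a^\ast)(a)\ne0$ for some $f\in T_{\max}$ if $\tau$ is l.c. at $a$ (analogously $v_b$). A pair lies in $S$ near $a$ (resp. $b$) if it lies in $T_{\max}$ near $a$ and, in the l.c. case there, satisfies $V(f,v_a^\ast)(a)=0$ (resp. $V(f,v_b^\ast)(b)=0$). $\rho(S)$ is the resolvent set of $S$. Real analytic on $\mathbb C\setminus\{0\}$ means analytic with $F(z^\ast)=F(z)^\ast$. *)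

theory Defs
  imports "HOL-Complex_Analysis.Complex_Analysis"
begin

text \<open>Conventions.  The interval (a,b) has extended-real endpoints.  Every measure
is a positive Borel measure on the real line, concentrated on (a,b).  The real
(signed) measure varrho is given by its Jordan decomposition rp - rn (two mutually
singular positive locally finite measures); sg is varsigma, ch is chi.
Functions are complex-valued functions on the reals, only their values on (a,b)
matter.\<close>

definition Ivl :: "ereal \<Rightarrow> ereal \<Rightarrow> real set" where
  "Ivl a b = {x. a < ereal x \<and> ereal x < b}"

definition sint :: "real measure \<Rightarrow> real \<Rightarrow> real \<Rightarrow> (real \<Rightarrow> complex) \<Rightarrow> complex" where
  "sint mu c x h =
     (if c < x then set_lebesgue_integral mu {c..<x} h
      else if x = c then 0 else - set_lebesgue_integral mu {x..<c} h)"

definition loc_int :: "ereal \<Rightarrow> ereal \<Rightarrow> real measure \<Rightarrow> (real \<Rightarrow> complex) \<Rightarrow> bool" where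
  "loc_int a b mu h \<longleftrightarrow>
     (\<forall>\<alpha> \<beta>. \<alpha> \<in> Ivl a b \<longrightarrow> \<beta> \<in> Ivl a b \<longrightarrow> set_integrable mu {\<alpha>..\<beta>} h)"

definition AC_deriv :: "ereal \<Rightarrow> ereal \<Rightarrow> real measure \<Rightarrow> (real \<Rightarrow> complex) \<Rightarrow> (real \<Rightarrow> complex) \<Rightarrow> bool" where
  "AC_deriv a b mu f h \<longleftrightarrow> loc_int a b mu h \<and>
     (\<exists>c \<in> Ivl a b. \<forall>x \<in> Ivl a b. f x = f c + sint mu c x h)"

definition loc_finite_on :: "ereal \<Rightarrow> ereal \<Rightarrow> real measure \<Rightarrow> bool" where
  "loc_finite_on a b mu \<longleftrightarrow> sets mu = sets borel \<and>
     (\<forall>\<alpha> \<beta>. \<alpha> \<in> Ivl a b \<longrightarrow> \<beta> \<in> Ivl a b \<longrightarrow> emeasure mu {\<alpha>..\<beta>} < \<infinity>) \<and>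
     emeasure mu (UNIV - Ivl a b) = 0"

definition standing :: "ereal \<Rightarrow> ereal \<Rightarrow> real measure \<Rightarrow> real measure \<Rightarrow> real measure \<Rightarrow> real measure \<Rightarrow> bool" where
  "standing a b rp rn sg ch \<longleftrightarrow> a < b \<and>
     loc_finite_on a b rp \<and> loc_finite_on a b rn \<and> loc_finite_on a b sg \<and> loc_finite_on a b ch \<and>
     (\<exists>A \<in> sets borel. emeasure rp (UNIV - A) = 0 \<and> emeasure rn A = 0) \<and>
     (\<forall>x \<in> Ivl a b. \<forall>e > 0. emeasure sg (ball x e) > 0) \<and>
     emeasure ch (Ivl a b) \<noteq> 0 \<and>
     (\<forall>x \<in> Ivl a b. measure sg {x} * measure ch {x} = 0 \<and>
                    measure sg {x} * (measure rp {x} - measure rn {x}) = 0)"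

text \<open>f in D_tau with (pointwise, unique) quasi-derivative f1 = f^[1] and tau f = ft:
  f is sg-AC with derivative f1, and x |-> -f1 x + int_c^x f dch coincides pointwise with
  an AC_loc(varrho) function whose varrho-derivative is ft.\<close>
definition qd :: "ereal \<Rightarrow> ereal \<Rightarrow> real measure \<Rightarrow> real measure \<Rightarrow> real measure \<Rightarrow> real measure \<Rightarrow>
    (real \<Rightarrow> complex) \<Rightarrow> (real \<Rightarrow> complex) \<Rightarrow> (real \<Rightarrow> complex) \<Rightarrow> bool" where
  "qd a b rp rn sg ch f f1 ft \<longleftrightarrow>
     loc_int a b sg f1 \<and> loc_int a b ch f \<and> loc_int a b rp ft \<and> loc_int a b rn ft \<and>
     (\<exists>c \<in> Ivl a b.
        (\<forall>x \<in> Ivl a b. f x = f c + sint sg c x f1) \<and>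
        (\<forall>x \<in> Ivl a b. - f1 x + sint ch c x f = - f1 c + (sint rp c x ft - sint rn c x ft)))"

definition L2_on :: "real measure \<Rightarrow> real set \<Rightarrow> (real \<Rightarrow> complex) \<Rightarrow> bool" where
  "L2_on mu A f \<longleftrightarrow> set_integrable mu A (\<lambda>x. (cmod (f x))\<^sup>2)"

definition in_H1 :: "ereal \<Rightarrow> ereal \<Rightarrow> real measure \<Rightarrow> real measure \<Rightarrow> (real \<Rightarrow> complex) \<Rightarrow> bool" where
  "in_H1 a b sg ch f \<longleftrightarrow>
     (\<exists>h. AC_deriv a b sg f h \<and> L2_on ch (Ivl a b) f \<and> L2_on sg (Ivl a b) h)"

definition H1_near_a :: "ereal \<Rightarrow> ereal \<Rightarrow> real measure \<Rightarrow> real measure \<Rightarrow> (real \<Rightarrow> complex) \<Rightarrow> bool" where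
  "H1_near_a a b sg ch f \<longleftrightarrow>
     (\<exists>h. AC_deriv a b sg f h \<and> (\<exists>\<alpha> \<in> Ivl a b.
        L2_on ch {x \<in> Ivl a b. x < \<alpha>} f \<and> L2_on sg {x \<in> Ivl a b. x < \<alpha>} h))"

definition H1_near_b :: "ereal \<Rightarrow> ereal \<Rightarrow> real measure \<Rightarrow> real measure \<Rightarrow> (real \<Rightarrow> complex) \<Rightarrow> bool" where
  "H1_near_b a b sg ch f \<longleftrightarrow>
     (\<exists>h. AC_deriv a b sg f h \<and> (\<exists>\<beta> \<in> Ivl a b.
        L2_on ch {x \<in> Ivl a b. \<beta> < x} f \<and> L2_on sg {x \<in> Ivl a b. \<beta> < x} h))"

text \<open>The H^1(a,b) norm (the integral does not depend on the chosen derivative).\<close>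
definition H1_norm :: "ereal \<Rightarrow> ereal \<Rightarrow> real measure \<Rightarrow> real measure \<Rightarrow> (real \<Rightarrow> complex) \<Rightarrow> real" where
  "H1_norm a b sg ch f =
     sqrt (set_lebesgue_integral ch (Ivl a b) (\<lambda>x. (cmod (f x))\<^sup>2) +
           set_lebesgue_integral sg (Ivl a b) (\<lambda>x. (cmod ((SOME h. AC_deriv a b sg f h) x))\<^sup>2))"

definition Tmax :: "ereal \<Rightarrow> ereal \<Rightarrow> real measure \<Rightarrow> real measure \<Rightarrow> real measure \<Rightarrow> real measure \<Rightarrow>
    (real \<Rightarrow> complex) \<Rightarrow> (real \<Rightarrow> complex) \<Rightarrow> (real \<Rightarrow> complex) \<Rightarrow> bool" where
  "Tmax a b rp rn sg ch f f1 ft \<longleftrightarrow>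
     qd a b rp rn sg ch f f1 ft \<and> in_H1 a b sg ch f \<and> in_H1 a b sg ch ft"

definition Vw :: "(real \<Rightarrow> complex) \<Rightarrow> (real \<Rightarrow> complex) \<Rightarrow> (real \<Rightarrow> complex) \<Rightarrow>
    (real \<Rightarrow> complex) \<Rightarrow> (real \<Rightarrow> complex) \<Rightarrow> (real \<Rightarrow> complex) \<Rightarrow> real \<Rightarrow> complex" where
  "Vw f f1 ft g g1 gt x = ft x * g1 x - f1 x * gt x"

definition at_a :: "ereal \<Rightarrow> real filter" where
  "at_a a = (if a = -\<infinity> then at_bot else at_right (real_of_ereal a))"

definition at_b :: "ereal \<Rightarrow> real filter" where
  "at_b b = (if b = \<infinity> then at_top else at_left (real_of_ereal b))"

definition lc_a :: "ereal \<Rightarrow> ereal \<Rightarrow> real measure \<Rightarrow> real measure \<Rightarrow> real measure \<Rightarrow> real measure \<Rightarrow> bool" where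
  "lc_a a b rp rn sg ch \<longleftrightarrow> (\<forall>z. z \<noteq> 0 \<longrightarrow> (\<forall>u u1.
      qd a b rp rn sg ch u u1 (\<lambda>x. z * u x) \<longrightarrow> H1_near_a a b sg ch u))"

definition lc_b :: "ereal \<Rightarrow> ereal \<Rightarrow> real measure \<Rightarrow> real measure \<Rightarrow> real measure \<Rightarrow> real measure \<Rightarrow> bool" where
  "lc_b a b rp rn sg ch \<longleftrightarrow> (\<forall>z. z \<noteq> 0 \<longrightarrow> (\<forall>u u1.
      qd a b rp rn sg ch u u1 (\<lambda>x. z * u x) \<longrightarrow> H1_near_b a b sg ch u))"

text \<open>V(f, v^*)(a) = 0, resp. V(f, v^*)(b) = 0 (the limits exist for pairs in T_max near a/b).\<close>
definition V0_a where
  "V0_a a f f1 ft v v1 vt \<longleftrightarrow>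
     ((\<lambda>x. Vw f f1 ft (cnj \<circ> v) (cnj \<circ> v1) (cnj \<circ> vt) x) \<longlongrightarrow> 0) (at_a a)"

definition V0_b where
  "V0_b b f f1 ft v v1 vt \<longleftrightarrow>
     ((\<lambda>x. Vw f f1 ft (cnj \<circ> v) (cnj \<circ> v1) (cnj \<circ> vt) x) \<longlongrightarrow> 0) (at_b b)"

definition bc_fun_a where
  "bc_fun_a a b rp rn sg ch v v1 vt \<longleftrightarrow>
     Tmax a b rp rn sg ch v v1 vt \<and> V0_a a v v1 vt v v1 vt \<and>
     (\<exists>f f1 ft. Tmax a b rp rn sg ch f f1 ft \<and> \<not> V0_a a f f1 ft v v1 vt)"

definition bc_fun_b where
  "bc_fun_b a b rp rn sg ch v v1 vt \<longleftrightarrow>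
     Tmax a b rp rn sg ch v v1 vt \<and> V0_b b v v1 vt v v1 vt \<and>
     (\<exists>f f1 ft. Tmax a b rp rn sg ch f f1 ft \<and> \<not> V0_b b f f1 ft v v1 vt)"

definition S_rel where
  "S_rel a b rp rn sg ch va va1 vat vb vb1 vbt =
     {(f, ft). \<exists>f1. Tmax a b rp rn sg ch f f1 ft \<and>
        (lc_a a b rp rn sg ch \<longrightarrow> V0_a a f f1 ft va va1 vat) \<and>
        (lc_b a b rp rn sg ch \<longrightarrow> V0_b b f f1 ft vb vb1 vbt)}"

definition resolvent_set where
  "resolvent_set a b sg ch S =
     {z. (\<forall>g. in_H1 a b sg ch g \<longrightarrow>
            (\<exists>f ft. (f, ft) \<in> S \<and> (\<forall>x \<in> Ivl a b. ft x - z * f x = g x))) \<and>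
         (\<exists>C. \<forall>f ft. (f, ft) \<in> S \<longrightarrow>
            H1_norm a b sg ch f \<le> C * H1_norm a b sg ch (\<lambda>x. ft x - z * f x))}"

definition sol_in_S_near_a where
  "sol_in_S_near_a a b rp rn sg ch va va1 vat z u u1 \<longleftrightarrow>
     qd a b rp rn sg ch u u1 (\<lambda>x. z * u x) \<and>
     H1_near_a a b sg ch u \<and> H1_near_a a b sg ch (\<lambda>x. z * u x) \<and>
     (lc_a a b rp rn sg ch \<longrightarrow> V0_a a u u1 (\<lambda>x. z * u x) va va1 vat)"

definition sol_in_S_near_b where
  "sol_in_S_near_b a b rp rn sg ch vb vb1 vbt z u u1 \<longleftrightarrow>
     qd a b rp rn sg ch u u1 (\<lambda>x. z * u x) \<and>
     H1_near_b a b sg ch u \<and> H1_near_b a b sg ch (\<lambda>x. z * u x) \<and>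
     (lc_b a b rp rn sg ch \<longrightarrow> V0_b b u u1 (\<lambda>x. z * u x) vb vb1 vbt)"

definition real_analytic_pole0 :: "(complex \<Rightarrow> complex) \<Rightarrow> bool" where
  "real_analytic_pole0 F \<longleftrightarrow> F analytic_on (- {0}) \<and>
     (\<forall>z. z \<noteq> 0 \<longrightarrow> F (cnj z) = cnj (F z)) \<and> not_essential F 0"

end

theory Submission imports Defs begin

text \<open>Fix the Weyl solution psi at the single point z = i: in the limit-circle case it is a linear
  combination of theta and phi, in the limit-point case it comes from nested Weyl discs. Glueing
  phi(i) on the left of a pole c to psi on the right of c gives an element w of H^1, the Green
  function of S at i. If z is in the resolvent set of S, then u = w + (z - i) R(z) w solves
  (tau - z) u = 0 off c with a prescribed jump of the quasi-derivative at c, its left half is a multiple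
  of phi(z), and its right half is a non-zero multiple of theta(z) + M(z) phi(z). This yields M(z) as a
  rational expression in phi(z)(c), theta(z)(c) and u(c); the latter is analytic by
  a Neumann series for R(z) w, which only needs that S is closed under bounded pointwise
  convergence. That a boundary form V(f,g) vanishes at a limit-point endpoint is obtained from
  Cramer's rule: if it did not, all solutions would be in H^1 near that endpoint.\<close>

section \<open>Integration by parts for measures without common atoms\<close>

text \<open>The point i is chosen because there the Lagrange identity for u and its conjugate says
  that Re (u cnj(u1)) grows by the sg-integral of |u1|^2 plus the ch-integral of |u|^2. The
  sign-changing measure cancels in it and both remaining terms are non-negative, so this quantity is
  monotone and serves as an energy: for phi(i) it starts from 0 at the left endpoint and becomes
  positive, which bounds the discs, and where it stays non-positive it forces square integrability
  up to the right endpoint. The passage from i to z is the resolvent identity for Green functions,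
  G(z) = G(i) + (z - i) R(z) G(i). Its merit is that the resolvent acts on one function that does
  not depend on z, so that the dependence on z is carried by R(z), phi(z) and theta(z) alone. The
  pole c must satisfy phi(z0)(c) different from 0, because the coefficient of theta(z) in the right
  half turns out to be - i z phi(z)(c). A suitable c works only for z close to z0, so M is described
  locally and uniqueness makes the local descriptions agree.\<close>

lemma integral_product_parts:
  fixes P Q :: "real \<Rightarrow> complex"
  assumes sf: "sigma_finite_measure M" "sigma_finite_measure N"
    and sets[measurable_cong]: "sets M = sets borel" "sets N = sets borel"
    and P: "integrable M P" and Q: "integrable N Q"
    and atoms: "AE s in M. emeasure N {s} = 0"
  shows "integrable M (\<lambda>s. P s * (LINT t:{..<s}|N. Q t))"
    and "integrable N (\<lambda>t. Q t * (LINT s:{..<t}|M. P s))"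
    and "(LINT s|M. P s * (LINT t:{..<s}|N. Q t)) + (LINT t|N. Q t * (LINT s:{..<t}|M. P s))
         = (LINT s|M. P s) * (LINT t|N. Q t)"
proof -
  interpret M: sigma_finite_measure M by fact
  interpret N: sigma_finite_measure N by fact
  interpret MN: pair_sigma_finite M N by unfold_locales
  have [measurable]: "P \<in> borel_measurable borel" "Q \<in> borel_measurable borel"
    using borel_measurable_integrable[OF P] borel_measurable_integrable[OF Q] sets
    by (auto cong: measurable_cong_sets)
  define H where "H = (\<lambda>(s,t). P s * Q t)"
  have H: "integrable (M \<Otimes>\<^sub>M N) H"
  proof (rule MN.Fubini_integrable)
    show "H \<in> borel_measurable (M \<Otimes>\<^sub>M N)" unfolding H_def by measurable
    show "integrable M (\<lambda>x. \<integral> y. norm (H (x, y)) \<partial>N)"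
      unfolding H_def using P by (simp add: norm_mult)
    show "AE x in M. integrable N (\<lambda>y. H (x, y))" unfolding H_def using Q by simp
  qed
  \<comment> \<open>The two open triangles t < s and s < t. Integrating over t first on the former
    and over s first on the latter produces the two integrals of the claim.\<close>
  define H1 where "H1 = (\<lambda>x::real\<times>real. if snd x < fst x then H x else 0)"
  define H2 where "H2 = (\<lambda>x::real\<times>real. if fst x < snd x then H x else 0)"
  have m: "H \<in> borel_measurable (M \<Otimes>\<^sub>M N)" using H by auto
  have I1: "integrable (M \<Otimes>\<^sub>M N) H1"
    by (rule Bochner_Integration.integrable_bound[OF H]) (use m in \<open>auto simp: H1_def\<close>)
  have I2: "integrable (M \<Otimes>\<^sub>M N) H2"
    by (rule Bochner_Integration.integrable_bound[OF H]) (use m in \<open>auto simp: H2_def\<close>)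
  have e1: "(LINT y|N. H1 (x, y)) = P x * (LINT t:{..<x}|N. Q t)" for x
    unfolding H1_def H_def set_lebesgue_integral_def integral_mult_right_zero[symmetric]
    by (rule Bochner_Integration.integral_cong) (auto simp: indicator_def)
  have e2: "(LINT x|M. H2 (x, y)) = Q y * (LINT s:{..<y}|M. P s)" for y
    unfolding H2_def H_def set_lebesgue_integral_def integral_mult_right_zero[symmetric]
    by (rule Bochner_Integration.integral_cong) (auto simp: indicator_def)
  show "integrable M (\<lambda>s. P s * (LINT t:{..<s}|N. Q t))"
    using MN.integrable_fst'[OF I1] by (simp add: e1)
  have I2': "integrable (M \<Otimes>\<^sub>M N) (\<lambda>(x,y). H2 (x,y))" using I2 by simp
  show "integrable N (\<lambda>t. Q t * (LINT s:{..<t}|M. P s))"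
    using MN.integrable_snd[OF I2'] by (simp add: e2)
  have "(LINT x|(M \<Otimes>\<^sub>M N). H1 x) + (LINT x|(M \<Otimes>\<^sub>M N). H2 x) = (LINT x|(M \<Otimes>\<^sub>M N). H1 x + H2 x)"
    using I1 I2 by simp
  also have "\<dots> = (LINT x|M. LINT y|N. H1 (x,y) + H2 (x,y))"
    using MN.integral_fst'[of "\<lambda>x. H1 x + H2 x"] I1 I2 by simp
  \<comment> \<open>The triangles miss the diagonal. Its section at x is {x}, which is
    \<open>N\<close>-null for \<open>M\<close>-almost every x by \<open>atoms\<close>.\<close>
  also have "\<dots> = (LINT x|M. LINT y|N. H (x,y))"
  proof (rule integral_cong_AE)
    show "AE x in M. (LINT y|N. H1 (x,y) + H2 (x,y)) = (LINT y|N. H (x,y))"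
      using atoms
    proof eventually_elim
      case (elim x)
      have "AE y in N. y \<noteq> x"
        using elim sets by (intro AE_I[of _ _ "{x}"]) auto
      then have "AE y in N. H1 (x,y) + H2 (x,y) = H (x,y)"
        by eventually_elim (auto simp: H1_def H2_def)
      moreover have "(\<lambda>y. H1 (x,y) + H2 (x,y)) \<in> borel_measurable N" "(\<lambda>y. H (x,y)) \<in> borel_measurable N"
        unfolding H1_def H2_def H_def fst_conv snd_conv prod.case by measurable
      ultimately show ?case by (intro integral_cong_AE)
    qed
    show "(\<lambda>x. LINT y|N. H1 (x,y) + H2 (x,y)) \<in> borel_measurable M"
      using MN.integrable_fst'[of "\<lambda>x. H1 x + H2 x"] I1 I2 by simp
    show "(\<lambda>x. LINT y|N. H (x,y)) \<in> borel_measurable M"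
      using MN.integrable_fst'[OF H] by simp
  qed
  also have "\<dots> = (LINT s|M. P s) * (LINT t|N. Q t)"
    by (simp add: H_def)
  finally show "(LINT s|M. P s * (LINT t:{..<s}|N. Q t)) + (LINT t|N. Q t * (LINT s:{..<t}|M. P s))
         = (LINT s|M. P s) * (LINT t|N. Q t)"
    using MN.integral_fst'[OF I1] MN.integral_snd[OF I2'] by (simp add: e1 e2)
qed

section \<open>Exhaustion of the interval and locally finite measures on it\<close>

lemma Ivl_convex:
  assumes "x \<in> Ivl a b" "y \<in> Ivl a b" "x \<le> t" "t \<le> y"
  shows "t \<in> Ivl a b"
proof -
  have "a < ereal x" "ereal x \<le> ereal t" "ereal t \<le> ereal y" "ereal y < b"
    using assms by (auto simp: Ivl_def)
  then show ?thesis unfolding Ivl_def mem_Collect_eq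
    using less_le_trans le_less_trans by metis
qed

text \<open>The strict inequalities in the last two claims matter later, when the interval has to be
  covered by the half-open intervals \<open>{l i..<u j}\<close>.\<close>

lemma Ivl_exhaustion:
  assumes "a < b"
  obtains l u :: "nat \<Rightarrow> real" where
    "Ivl a b = (\<Union>i. {l i..u i})" "incseq u" "decseq l" "\<And>i. l i \<in> Ivl a b" "\<And>i. u i \<in> Ivl a b"
    "\<And>x. x \<in> Ivl a b \<Longrightarrow> \<exists>i. l i < x" "\<And>x. x \<in> Ivl a b \<Longrightarrow> \<exists>i. x < u i"
proof -
  obtain l u where *: "einterval a b = (\<Union>i::nat. {l i .. u i})"
    "incseq u" "decseq l" "\<And>i. l i < u i" "\<And>i. a < l i" "\<And>i. u i < b"
    "l \<longlonglongrightarrow> a" "u \<longlonglongrightarrow> b"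
    by (rule einterval_Icc_approximation[OF assms]; rule that; assumption)
  have I: "Ivl a b = einterval a b" by (auto simp: Ivl_def einterval_def)
  have 1: "\<exists>i. l i < x" if "x \<in> Ivl a b" for x
  proof -
    have "eventually (\<lambda>i. ereal (l i) < ereal x) sequentially"
      by (rule order_tendstoD(2)[OF *(7)]) (use that in \<open>simp add: Ivl_def\<close>)
    then show ?thesis using eventually_happens' by force
  qed
  have 2: "\<exists>i. x < u i" if "x \<in> Ivl a b" for x
  proof -
    have "eventually (\<lambda>i. ereal x < ereal (u i)) sequentially"
      by (rule order_tendstoD(1)[OF *(8)]) (use that in \<open>simp add: Ivl_def\<close>)
    then show ?thesis using eventually_happens' by force
  qed
  have 3: "l i \<in> Ivl a b" "u i \<in> Ivl a b" for i
  proof -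
    have "ereal (l i) < ereal (u i)" using *(4)[of i] by simp
    then have "a < ereal (u i)" "ereal (l i) < b" using *(5,6)[of i] less_trans by metis+
    then show "l i \<in> Ivl a b" "u i \<in> Ivl a b"
      unfolding Ivl_def mem_Collect_eq using *(5,6)[of i] by simp_all
  qed
  have 4: "Ivl a b = (\<Union>i. {l i..u i})" using I *(1) by metis
  show ?thesis by (rule that[OF 4 *(2,3) 3(1) 3(2) 1 2])
qed

lemma Ivl_upper:
  assumes "x \<in> Ivl a b" obtains y where "y \<in> Ivl a b" "x < y"
proof -
  have x: "a < ereal x" "ereal x < b" using assms by (simp_all add: Ivl_def)
  then obtain y where y: "ereal x < ereal y" "ereal y < b" using ereal_dense2 by blast
  then have "a < ereal y" using x(1) less_trans by blast
  then show ?thesis using that[of y] y by (simp add: Ivl_def)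
qed

lemma Ivl_borel [measurable]: "Ivl a b \<in> sets borel"
proof -
  have "Ivl a b = einterval a b" by (auto simp: Ivl_def einterval_def)
  then show ?thesis using borel_einterval by simp
qed

lemma loc_finite_sigma_finite:
  assumes "loc_finite_on a b M" "a < b"
  shows "sigma_finite_measure M"
proof -
  obtain l u where lu: "Ivl a b = (\<Union>i::nat. {l i..u i})" "incseq u" "decseq l" "\<And>i. l i \<in> Ivl a b" "\<And>i. u i \<in> Ivl a b"
    "\<And>x. x \<in> Ivl a b \<Longrightarrow> \<exists>i. l i < x" "\<And>x. x \<in> Ivl a b \<Longrightarrow> \<exists>i. x < u i"
    by (rule Ivl_exhaustion[OF assms(2)]; rule that; assumption)
  have s: "sets M = sets borel" "space M = UNIV"
    using assms(1) by (auto simp: loc_finite_on_def dest: sets_eq_imp_space_eq)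
  show ?thesis
  proof
    show "\<exists>A. countable A \<and> A \<subseteq> sets M \<and> \<Union>A = space M \<and> (\<forall>a\<in>A. emeasure M a \<noteq> \<infinity>)"
    proof (intro exI[of _ "insert (UNIV - Ivl a b) (range (\<lambda>i. {l i..u i}))"] conjI)
      show "\<Union> (insert (UNIV - Ivl a b) (range (\<lambda>i. {l i..u i}))) = space M"
        using lu(1) s by auto
      show "\<forall>A\<in>insert (UNIV - Ivl a b) (range (\<lambda>i. {l i..u i})). emeasure M A \<noteq> \<infinity>"
        using assms(1) lu(4,5) by (auto simp: loc_finite_on_def less_top)
      show "insert (UNIV - Ivl a b) (range (\<lambda>i. {l i..u i})) \<subseteq> sets M" 
        unfolding s(1) using Ivl_borel[of a b] by auto
    qed auto
  qed
qed

text \<open>Local integrability gives measurability on compact subintervals only; the function cut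
  off to the whole interval is the pointwise limit of its compact cut-offs.\<close>

lemma loc_int_measurable:
  assumes "loc_int a b M h" "sets M = sets borel" "a < b"
  shows "(\<lambda>x. indicator (Ivl a b) x *\<^sub>R h x) \<in> borel_measurable borel"
proof -
  obtain l u where lu: "Ivl a b = (\<Union>i::nat. {l i..u i})" "incseq u" "decseq l" "\<And>i. l i \<in> Ivl a b" "\<And>i. u i \<in> Ivl a b"
    "\<And>x. x \<in> Ivl a b \<Longrightarrow> \<exists>i. l i < x" "\<And>x. x \<in> Ivl a b \<Longrightarrow> \<exists>i. x < u i"
    by (rule Ivl_exhaustion[OF assms(3)]; rule that; assumption)
  show ?thesis
  proof (rule borel_measurable_LIMSEQ_metric)
    fix i
    have "integrable M (\<lambda>x. indicat_real {l i..u i} x *\<^sub>R h x)"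
      using assms(1) lu(4,5) by (auto simp: loc_int_def set_integrable_def)
    then show "(\<lambda>x. indicat_real {l i..u i} x *\<^sub>R h x) \<in> borel_measurable borel"
      using assms(2) by (auto dest!: borel_measurable_integrable cong: measurable_cong_sets)
  next
    fix x :: real
    have "incseq (\<lambda>i. {l i..u i})" using lu(2,3) unfolding incseq_def decseq_def by (auto intro: order_trans)
    then have "(\<lambda>i. indicat_real {l i..u i} x) \<longlonglongrightarrow> indicator (\<Union>i. {l i..u i}) x"
      by (intro LIMSEQ_indicator_incseq)
    then show "(\<lambda>i. indicat_real {l i..u i} x *\<^sub>R h x) \<longlonglongrightarrow> indicat_real (Ivl a b) x *\<^sub>R h x"
      unfolding lu(1) by (intro tendsto_intros)
  qed
qed

text \<open>A locally finite measure has at most countably many atoms. Each atom of \<open>N\<close>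
  is an \<open>M\<close>-null point by assumption, hence so is their union.\<close>

lemma loc_finite_atoms_AE:
  assumes M: "loc_finite_on a b M" and N: "loc_finite_on a b N" and ab: "a < b"
    and at: "\<And>x. x \<in> Ivl a b \<Longrightarrow> measure M {x} * measure N {x} = 0"
  shows "AE s in M. emeasure N {s} = 0"
proof -
  obtain l u where lu: "Ivl a b = (\<Union>i::nat. {l i..u i})" "incseq u" "decseq l" "\<And>i. l i \<in> Ivl a b" "\<And>i. u i \<in> Ivl a b"
    "\<And>x. x \<in> Ivl a b \<Longrightarrow> \<exists>i. l i < x" "\<And>x. x \<in> Ivl a b \<Longrightarrow> \<exists>i. x < u i"
    by (rule Ivl_exhaustion[OF ab]; rule that; assumption)
  have sN: "sets N = sets borel" and sM: "sets M = sets borel" using assms by (auto simp: loc_finite_on_def)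
  have fin: "emeasure K {x} < \<infinity>" if "x \<in> Ivl a b" "loc_finite_on a b K" for x K
    using that unfolding loc_finite_on_def by (metis atLeastAtMost_singleton)
  define Z where "Z = {x \<in> Ivl a b. measure N {x} \<noteq> 0}"
  have "countable {x \<in> {l i..u i}. measure N {x} \<noteq> 0}" for i
  proof -
    interpret R: finite_measure "restrict_space N {l i..u i}"
      by (rule finite_measureI)
        (use N lu(4,5)[of i] sN in \<open>auto simp: emeasure_restrict_space loc_finite_on_def space_restrict_space less_top
           dest: sets_eq_imp_space_eq\<close>)
    have "countable {x. measure (restrict_space N {l i..u i}) {x} \<noteq> 0}" by (rule R.countable_support)
    moreover have "measure (restrict_space N {l i..u i}) {x} = measure N {x}" if "x \<in> {l i..u i}" for x
      using that sN by (intro measure_restrict_space) (auto dest: sets_eq_imp_space_eq)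
    ultimately show ?thesis by (auto elim!: countable_subset[rotated])
  qed
  then have "countable (\<Union>i. {x \<in> {l i..u i}. measure N {x} \<noteq> 0})" by auto
  then have Z: "countable Z" unfolding Z_def lu(1) by (rule countable_subset[rotated]) auto
  have "emeasure M {x} = 0" if "x \<in> Z" for x
    using that at[of x] fin[OF _ M, of x] unfolding Z_def measure_def
    by (auto simp: enn2real_eq_0_iff)
  then have "(\<Union>x\<in>Z. {x}) \<in> null_sets M"
    using Z sM by (intro null_sets_UN') auto
  then have nZ: "Z \<in> null_sets M" by simp
  have "UNIV - Ivl a b \<in> null_sets M"
    using M sM by (auto simp: loc_finite_on_def null_sets_def)
  then have "Z \<union> (UNIV - Ivl a b) \<in> null_sets M" using nZ by auto
  then show ?thesis
  proof (rule AE_I'; safe)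
    fix x assume x: "emeasure N {x} \<noteq> 0" "x \<in> Ivl a b" "x \<notin> Z"
    then show False using fin[OF _ N, of x] by (auto simp: Z_def measure_def enn2real_eq_0_iff)
  qed simp
qed

text \<open>Local absolute continuity on an arbitrary set, without base point; the half-open intervals
  are those of the paper's convention for the integral from c to x.\<close>

definition ac_on :: "real measure \<Rightarrow> real set \<Rightarrow> (real \<Rightarrow> complex) \<Rightarrow> (real \<Rightarrow> complex) \<Rightarrow> bool" where
  "ac_on M A f h \<longleftrightarrow> (\<forall>x\<in>A. \<forall>y\<in>A. x \<le> y \<longrightarrow>
     set_integrable M {x..<y} h \<and> f y = f x + (LINT t:{x..<y}|M. h t))"

lemma ac_onI:
  assumes "\<And>x y. x \<in> A \<Longrightarrow> y \<in> A \<Longrightarrow> x \<le> y \<Longrightarrow> set_integrable M {x..<y} h"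
    "\<And>x y. x \<in> A \<Longrightarrow> y \<in> A \<Longrightarrow> x \<le> y \<Longrightarrow> f y = f x + (LINT t:{x..<y}|M. h t)"
  shows "ac_on M A f h"
  using assms unfolding ac_on_def by blast

lemma ac_onD:
  assumes "ac_on M A f h" "x \<in> A" "y \<in> A" "x \<le> y"
  shows "set_integrable M {x..<y} h" "f y = f x + (LINT t:{x..<y}|M. h t)"
  using assms unfolding ac_on_def by blast+

lemma ac_on_subset: "ac_on M A f h \<Longrightarrow> B \<subseteq> A \<Longrightarrow> ac_on M B f h"
  unfolding ac_on_def by blast

lemma set_integral_split:
  fixes h :: "real \<Rightarrow> complex"
  assumes "set_integrable M {x..<z} h" "sets M = sets borel" "x \<le> y" "y \<le> z"
  shows "(LINT t:{x..<z}|M. h t) = (LINT t:{x..<y}|M. h t) + (LINT t:{y..<z}|M. h t)"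
proof -
  have "{x..<z} = {x..<y} \<union> {y..<z}" using assms by auto
  then show ?thesis
    using assms by (auto intro!: set_integral_Un set_integrable_subset[OF assms(1)])
qed

lemma ac_on_integral:
  fixes h :: "real \<Rightarrow> complex"
  assumes "set_integrable M {x..<y} h" "sets M = sets borel"
  shows "ac_on M {x..y} (\<lambda>s. c + (LINT t:{x..<s}|M. h t)) h"
proof (rule ac_onI)
  fix s t assume *: "s \<in> {x..y}" "t \<in> {x..y}" "s \<le> t"
  then show "set_integrable M {s..<t} h" using assms by (auto intro: set_integrable_subset)
  have "set_integrable M {x..<t} h" using assms * by (auto intro: set_integrable_subset)
  then show "c + (LINT t:{x..<t}|M. h t) = c + (LINT t:{x..<s}|M. h t) + (LINT t:{s..<t}|M. h t)"
    using * assms by (subst set_integral_split[where y=s]) auto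
qed

text \<open>Integrals over half-open intervals [x,s) are left-continuous in s and jump at atoms. The
  product rule would contain products of the jumps of \<open>F\<close> and \<open>G\<close>; these
  are absent because the measures share no atoms. The proof applies the Fubini identity to
  \<open>p\<close> and \<open>q\<close> cut off to [x,y), whose inner integrals are the increments
  of \<open>F\<close> and \<open>G\<close> from x.\<close>

lemma ac_on_parts:
  assumes M: "sigma_finite_measure M" "sets M = sets borel" and N: "sigma_finite_measure N" "sets N = sets borel"
    and at: "AE s in M. emeasure N {s} = 0"
    and F: "ac_on M {x..y} F p" and G: "ac_on N {x..y} G q" and xy: "x \<le> y"
  shows "set_integrable M {x..<y} (\<lambda>s. p s * G s)" "set_integrable N {x..<y} (\<lambda>s. F s * q s)"
    "F y * G y = F x * G x + (LINT s:{x..<y}|M. p s * G s) + (LINT s:{x..<y}|N. F s * q s)"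
proof -
  define P where "P = (\<lambda>s. indicat_real {x..<y} s *\<^sub>R p s)"
  define Q where "Q = (\<lambda>s. indicat_real {x..<y} s *\<^sub>R q s)"
  have P: "integrable M P" and Q: "integrable N Q"
    using ac_onD(1)[OF F, of x y] ac_onD(1)[OF G, of x y] xy by (auto simp: P_def Q_def set_integrable_def)
  note parts = integral_product_parts[OF M(1) N(1) M(2) N(2) P Q at]
  have iq: "(LINT t:{..<s}|N. Q t) = G s - G x" if "s \<in> {x..<y}" for s
  proof -
    have "(LINT t:{..<s}|N. Q t) = (LINT t:{x..<s}|N. q t)"
      unfolding set_lebesgue_integral_def Q_def using that
      by (intro Bochner_Integration.integral_cong) (auto simp: indicator_def)
    then show ?thesis using ac_onD(2)[OF G, of x s] that by simp
  qed
  have ip: "(LINT t:{..<s}|M. P t) = F s - F x" if "s \<in> {x..<y}" for s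
  proof -
    have "(LINT t:{..<s}|M. P t) = (LINT t:{x..<s}|M. p t)"
      unfolding set_lebesgue_integral_def P_def using that
      by (intro Bochner_Integration.integral_cong) (auto simp: indicator_def)
    then show ?thesis using ac_onD(2)[OF F, of x s] that by simp
  qed
  have e1: "(\<lambda>s. P s * (LINT t:{..<s}|N. Q t)) = (\<lambda>s. indicat_real {x..<y} s *\<^sub>R (p s * G s) - P s * G x)"
    by (rule ext) (simp add: iq P_def indicator_def right_diff_distrib)
  have e2: "(\<lambda>s. Q s * (LINT t:{..<s}|M. P t)) = (\<lambda>s. indicat_real {x..<y} s *\<^sub>R (F s * q s) - Q s * F x)"
    by (rule ext) (simp add: ip Q_def indicator_def algebra_simps)
  have i1: "integrable M (\<lambda>s. indicat_real {x..<y} s *\<^sub>R (p s * G s))"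
  proof -
    have "integrable M (\<lambda>s. (indicat_real {x..<y} s *\<^sub>R (p s * G s) - P s * G x) + P s * G x)"
      using parts(1) P unfolding e1 by (intro Bochner_Integration.integrable_add) auto
    then show ?thesis by simp
  qed
  have i2: "integrable N (\<lambda>s. indicat_real {x..<y} s *\<^sub>R (F s * q s))"
  proof -
    have "integrable N (\<lambda>s. (indicat_real {x..<y} s *\<^sub>R (F s * q s) - Q s * F x) + Q s * F x)"
      using parts(2) Q unfolding e2 by (intro Bochner_Integration.integrable_add) auto
    then show ?thesis by simp
  qed
  show "set_integrable M {x..<y} (\<lambda>s. p s * G s)" "set_integrable N {x..<y} (\<lambda>s. F s * q s)"
    using i1 i2 by (auto simp: set_integrable_def)
  have iP: "(LINT s|M. P s) = F y - F x" and iQ: "(LINT s|N. Q s) = G y - G x"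
    using ac_onD(2)[OF F, of x y] ac_onD(2)[OF G, of x y] xy by (auto simp: P_def Q_def set_lebesgue_integral_def)
  have "(LINT s:{x..<y}|M. p s * G s) - (F y - F x) * G x + ((LINT s:{x..<y}|N. F s * q s) - (G y - G x) * F x)
     = (F y - F x) * (G y - G x)"
    using parts(3) P Q i1 i2 unfolding e1 e2 by (simp add: set_lebesgue_integral_def iP iQ)
  then show "F y * G y = F x * G x + (LINT s:{x..<y}|M. p s * G s) + (LINT s:{x..<y}|N. F s * q s)"
    by (simp add: algebra_simps)
qed

lemma loc_intI:
  assumes sets: "sets M = sets borel"
    and A: "\<And>x y. x \<in> Ivl a b \<Longrightarrow> y \<in> Ivl a b \<Longrightarrow> x \<le> y \<Longrightarrow> set_integrable M {x..<y} h"
  shows "loc_int a b M h"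
  unfolding loc_int_def
proof (intro allI impI)
  fix x y assume *: "x \<in> Ivl a b" "y \<in> Ivl a b"
  then have "max x y \<in> Ivl a b" by (simp add: max_def)
  then obtain r where r: "r \<in> Ivl a b" "max x y < r" by (rule Ivl_upper)
  have "set_integrable M {x..<r} h" by (rule A) (use * r in auto)
  then show "set_integrable M {x..y} h" by (rule set_integrable_subset) (use r sets in auto)
qed

lemma ac_on_sint:
  assumes "ac_on M (Ivl a b) f h" "c \<in> Ivl a b" "x \<in> Ivl a b"
  shows "f x = f c + sint M c x h"
proof (cases x c rule: linorder_cases)
  case less
  then show ?thesis using ac_onD(2)[OF assms(1,3,2)] by (simp add: sint_def)
next
  case greater
  then show ?thesis using ac_onD(2)[OF assms] by (simp add: sint_def)
qed (simp add: sint_def)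

lemma AC_deriv_iff_ac_on:
  assumes ab: "a < b" and sets: "sets M = sets borel"
  shows "AC_deriv a b M f h \<longleftrightarrow> ac_on M (Ivl a b) f h"
proof
  assume "AC_deriv a b M f h"
  then obtain c where c: "c \<in> Ivl a b" and L: "loc_int a b M h" and f: "\<And>x. x \<in> Ivl a b \<Longrightarrow> f x = f c + sint M c x h"
    unfolding AC_deriv_def by blast
  have int: "set_integrable M {x..<y} h" if "x \<in> Ivl a b" "y \<in> Ivl a b" for x y
    by (rule set_integrable_subset[where A="{x..y}"]) (use L that sets in \<open>auto simp: loc_int_def\<close>)
  show "ac_on M (Ivl a b) f h"
  proof (rule ac_onI)
    fix x y assume *: "x \<in> Ivl a b" "y \<in> Ivl a b" "x \<le> y"
    show "set_integrable M {x..<y} h" using int * by auto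
    have "sint M c y h = sint M c x h + (LINT t:{x..<y}|M. h t)"
    proof -
      consider "c < x" | "x < c" "c < y" | "y < c" | "x = c" | "y = c" by linarith
      then show ?thesis
      proof cases
        case 1
        have "(LINT t:{c..<y}|M. h t) = (LINT t:{c..<x}|M. h t) + (LINT t:{x..<y}|M. h t)"
          by (rule set_integral_split[OF int[OF c *(2)] sets]) (use 1 * in auto)
        moreover have "sint M c y h = (LINT t:{c..<y}|M. h t)" "sint M c x h = (LINT t:{c..<x}|M. h t)"
          using 1 * unfolding sint_def by auto
        ultimately show ?thesis by metis
      next
        case 2
        have "(LINT t:{x..<y}|M. h t) = (LINT t:{x..<c}|M. h t) + (LINT t:{c..<y}|M. h t)"
          by (rule set_integral_split[OF int[OF *(1,2)] sets]) (use 2 * in auto)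
        moreover have "sint M c y h = (LINT t:{c..<y}|M. h t)" "sint M c x h = - (LINT t:{x..<c}|M. h t)"
          using 2 * unfolding sint_def by auto
        ultimately show ?thesis by (metis add.commute add_diff_cancel_left' uminus_add_conv_diff)
      next
        case 3
        have "(LINT t:{x..<c}|M. h t) = (LINT t:{x..<y}|M. h t) + (LINT t:{y..<c}|M. h t)"
          by (rule set_integral_split[OF int[OF *(1) c] sets]) (use 3 * in auto)
        moreover have "sint M c y h = - (LINT t:{y..<c}|M. h t)" "sint M c x h = - (LINT t:{x..<c}|M. h t)"
          using 3 * unfolding sint_def by auto
        ultimately show ?thesis by (metis add.commute minus_add_cancel minus_add_distrib)
      next
        case 4 then show ?thesis using * by (auto simp: sint_def set_lebesgue_integral_def)
      next
        case 5 then show ?thesis using * by (auto simp: sint_def set_lebesgue_integral_def)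
      qed
    qed
    then show "f y = f x + (LINT t:{x..<y}|M. h t)" using f * by (auto simp: )
  qed
next
  assume A: "ac_on M (Ivl a b) f h"
  obtain c where c: "c \<in> Ivl a b" using Ivl_exhaustion[OF ab] by metis
  have "loc_int a b M h" using loc_intI[OF sets] ac_onD(1)[OF A] by blast
  then show "AC_deriv a b M f h" unfolding AC_deriv_def using ac_on_sint[OF A c] c by blast
qed

section \<open>Quasi-derivatives and the Lagrange identity\<close>

locale left_definite =
  fixes a b :: ereal and rp rn sg ch :: "real measure"
  assumes std: "standing a b rp rn sg ch"
begin

abbreviation "I \<equiv> Ivl a b"
abbreviation "sol \<equiv> qd a b rp rn sg ch"

lemma ab: "a < b" using std by (simp add: standing_def)

lemma lf: "loc_finite_on a b rp" "loc_finite_on a b rn" "loc_finite_on a b sg" "loc_finite_on a b ch"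
  using std by (simp_all add: standing_def)

lemma sets_borel: "sets rp = sets borel" "sets rn = sets borel" "sets sg = sets borel" "sets ch = sets borel"
  using lf by (simp_all add: loc_finite_on_def)

lemma sf: "sigma_finite_measure rp" "sigma_finite_measure rn" "sigma_finite_measure sg" "sigma_finite_measure ch"
  using lf[THEN loc_finite_sigma_finite, OF ab] .

lemma Icc_subset: "x \<in> I \<Longrightarrow> y \<in> I \<Longrightarrow> {x..y} \<subseteq> I"
  using Ivl_convex[of x a b y] by (simp add: subset_iff)

lemma atoms: "AE s in sg. emeasure ch {s} = 0" "AE s in sg. emeasure rp {s} = 0" "AE s in sg. emeasure rn {s} = 0"
proof -
  have 1: "measure sg {x} * measure ch {x} = 0" "measure sg {x} * (measure rp {x} - measure rn {x}) = 0"
    if "x \<in> I" for x using std that by (auto simp: standing_def)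
  obtain A where A: "A \<in> sets borel" "emeasure rp (UNIV - A) = 0" "emeasure rn A = 0"
    using std by (auto simp: standing_def)
  \<comment> \<open>The hypothesis on atoms concerns only the difference of \<open>rp\<close> and
    \<open>rn\<close>. Mutual singularity excludes cancellation: at most one of the two charges a
    given point.\<close>
  have 2: "measure rp {x} = 0 \<or> measure rn {x} = 0" for x
  proof (cases "x \<in> A")
    case True
    then have "emeasure rn {x} \<le> emeasure rn A" using A sets_borel by (intro emeasure_mono) auto
    then show ?thesis using A by (auto simp: measure_def)
  next
    case False
    then have "emeasure rp {x} \<le> emeasure rp (UNIV - A)" using A sets_borel by (intro emeasure_mono) auto
    then show ?thesis using A by (auto simp: measure_def)
  qed
  have 3: "measure sg {x} * measure rp {x} = 0" "measure sg {x} * measure rn {x} = 0" if "x \<in> I" for x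
    using 1(2)[OF that] 2[of x] by auto
  show "AE s in sg. emeasure ch {s} = 0" by (rule loc_finite_atoms_AE[OF lf(3,4) ab 1(1)])
  show "AE s in sg. emeasure rp {s} = 0" by (rule loc_finite_atoms_AE[OF lf(3,1) ab 3(1)])
  show "AE s in sg. emeasure rn {s} = 0" by (rule loc_finite_atoms_AE[OF lf(3,2) ab 3(2)])
qed

text \<open>The set \<open>A\<close> is a parameter because the two halves of the Green function
  satisfy the equation only on their own side of the pole.\<close>

definition qd_on :: "real set \<Rightarrow> (real \<Rightarrow> complex) \<Rightarrow> (real \<Rightarrow> complex) \<Rightarrow> (real \<Rightarrow> complex) \<Rightarrow> bool" where
  "qd_on A f f1 ft \<longleftrightarrow> ac_on sg A f f1 \<and> (\<forall>x\<in>A. \<forall>y\<in>A. x \<le> y \<longrightarrow>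
     set_integrable ch {x..<y} f \<and> set_integrable rp {x..<y} ft \<and> set_integrable rn {x..<y} ft \<and>
     f1 y = f1 x + (LINT t:{x..<y}|ch. f t) - (LINT t:{x..<y}|rp. ft t) + (LINT t:{x..<y}|rn. ft t))"

lemma qd_onI:
  assumes "ac_on sg A f f1"
    and "\<And>x y. x \<in> A \<Longrightarrow> y \<in> A \<Longrightarrow> x \<le> y \<Longrightarrow> set_integrable ch {x..<y} f"
    and "\<And>x y. x \<in> A \<Longrightarrow> y \<in> A \<Longrightarrow> x \<le> y \<Longrightarrow> set_integrable rp {x..<y} ft"
    and "\<And>x y. x \<in> A \<Longrightarrow> y \<in> A \<Longrightarrow> x \<le> y \<Longrightarrow> set_integrable rn {x..<y} ft"
    and "\<And>x y. x \<in> A \<Longrightarrow> y \<in> A \<Longrightarrow> x \<le> y \<Longrightarrow>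
      f1 y = f1 x + (LINT t:{x..<y}|ch. f t) - (LINT t:{x..<y}|rp. ft t) + (LINT t:{x..<y}|rn. ft t)"
  shows "qd_on A f f1 ft"
  unfolding qd_on_def by (intro conjI ballI impI; (rule assms; assumption)?)

lemma qd_onD:
  assumes "qd_on A f f1 ft"
  shows "ac_on sg A f f1"
    and "\<And>x y. x \<in> A \<Longrightarrow> y \<in> A \<Longrightarrow> x \<le> y \<Longrightarrow> set_integrable ch {x..<y} f"
    and "\<And>x y. x \<in> A \<Longrightarrow> y \<in> A \<Longrightarrow> x \<le> y \<Longrightarrow> set_integrable rp {x..<y} ft"
    and "\<And>x y. x \<in> A \<Longrightarrow> y \<in> A \<Longrightarrow> x \<le> y \<Longrightarrow> set_integrable rn {x..<y} ft"
    and "\<And>x y. x \<in> A \<Longrightarrow> y \<in> A \<Longrightarrow> x \<le> y \<Longrightarrow>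
      f1 y = f1 x + (LINT t:{x..<y}|ch. f t) - (LINT t:{x..<y}|rp. ft t) + (LINT t:{x..<y}|rn. ft t)"
  using assms unfolding qd_on_def by blast+

lemma qd_on_subset: "qd_on A f f1 ft \<Longrightarrow> B \<subseteq> A \<Longrightarrow> qd_on B f f1 ft"
  using ac_on_subset[of sg A f f1 B] unfolding qd_on_def by blast

lemma AC_iff: "AC_deriv a b sg f h \<longleftrightarrow> ac_on sg I f h"
  by (rule AC_deriv_iff_ac_on[OF ab sets_borel(3)])

lemma sol_iff: "sol f f1 ft \<longleftrightarrow> qd_on I f f1 ft"
proof
  assume L: "sol f f1 ft"
  then obtain c where c: "c \<in> I" and 1: "\<And>x. x \<in> I \<Longrightarrow> f x = f c + sint sg c x f1"
    and 2: "\<And>x. x \<in> I \<Longrightarrow> - f1 x + sint ch c x f = - f1 c + (sint rp c x ft - sint rn c x ft)"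
    unfolding qd_def by blast
  have li: "loc_int a b sg f1" "loc_int a b ch f" "loc_int a b rp ft" "loc_int a b rn ft"
    using L unfolding qd_def by blast+
  have s0: "sint M c c h = 0" for M h by (simp add: sint_def)
  have A0: "ac_on sg I f f1" unfolding AC_iff[symmetric] AC_deriv_def using li(1) c 1 by blast
  have A: "ac_on M I (\<lambda>x. sint M c x h) h" if "loc_int a b M h" "sets M = sets borel" for M h
    unfolding AC_deriv_iff_ac_on[OF ab that(2), symmetric] AC_deriv_def
    using that(1) by (intro conjI bexI[of _ c] ballI) (simp_all add: s0 c)
  note A1 = A[OF li(2) sets_borel(4)] and A2 = A[OF li(3) sets_borel(1)] and A3 = A[OF li(4) sets_borel(2)]
  show "qd_on I f f1 ft"
  proof (rule qd_onI[OF A0 ac_onD(1)[OF A1] ac_onD(1)[OF A2] ac_onD(1)[OF A3]], assumption+)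
    fix x y assume *: "x \<in> I" "y \<in> I" "x \<le> y"
    have "f1 y - f1 x = (sint ch c y f - sint ch c x f) - (sint rp c y ft - sint rp c x ft) + (sint rn c y ft - sint rn c x ft)"
      using 2[OF *(1)] 2[OF *(2)] by algebra
    then show "f1 y = f1 x + (LINT t:{x..<y}|ch. f t) - (LINT t:{x..<y}|rp. ft t) + (LINT t:{x..<y}|rn. ft t)"
      using ac_onD(2)[OF A1 *] ac_onD(2)[OF A2 *] ac_onD(2)[OF A3 *] by (simp add: algebra_simps)
  qed
next
  assume Q: "qd_on I f f1 ft"
  have "loc_int a b sg f1" by (rule loc_intI[OF sets_borel(3) ac_onD(1)[OF qd_onD(1)[OF Q]]])
  moreover have "loc_int a b ch f" by (rule loc_intI[OF sets_borel(4) qd_onD(2)[OF Q]])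
  moreover have "loc_int a b rp ft" by (rule loc_intI[OF sets_borel(1) qd_onD(3)[OF Q]])
  moreover have "loc_int a b rn ft" by (rule loc_intI[OF sets_borel(2) qd_onD(4)[OF Q]])
  moreover obtain c where c: "c \<in> I" using Ivl_exhaustion[OF ab] by metis
  moreover have "- f1 x + sint ch c x f = - f1 c + (sint rp c x ft - sint rn c x ft)" if x: "x \<in> I" for x
  proof (cases x c rule: linorder_cases)
    case less
    then show ?thesis using qd_onD(5)[OF Q x c] by (simp add: sint_def)
  next
    case greater
    then show ?thesis using qd_onD(5)[OF Q c x] by (simp add: sint_def)
  qed (simp add: sint_def)
  moreover have "f x = f c + sint sg c x f1" if x: "x \<in> I" for x
    by (rule ac_on_sint[OF qd_onD(1)[OF Q] c x])
  ultimately show "sol f f1 ft" unfolding qd_def by blast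
qed

text \<open>\<open>f1\<close> is not absolutely continuous with respect to one measure, but it is a
  sum of primitives over \<open>ch\<close>, \<open>rp\<close> and \<open>rn\<close>. Each of them is
  integrated by parts against \<open>F\<close>, using the matching statement of
  \<open>atoms\<close>.\<close>

lemma qd_on_parts:
  assumes F: "ac_on sg {x..y} F p" and Q: "qd_on {x..y} f f1 ft" and xy: "x \<le> y"
  shows "set_integrable sg {x..<y} (\<lambda>s. p s * f1 s)" "set_integrable ch {x..<y} (\<lambda>s. F s * f s)"
    "set_integrable rp {x..<y} (\<lambda>s. F s * ft s)" "set_integrable rn {x..<y} (\<lambda>s. F s * ft s)"
    "F y * f1 y = F x * f1 x + (LINT s:{x..<y}|sg. p s * f1 s) + (LINT s:{x..<y}|ch. F s * f s)
       - (LINT s:{x..<y}|rp. F s * ft s) + (LINT s:{x..<y}|rn. F s * ft s)"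
proof -
  define G1 where "G1 = (\<lambda>s. f1 x + (LINT t:{x..<s}|ch. f t))"
  define G2 where "G2 = (\<lambda>s. 0 + (LINT t:{x..<s}|rp. ft t))"
  define G3 where "G3 = (\<lambda>s. 0 + (LINT t:{x..<s}|rn. ft t))"
  have mem: "x \<in> {x..y}" "y \<in> {x..y}" using xy by auto
  have "ac_on ch {x..y} G1 f" "ac_on rp {x..y} G2 ft" "ac_on rn {x..y} G3 ft" unfolding G1_def G2_def G3_def
    using ac_on_integral qd_onD(2-4)[OF Q mem xy] sets_borel by blast+
  note P1 = ac_on_parts[OF sf(3) sets_borel(3) sf(4) sets_borel(4) atoms(1) F this(1) xy]
    and P2 = ac_on_parts[OF sf(3) sets_borel(3) sf(1) sets_borel(1) atoms(2) F this(2) xy]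
    and P3 = ac_on_parts[OF sf(3) sets_borel(3) sf(2) sets_borel(2) atoms(3) F this(3) xy]
  have f1: "f1 s = G1 s - G2 s + G3 s" if "s \<in> {x..y}" for s
    using qd_onD(5)[OF Q mem(1) that] that by (simp add: G1_def G2_def G3_def)
  have eq: "p s * f1 s = p s * G1 s - p s * G2 s + p s * G3 s" if "s \<in> {x..<y}" for s
    by (subst f1) (use that in \<open>simp_all add: algebra_simps\<close>)
  have "set_integrable sg {x..<y} (\<lambda>s. p s * G1 s - p s * G2 s + p s * G3 s)"
    using P1(1) P2(1) P3(1) by (intro set_integral_add set_integral_diff)
  then show "set_integrable sg {x..<y} (\<lambda>s. p s * f1 s)"
    by (subst set_integrable_cong[OF refl refl eq])
  have i: "(LINT s:{x..<y}|sg. p s * f1 s) = (LINT s:{x..<y}|sg. p s * G1 s) - (LINT s:{x..<y}|sg. p s * G2 s) + (LINT s:{x..<y}|sg. p s * G3 s)"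
  proof -
    have "(LINT s:{x..<y}|sg. p s * f1 s) = (LINT s:{x..<y}|sg. p s * G1 s - p s * G2 s + p s * G3 s)"
      by (rule set_lebesgue_integral_cong) (use eq sets_borel in auto)
    then show ?thesis using P1(1) P2(1) P3(1) by simp
  qed
  show "set_integrable ch {x..<y} (\<lambda>s. F s * f s)"
    "set_integrable rp {x..<y} (\<lambda>s. F s * ft s)" "set_integrable rn {x..<y} (\<lambda>s. F s * ft s)"
    by fact+
  have "G1 x = f1 x" "G2 x = 0" "G3 x = 0" by (auto simp: G1_def G2_def G3_def set_lebesgue_integral_def)
  then have e: "F y * G1 y = F x * f1 x + (LINT s:{x..<y}|sg. p s * G1 s) + (LINT s:{x..<y}|ch. F s * f s)"
    "F y * G2 y = (LINT s:{x..<y}|sg. p s * G2 s) + (LINT s:{x..<y}|rp. F s * ft s)"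
    "F y * G3 y = (LINT s:{x..<y}|sg. p s * G3 s) + (LINT s:{x..<y}|rn. F s * ft s)"
    using P1(3) P2(3) P3(3) by simp_all
  have "F y * f1 y = F y * G1 y - F y * G2 y + F y * G3 y"  by (subst f1[OF mem(2)]) (simp add: algebra_simps)
  then show "F y * f1 y = F x * f1 x + (LINT s:{x..<y}|sg. p s * f1 s) + (LINT s:{x..<y}|ch. F s * f s)
       - (LINT s:{x..<y}|rp. F s * ft s) + (LINT s:{x..<y}|rn. F s * ft s)"
    unfolding e i by simp
qed

text \<open>Integration by parts of \<open>ft\<close> against \<open>g1\<close> and of
  \<open>gt\<close> against \<open>f1\<close> yields the same integrals of \<open>ft gt\<close> over
  \<open>rp\<close> and \<open>rn\<close>. They cancel in the difference, so only the two positive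
  measures of the H^1 inner product survive.\<close>

lemma lagrange:
  assumes f: "qd_on A f f1 ft" "ac_on sg A ft ft1" and g: "qd_on A g g1 gt" "ac_on sg A gt gt1"
    and xy: "x \<le> y" "{x..y} \<subseteq> A"
  shows "set_integrable sg {x..<y} (\<lambda>s. ft1 s * g1 s - gt1 s * f1 s)"
    "set_integrable ch {x..<y} (\<lambda>s. ft s * g s - gt s * f s)"
    "Vw f f1 ft g g1 gt y = Vw f f1 ft g g1 gt x + (LINT s:{x..<y}|sg. ft1 s * g1 s - gt1 s * f1 s)
       + (LINT s:{x..<y}|ch. ft s * g s - gt s * f s)"
proof -
  note P = qd_on_parts[OF ac_on_subset[OF f(2) xy(2)] qd_on_subset[OF g(1) xy(2)] xy(1)]
  note Q = qd_on_parts[OF ac_on_subset[OF g(2) xy(2)] qd_on_subset[OF f(1) xy(2)] xy(1)]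
  show "set_integrable sg {x..<y} (\<lambda>s. ft1 s * g1 s - gt1 s * f1 s)"
    "set_integrable ch {x..<y} (\<lambda>s. ft s * g s - gt s * f s)"
    by (fact set_integral_diff(1)[OF P(1) Q(1)], fact set_integral_diff(1)[OF P(2) Q(2)])
  have c: "(LINT s:{x..<y}|M. ft s * gt s) = (LINT s:{x..<y}|M. gt s * ft s)" for M
    by (simp only: mult.commute)
  have "ft y * g1 y - gt y * f1 y = ft x * g1 x - gt x * f1 x + ((LINT s:{x..<y}|sg. ft1 s * g1 s) - (LINT s:{x..<y}|sg. gt1 s * f1 s))
     + ((LINT s:{x..<y}|ch. ft s * g s) - (LINT s:{x..<y}|ch. gt s * f s))"
    using P(5) Q(5) unfolding c by algebra
  moreover have "Vw f f1 ft g g1 gt t = ft t * g1 t - gt t * f1 t" for t by (simp add: Vw_def)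
  ultimately show "Vw f f1 ft g g1 gt y = Vw f f1 ft g g1 gt x + (LINT s:{x..<y}|sg. ft1 s * g1 s - gt1 s * f1 s)
       + (LINT s:{x..<y}|ch. ft s * g s - gt s * f s)"
    using set_integral_diff(2)[OF P(1) Q(1)] set_integral_diff(2)[OF P(2) Q(2)] by metis
qed

lemma ac_on_cmult:
  assumes "ac_on M A f h" shows "ac_on M A (\<lambda>x. c * f x) (\<lambda>x. c * h x)"
proof (rule ac_onI)
  fix x y assume *: "x \<in> A" "y \<in> A" "x \<le> y"
  show "set_integrable M {x..<y} (\<lambda>x. c * h x)" using ac_onD(1)[OF assms *] by simp
  show "c * f y = c * f x + (LINT t:{x..<y}|M. c * h t)"
    unfolding ac_onD(2)[OF assms *] by (simp add: distrib_left)
qed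

lemma Vw_const_le:
  assumes f: "qd_on A f f1 (\<lambda>x. z * f x)" and g: "qd_on A g g1 (\<lambda>x. z * g x)"
    and xy: "x \<le> y" "{x..y} \<subseteq> A"
  shows "Vw f f1 (\<lambda>x. z * f x) g g1 (\<lambda>x. z * g x) y = Vw f f1 (\<lambda>x. z * f x) g g1 (\<lambda>x. z * g x) x"
proof -
  have "z * f1 r * g1 r - z * g1 r * f1 r = 0" "z * f r * g r - z * g r * f r = 0" for r
    by simp_all
  then show ?thesis
    using lagrange(3)[OF f ac_on_cmult[OF qd_onD(1)[OF f]] g ac_on_cmult[OF qd_onD(1)[OF g]] xy] by simp
qed

end

section \<open>Linear combinations, conjugates and bounds on compact intervals\<close>

lemma ac_on_add:
  assumes "ac_on M A f h" "ac_on M A g k" shows "ac_on M A (\<lambda>x. f x + g x) (\<lambda>x. h x + k x)"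
proof (rule ac_onI)
  fix x y assume *: "x \<in> A" "y \<in> A" "x \<le> y"
  note i = ac_onD(1)[OF assms(1) *] ac_onD(1)[OF assms(2) *]
  show "set_integrable M {x..<y} (\<lambda>x. h x + k x)" using i by simp
  show "f y + g y = f x + g x + (LINT t:{x..<y}|M. h t + k t)"
    unfolding ac_onD(2)[OF assms(1) *] ac_onD(2)[OF assms(2) *] using i by simp
qed

lemma scaleR_cnj: "indicat_real S t *\<^sub>R cnj z = cnj (indicat_real S t *\<^sub>R z)"
  by simp

lemma set_integral_cnj: "(LINT t:S|M. cnj (h t)) = cnj (LINT t:S|M. h t)"
  unfolding set_lebesgue_integral_def scaleR_cnj by (rule Bochner_Integration.integral_cnj)

lemma set_integrable_cnj: "set_integrable M S h \<Longrightarrow> set_integrable M S (\<lambda>x. cnj (h x))"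
  unfolding set_integrable_def scaleR_cnj by (rule integrable_cnj)

lemma ac_on_cnj:
  assumes "ac_on M A f h" shows "ac_on M A (\<lambda>x. cnj (f x)) (\<lambda>x. cnj (h x))"
proof (rule ac_onI)
  fix x y assume *: "x \<in> A" "y \<in> A" "x \<le> y"
  show "set_integrable M {x..<y} (\<lambda>x. cnj (h x))"
    by (rule set_integrable_cnj[OF ac_onD(1)[OF assms *]])
  show "cnj (f y) = cnj (f x) + (LINT t:{x..<y}|M. cnj (h t))"
    unfolding ac_onD(2)[OF assms *] set_integral_cnj by simp
qed

lemma set_integral_mono_set:
  fixes k :: "_ \<Rightarrow> real"
  assumes "set_integrable M B k" "A \<subseteq> B" "A \<in> sets M" "\<And>x. x \<in> B \<Longrightarrow> 0 \<le> k x"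
  shows "(LINT x:A|M. k x) \<le> (LINT x:B|M. k x)"
  unfolding set_lebesgue_integral_def
proof (rule integral_mono)
  show "integrable M (\<lambda>x. indicat_real A x *\<^sub>R k x)"
    using set_integrable_subset[OF assms(1,3,2)] by (simp add: set_integrable_def)
  show "integrable M (\<lambda>x. indicat_real B x *\<^sub>R k x)" using assms(1) by (simp add: set_integrable_def)
  show "indicat_real A x *\<^sub>R k x \<le> indicat_real B x *\<^sub>R k x" for x
    using assms(2,4) by (auto simp: indicator_def)
qed

lemma set_integrable_congI:
  "set_integrable M A f \<Longrightarrow> (\<And>x. x \<in> A \<Longrightarrow> f x = g x) \<Longrightarrow> set_integrable M A g"
  by (subst set_integrable_cong[of M M A A g f]) simp_all

lemma ac_on_cong:
  assumes "ac_on M A f h" "sets M = sets borel" "\<And>x y. x \<in> A \<Longrightarrow> y \<in> A \<Longrightarrow> {x..<y} \<subseteq> A"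
    and e: "\<And>x. x \<in> A \<Longrightarrow> f x = g x" "\<And>x. x \<in> A \<Longrightarrow> h x = k x"
  shows "ac_on M A g k"
proof (rule ac_onI)
  fix x y assume *: "x \<in> A" "y \<in> A" "x \<le> y"
  have hk: "t \<in> {x..<y} \<Longrightarrow> h t = k t" for t using assms(3)[OF *(1,2)] e(2) by blast
  show "set_integrable M {x..<y} k" by (rule set_integrable_congI[OF ac_onD(1)[OF assms(1) *] hk])
  have "(LINT t:{x..<y}|M. h t) = (LINT t:{x..<y}|M. k t)"
    by (rule set_lebesgue_integral_cong) (use hk assms(2) in auto)
  then show "g y = g x + (LINT t:{x..<y}|M. k t)" using ac_onD(2)[OF assms(1) *] e(1)[OF *(1)] e(1)[OF *(2)] by simp
qed

lemma ac_on_norm_bound: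
  assumes "ac_on M A f h" "x \<in> A" "y \<in> A" "{x..y} \<subseteq> A" "sets M = sets borel" and s: "s \<in> {x..y}" "t \<in> {x..y}"
  shows "cmod (f s - f t) \<le> (LINT r:{x..<y}|M. cmod (h r))"
proof -
  have xy: "x \<le> y" using s by auto
  have i: "set_integrable M {x..<y} (\<lambda>r. cmod (h r))"
    using ac_onD(1)[OF assms(1,2,3) xy] by (rule set_integrable_norm)
  have *: "cmod (f s - f t) \<le> (LINT r:{x..<y}|M. cmod (h r))" if "t \<le> s" "s \<in> {x..y}" "t \<in> {x..y}" for s t
  proof -
    have "s \<in> A" "t \<in> A" using that assms(4) by auto
    then have "f s - f t = (LINT r:{t..<s}|M. h r)" using ac_onD(2)[OF assms(1), of t s] that by simp
    also have "cmod \<dots> \<le> (LINT r:{t..<s}|M. cmod (h r))"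
      by (rule set_integral_norm_bound) (rule ac_onD(1)[OF assms(1) \<open>t \<in> A\<close> \<open>s \<in> A\<close> \<open>t \<le> s\<close>])
    also have "\<dots> \<le> (LINT r:{x..<y}|M. cmod (h r))"
      by (rule set_integral_mono_set[OF i]) (use that assms(5) in auto)
    finally show ?thesis .
  qed
  show ?thesis
  proof (cases "t \<le> s")
    case False then show ?thesis using *[of s t] s by (simp add: norm_minus_commute)
  qed (use * s in simp)
qed

lemma ac_on_bounded:
  assumes "ac_on M A f h" "x \<in> A" "y \<in> A" "{x..y} \<subseteq> A" "sets M = sets borel"
  obtains B where "\<And>s. s \<in> {x..y} \<Longrightarrow> cmod (f s) \<le> B"
proof (rule that)
  fix s assume s: "s \<in> {x..y}"
  have "cmod (f s - f x) \<le> (LINT r:{x..<y}|M. cmod (h r))"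
    by (rule ac_on_norm_bound[OF assms]) (use s in auto)
  then show "cmod (f s) \<le> cmod (f x) + (LINT r:{x..<y}|M. cmod (h r))"
    using norm_triangle_ineq[of "f s - f x" "f x"] by simp
qed

context left_definite begin

lemma qd_on_add:
  assumes f: "qd_on A f f1 ft" and g: "qd_on A g g1 gt"
  shows "qd_on A (\<lambda>x. f x + g x) (\<lambda>x. f1 x + g1 x) (\<lambda>x. ft x + gt x)"
proof (rule qd_onI)
  show "ac_on sg A (\<lambda>x. f x + g x) (\<lambda>x. f1 x + g1 x)" by (rule ac_on_add[OF qd_onD(1)[OF f] qd_onD(1)[OF g]])
  fix x y assume *: "x \<in> A" "y \<in> A" "x \<le> y"
  note F = qd_onD(2-4)[OF f *] and G = qd_onD(2-4)[OF g *]
  show "set_integrable ch {x..<y} (\<lambda>x. f x + g x)" "set_integrable rp {x..<y} (\<lambda>x. ft x + gt x)"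
    "set_integrable rn {x..<y} (\<lambda>x. ft x + gt x)" using F G by simp_all
  show "f1 y + g1 y = f1 x + g1 x + (LINT t:{x..<y}|ch. f t + g t) - (LINT t:{x..<y}|rp. ft t + gt t) + (LINT t:{x..<y}|rn. ft t + gt t)"
    unfolding qd_onD(5)[OF f *] qd_onD(5)[OF g *] using F G by simp
qed

lemma qd_on_cmult:
  assumes f: "qd_on A f f1 ft" 
  shows "qd_on A (\<lambda>x. c * f x) (\<lambda>x. c * f1 x) (\<lambda>x. c * ft x)"
proof (rule qd_onI)
  show "ac_on sg A (\<lambda>x. c * f x) (\<lambda>x. c * f1 x)" by (rule ac_on_cmult[OF qd_onD(1)[OF f]])
  fix x y assume *: "x \<in> A" "y \<in> A" "x \<le> y"
  note F = qd_onD(2-4)[OF f *]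
  show "set_integrable ch {x..<y} (\<lambda>x. c * f x)" "set_integrable rp {x..<y} (\<lambda>x. c * ft x)"
    "set_integrable rn {x..<y} (\<lambda>x. c * ft x)" using F by simp_all
  show "c * f1 y = c * f1 x + (LINT t:{x..<y}|ch. c * f t) - (LINT t:{x..<y}|rp. c * ft t) + (LINT t:{x..<y}|rn. c * ft t)"
    unfolding qd_onD(5)[OF f *] by (simp add: algebra_simps)
qed

lemma qd_on_cnj:
  assumes f: "qd_on A f f1 ft" 
  shows "qd_on A (\<lambda>x. cnj (f x)) (\<lambda>x. cnj (f1 x)) (\<lambda>x. cnj (ft x))"
proof (rule qd_onI)
  show "ac_on sg A (\<lambda>x. cnj (f x)) (\<lambda>x. cnj (f1 x))" by (rule ac_on_cnj[OF qd_onD(1)[OF f]])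
  fix x y assume *: "x \<in> A" "y \<in> A" "x \<le> y"
  note F = qd_onD(2-4)[OF f *]
  show "set_integrable ch {x..<y} (\<lambda>x. cnj (f x))" "set_integrable rp {x..<y} (\<lambda>x. cnj (ft x))"
    "set_integrable rn {x..<y} (\<lambda>x. cnj (ft x))" using F by (auto intro: set_integrable_cnj)
  show "cnj (f1 y) = cnj (f1 x) + (LINT t:{x..<y}|ch. cnj (f t)) - (LINT t:{x..<y}|rp. cnj (ft t)) + (LINT t:{x..<y}|rn. cnj (ft t))"
    unfolding qd_onD(5)[OF f *] set_integral_cnj by simp
qed

lemma qd_on_cong:
  assumes Q: "qd_on A f f1 ft" and A: "\<And>x y. x \<in> A \<Longrightarrow> y \<in> A \<Longrightarrow> {x..<y} \<subseteq> A"
    and e: "\<And>x. x \<in> A \<Longrightarrow> f x = g x" "\<And>x. x \<in> A \<Longrightarrow> f1 x = g1 x" "\<And>x. x \<in> A \<Longrightarrow> ft x = gt x"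
  shows "qd_on A g g1 gt"
proof (rule qd_onI)
  show "ac_on sg A g g1" by (rule ac_on_cong[OF qd_onD(1)[OF Q] sets_borel(3) A e(1,2)])
  fix x y assume *: "x \<in> A" "y \<in> A" "x \<le> y"
  have fg: "f t = g t" and fgt: "ft t = gt t" if "t \<in> {x..<y}" for t
    using A[OF *(1,2)] e that by blast+
  show "set_integrable ch {x..<y} g" by (rule set_integrable_congI[OF qd_onD(2)[OF Q *] fg])
  show "set_integrable rp {x..<y} gt" by (rule set_integrable_congI[OF qd_onD(3)[OF Q *] fgt])
  show "set_integrable rn {x..<y} gt" by (rule set_integrable_congI[OF qd_onD(4)[OF Q *] fgt])
  have i: "(LINT t:{x..<y}|ch. g t) = (LINT t:{x..<y}|ch. f t)" "(LINT t:{x..<y}|rp. gt t) = (LINT t:{x..<y}|rp. ft t)"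
    "(LINT t:{x..<y}|rn. gt t) = (LINT t:{x..<y}|rn. ft t)"
    by (rule set_lebesgue_integral_cong; use fg fgt sets_borel in auto)+
  show "g1 y = g1 x + (LINT t:{x..<y}|ch. g t) - (LINT t:{x..<y}|rp. gt t) + (LINT t:{x..<y}|rn. gt t)"
    unfolding i using qd_onD(5)[OF Q *] e(2)[OF *(1)] e(2)[OF *(2)] by simp
qed

section \<open>Measurability and square integrability on subsets of the interval\<close>

lemma I_co: "x \<in> I \<Longrightarrow> y \<in> I \<Longrightarrow> {x..<y} \<subseteq> I"
  by (rule subset_trans[OF _ Icc_subset[of x y]]) auto

text \<open>Values off \<open>I\<close> are arbitrary, so only the cut-off function can be expected
  to be measurable. Using \<open>borel\<close> lets one statement serve all four measures, which
  have the same measurable sets.\<close>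

definition meas :: "(real \<Rightarrow> complex) \<Rightarrow> bool" where
  "meas f \<longleftrightarrow> (\<lambda>x. indicat_real I x *\<^sub>R f x) \<in> borel_measurable borel"

lemma meas_measurable:
  assumes "meas f" "A \<in> sets borel" "A \<subseteq> I" "sets M = sets borel"
  shows "(\<lambda>x. indicat_real A x *\<^sub>R f x) \<in> borel_measurable M"
proof -
  have "(\<lambda>x. indicat_real A x *\<^sub>R f x) = (\<lambda>x. indicat_real A x *\<^sub>R (indicat_real I x *\<^sub>R f x))"
    using assms(3) by (auto simp: indicator_def fun_eq_iff)
  also have "\<dots> \<in> borel_measurable borel" using assms(1,2) unfolding meas_def by measurable
  finally show ?thesis using assms(4) by (simp cong: measurable_cong_sets)
qed

lemma meas_compose:
  assumes "meas f" "meas g" "continuous_on UNIV (\<lambda>p. F (fst p) (snd p) :: complex)"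
  shows "meas (\<lambda>x. F (f x) (g x))"
proof -
  have c: "(\<lambda>p. F (fst p) (snd p)) \<in> borel_measurable borel" using assms(3) by (rule borel_measurable_continuous_onI)
  have p: "(\<lambda>x. (indicat_real I x *\<^sub>R f x, indicat_real I x *\<^sub>R g x)) \<in> borel_measurable borel"
    using assms(1,2) unfolding meas_def by (intro borel_measurable_Pair)
  have "(\<lambda>x. F (indicat_real I x *\<^sub>R f x) (indicat_real I x *\<^sub>R g x)) \<in> borel_measurable borel"
    using measurable_compose[OF p c] by simp
  \<comment> \<open>The second cut-off is there because \<open>F\<close> need not vanish at the
    origin.\<close>
  then have "(\<lambda>x. indicat_real I x *\<^sub>R F (indicat_real I x *\<^sub>R f x) (indicat_real I x *\<^sub>R g x)) \<in> borel_measurable borel"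
    by measurable
  also have "(\<lambda>x. indicat_real I x *\<^sub>R F (indicat_real I x *\<^sub>R f x) (indicat_real I x *\<^sub>R g x)) = (\<lambda>x. indicat_real I x *\<^sub>R F (f x) (g x))"
    by (auto simp: indicator_def fun_eq_iff)
  finally show ?thesis unfolding meas_def .
qed

lemma meas_add: "meas f \<Longrightarrow> meas g \<Longrightarrow> meas (\<lambda>x. f x + g x)"
  by (rule meas_compose) (auto intro!: continuous_intros)

lemma meas_diff: "meas f \<Longrightarrow> meas g \<Longrightarrow> meas (\<lambda>x. f x - g x)"
  by (rule meas_compose) (auto intro!: continuous_intros)

lemma meas_mult: "meas f \<Longrightarrow> meas g \<Longrightarrow> meas (\<lambda>x. f x * g x)"
  by (rule meas_compose) (auto intro!: continuous_intros)

lemma meas_const: "meas (\<lambda>x. c)"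
  unfolding meas_def by measurable

lemma meas_cmult: "meas f \<Longrightarrow> meas (\<lambda>x. c * f x)"
  by (rule meas_mult[OF meas_const])

lemma meas_if: "meas f \<Longrightarrow> meas g \<Longrightarrow> S \<in> sets borel \<Longrightarrow> meas (\<lambda>x. if x \<in> S then f x else g x)"
proof -
  assume *: "meas f" "meas g" and [measurable]: "S \<in> sets borel"
  have "(\<lambda>x. indicat_real I x *\<^sub>R (if x \<in> S then f x else g x)) =
        (\<lambda>x. if x \<in> S then indicat_real I x *\<^sub>R f x else indicat_real I x *\<^sub>R g x)" by auto
  also have "\<dots> \<in> borel_measurable borel" using * unfolding meas_def by measurable
  finally show ?thesis unfolding meas_def .
qed

lemma ac_on_meas: "ac_on M I f h \<Longrightarrow> sets M = sets borel \<Longrightarrow> meas h"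
  unfolding meas_def by (rule loc_int_measurable[OF loc_intI[OF _ ac_onD(1)] _ ab])

lemma qd_on_meas:
  assumes "qd_on I f f1 ft" shows "meas f" "meas f1" "meas ft"
proof -
  show "meas f1" by (rule ac_on_meas[OF qd_onD(1)[OF assms] sets_borel(3)])
  have "loc_int a b ch f" by (rule loc_intI[OF sets_borel(4) qd_onD(2)[OF assms]])
  then show "meas f" unfolding meas_def by (rule loc_int_measurable[OF _ sets_borel(4) ab])
  have "loc_int a b rp ft" by (rule loc_intI[OF sets_borel(1) qd_onD(3)[OF assms]])
  then show "meas ft" unfolding meas_def by (rule loc_int_measurable[OF _ sets_borel(1) ab])
qed

lemma L2_cmult: "L2_on M A f \<Longrightarrow> L2_on M A (\<lambda>x. c * f x)"
  unfolding L2_on_def by (simp add: norm_mult power_mult_distrib)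

lemma meas_real:
  assumes "meas f" "A \<in> sets borel" "A \<subseteq> I" "sets M = sets borel"
  shows "(\<lambda>x. indicat_real A x *\<^sub>R (cmod (f x))^2) \<in> borel_measurable M"
    "(\<lambda>x. indicat_real A x *\<^sub>R cmod (f x)) \<in> borel_measurable M"
proof -
  have "(\<lambda>x. indicat_real A x *\<^sub>R cmod (f x)) = (\<lambda>x. cmod (indicat_real A x *\<^sub>R f x))"
    by (auto simp: indicator_def fun_eq_iff)
  also have "\<dots> \<in> borel_measurable M" using meas_measurable[OF assms] by measurable
  finally show 1: "(\<lambda>x. indicat_real A x *\<^sub>R cmod (f x)) \<in> borel_measurable M" .
  have "(\<lambda>x. indicat_real A x *\<^sub>R (cmod (f x))^2) = (\<lambda>x. (indicat_real A x *\<^sub>R cmod (f x))^2)"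
    by (auto simp: indicator_def fun_eq_iff)
  then show "(\<lambda>x. indicat_real A x *\<^sub>R (cmod (f x))^2) \<in> borel_measurable M" using 1 by simp
qed

lemma L2_bound:
  assumes "set_integrable M A k" "meas f" "A \<in> sets borel" "A \<subseteq> I" "sets M = sets borel"
    and "\<And>x. x \<in> A \<Longrightarrow> (cmod (f x))^2 \<le> k x"
  shows "L2_on M A f"
  unfolding L2_on_def
  by (rule set_integrable_bound[OF assms(1)])
    (use meas_real(1)[OF assms(2-5)] assms(6) in \<open>auto simp: set_borel_measurable_def intro: order_trans[OF _ abs_ge_self]\<close>)

lemma sq_add_le: "(cmod (u + v))^2 \<le> 2 * (cmod u)^2 + 2 * (cmod v)^2"
proof -
  have "(cmod (u + v))^2 \<le> (cmod u + cmod v)^2" by (intro power_mono norm_triangle_ineq) auto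
  also have "\<dots> \<le> 2 * (cmod u)^2 + 2 * (cmod v)^2"
    using zero_le_power2[of "cmod u - cmod v"] by (simp add: power2_eq_square algebra_simps)
  finally show ?thesis .
qed

lemma L2_add:
  assumes "L2_on M A f" "L2_on M A g" "meas f" "meas g" "A \<in> sets borel" "A \<subseteq> I" "sets M = sets borel"
  shows "L2_on M A (\<lambda>x. f x + g x)"
proof (rule L2_bound[OF _ meas_add[OF assms(3,4)] assms(5-7)])
  show "set_integrable M A (\<lambda>x. 2 * (cmod (f x))^2 + 2 * (cmod (g x))^2)"
    using assms(1,2) unfolding L2_on_def by simp
qed (rule sq_add_le)

lemma L2_mono: "L2_on M A f \<Longrightarrow> B \<subseteq> A \<Longrightarrow> B \<in> sets borel \<Longrightarrow> sets M = sets borel \<Longrightarrow> L2_on M B f"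
  unfolding L2_on_def by (rule set_integrable_subset) simp_all

lemma L2_prod:
  assumes "L2_on M A f" "L2_on M A g" "meas f" "meas g" "A \<in> sets borel" "A \<subseteq> I" "sets M = sets borel"
  shows "set_integrable M A (\<lambda>x. f x * g x)"
proof (rule set_integrable_bound)
  show "set_integrable M A (\<lambda>x. (cmod (f x))^2 + (cmod (g x))^2)"
    by (rule set_integral_add(1)[OF assms(1,2)[unfolded L2_on_def]])
  show "set_borel_measurable M A (\<lambda>x. f x * g x)" 
    unfolding set_borel_measurable_def by (rule meas_measurable[OF meas_mult[OF assms(3,4)] assms(5-7)])
  have "cmod (f x * g x) \<le> norm ((cmod (f x))^2 + (cmod (g x))^2)" for x
  proof -
    have "2 * (cmod (f x) * cmod (g x)) \<le> (cmod (f x))^2 + (cmod (g x))^2"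
      using zero_le_power2[of "cmod (f x) - cmod (g x)"] by (simp add: power2_eq_square algebra_simps)
    moreover have "0 \<le> cmod (f x) * cmod (g x)" by simp
    ultimately have "cmod (f x) * cmod (g x) \<le> (cmod (f x))^2 + (cmod (g x))^2" by linarith
    then show ?thesis by (simp add: norm_mult)
  qed
  then show "AE x in M. x \<in> A \<longrightarrow> norm (f x * g x) \<le> norm ((cmod (f x))^2 + (cmod (g x))^2)" by simp
qed

lemma L2_compact:
  assumes "meas f" "x \<in> I" "y \<in> I" "loc_finite_on a b M" and B: "\<And>s. s \<in> {x..y} \<Longrightarrow> cmod (f s) \<le> B"
  shows "L2_on M {x..y} f"
proof (rule L2_bound[where k="\<lambda>_. B^2"])
  show "set_integrable M {x..y} (\<lambda>_. B\<^sup>2)"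
    unfolding set_integrable_def using assms(2-4) unfolding loc_finite_on_def
    by (auto intro!: integrable_mult_left integrable_real_indicator simp: )
  show "(cmod (f s))\<^sup>2 \<le> B\<^sup>2" if "s \<in> {x..y}" for s using B[OF that] by (intro power_mono) auto
qed (use assms Icc_subset in \<open>auto simp: loc_finite_on_def\<close>)

end

section \<open>The space H1\<close>

text \<open>Open left half-lines form an intersection-stable generator of the Borel sets, so the
  vanishing of the integrals spreads to all Borel sets. The total integral is a separate assumption
  since the whole line, which complements refer to, is no half-line.\<close>

lemma AE_zero_of_interval_integrals:
  fixes D :: "real \<Rightarrow> complex"
  assumes sf: "sigma_finite_measure M" and D: "integrable M D" and sets: "sets M = sets borel"
    and z: "\<And>t. (LINT x:{..<t}|M. D x) = 0" and tot: "(LINT x|M. D x) = 0"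
  shows "AE x in M. D x = 0"
proof (rule sigma_finite_measure.density_zero[OF sf D])
  have i: "set_integrable M A D" if "A \<in> sets borel" for A
    unfolding set_integrable_def using D that sets by (intro integrable_mult_indicator) auto
  have UN: "(LINT x:UNIV|M. D x) = 0" using tot by (simp add: set_lebesgue_integral_def)
  have S1: "Int_stable (range lessThan :: real set set)"
  proof (rule Int_stableI)
    fix A B :: "real set" assume "A \<in> range lessThan" "B \<in> range lessThan"
    then obtain r s where "A = {..<r}" "B = {..<s}" by auto
    then have "A \<inter> B = {..<min r s}" by auto
    then show "A \<inter> B \<in> range lessThan" by (rule range_eqI)
  qed
  have S2: "range lessThan \<subseteq> Pow (UNIV::real set)" by auto
  fix A assume "A \<in> sets M"
  then have "A \<in> sigma_sets UNIV (range lessThan :: real set set)"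
    unfolding sets borel_Iio by simp
  then show "(LINT x:A|M. D x) = 0"
  proof (induction rule: sigma_sets_induct_disjoint[OF S1 S2, consumes 1, case_names basic empty compl union])
    case (basic A)
    then show ?case using z by auto
  next
    case empty
    then show ?case by (simp add: set_lebesgue_integral_def)
  next
    case (compl A)
    have A: "A \<in> sets borel" using compl(1) unfolding borel_Iio by simp
    have "(LINT x:A \<union> (UNIV - A)|M. D x) = (LINT x:A|M. D x) + (LINT x:UNIV - A|M. D x)"
      by (rule set_integral_Un) (use i A in auto)
    then show ?case using compl UN by simp
  next
    case (union A)
    have A: "A i \<in> sets borel" for i using union(2) unfolding borel_Iio by auto
    have "(LINT x:(\<Union>i. A i)|M. D x) = (\<Sum>i. (LINT x:(A i)|M. D x))"
      by (rule lebesgue_integral_countable_add)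
        (use union(1) A sets i in \<open>auto simp: disjoint_family_on_def\<close>)
    then show ?case using union(3) by simp
  qed
qed

lemma le_one_plus_square:
  fixes t :: real assumes "0 \<le> t" shows "t \<le> 1 + t^2"
proof -
  have "0 \<le> (t - 1)^2" by simp
  then have "2 * t \<le> 1 + t^2" by (simp add: power2_diff)
  then show ?thesis using assms by linarith
qed

context left_definite begin

lemma I_exhaustion:
  obtains l u where "I = (\<Union>i::nat. {l i..u i})" "incseq u" "decseq l" "\<And>i. l i \<in> I" "\<And>i. u i \<in> I"
    "\<And>x. x \<in> I \<Longrightarrow> \<exists>i. l i < x" "\<And>x. x \<in> I \<Longrightarrow> \<exists>i. x < u i"
  by (rule Ivl_exhaustion[OF ab]; rule that; assumption)

lemma AE_Ivl_intervals:
  assumes "\<And>x y. x \<in> I \<Longrightarrow> y \<in> I \<Longrightarrow> x \<le> y \<Longrightarrow> AE t in M. t \<in> {x..<y} \<longrightarrow> Q t"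
  shows "AE t in M. t \<in> I \<longrightarrow> Q t"
proof -
  obtain l u where lu: "I = (\<Union>i::nat. {l i..u i})" "incseq u" "decseq l" "\<And>i. l i \<in> I" "\<And>i. u i \<in> I"
    "\<And>x. x \<in> I \<Longrightarrow> \<exists>i. l i < x" "\<And>x. x \<in> I \<Longrightarrow> \<exists>i. x < u i"
    by (rule I_exhaustion; rule that; assumption)
  have "AE t in M. t \<in> {l i..<u j} \<longrightarrow> Q t" for i j
    by (cases "l i \<le> u j") (use assms[OF lu(4)[of i] lu(5)[of j]] in simp_all)
  then have "AE t in M. \<forall>i j. t \<in> {l i..<u j} \<longrightarrow> Q t" unfolding AE_all_countable by blast
  then show ?thesis
  proof eventually_elim
    case (elim t)
    show ?case
    proof
      assume t: "t \<in> I"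
      obtain i where "l i < t" using lu(6) t by blast
      moreover obtain j where "t < u j" using lu(7) t by blast
      ultimately show "Q t" using elim by (meson atLeastLessThan_iff less_imp_le)
    qed
  qed
qed

text \<open>Over each [p,t) both derivatives integrate to the same increment of \<open>f\<close>.
  This makes square integrability and the norm independent of the derivative that is used.\<close>

lemma ac_on_derivative_unique:
  assumes "ac_on sg I f h" "ac_on sg I f k"
  shows "AE x in sg. x \<in> I \<longrightarrow> h x = k x"
proof (rule AE_Ivl_intervals)
  fix p q assume pq: "p \<in> I" "q \<in> I" "p \<le> q"
  define D where "D = (\<lambda>x. indicat_real {p..<q} x *\<^sub>R (h x - k x))"
  have i: "set_integrable sg {p..<q} h" "set_integrable sg {p..<q} k"
    using ac_onD(1)[OF assms(1) pq] ac_onD(1)[OF assms(2) pq] by auto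
  have z: "(LINT x:{p..<t}|sg. h x - k x) = 0" if t: "p \<le> t" "t \<le> q" for t
  proof -
    have tI: "t \<in> I" by (rule subsetD[OF Icc_subset[OF pq(1) pq(2)]]) (use t in simp)
    have "(LINT x:{p..<t}|sg. h x) = f t - f p" "(LINT x:{p..<t}|sg. k x) = f t - f p"
      using ac_onD(2)[OF assms(1) pq(1) tI t(1)] ac_onD(2)[OF assms(2) pq(1) tI t(1)] by auto
    then show ?thesis
      using ac_onD(1)[OF assms(1) pq(1) tI t(1)] ac_onD(1)[OF assms(2) pq(1) tI t(1)] by simp
  qed
  have "AE x in sg. D x = 0"
  proof (rule AE_zero_of_interval_integrals[OF sf(3) _ sets_borel(3)])
    show "integrable sg D" unfolding D_def using set_integral_diff(1)[OF i] by (simp add: set_integrable_def)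
    show "(LINT x|sg. D x) = 0" unfolding D_def using z[OF pq(3) order_refl] by (simp add: set_lebesgue_integral_def)
    fix t
    show "(LINT x:{..<t}|sg. D x) = 0"
    proof (cases "t \<le> p")
      case True
      then have "(\<lambda>x. indicat_real {..<t} x *\<^sub>R D x) = (\<lambda>x. 0)" by (auto simp: D_def indicator_def)
      then show ?thesis by (simp only: set_lebesgue_integral_def Bochner_Integration.integral_zero)
    next
      case False
      have "indicat_real {..<t} x *\<^sub>R D x = indicat_real {p..<min t q} x *\<^sub>R (h x - k x)" for x
        by (auto simp: D_def indicator_def)
      then show ?thesis using z[of "min t q"] False pq(3) by (simp add: set_lebesgue_integral_def)
    qed
  qed
  then show "AE x in sg. x \<in> {p..<q} \<longrightarrow> h x = k x" by eventually_elim (auto simp: D_def indicator_def split: if_splits)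
qed

lemma L2_sg_unique:
  assumes "ac_on sg I f h" "ac_on sg I f k" "A \<in> sets borel" "A \<subseteq> I"
  shows "L2_on sg A h \<longleftrightarrow> L2_on sg A k"
    "(LINT x:A|sg. (cmod (h x))^2) = (LINT x:A|sg. (cmod (k x))^2)"
proof -
  have ae: "AE x in sg. indicat_real A x *\<^sub>R (cmod (h x))\<^sup>2 = indicat_real A x *\<^sub>R (cmod (k x))\<^sup>2"
    using ac_on_derivative_unique[OF assms(1,2)]
  proof eventually_elim
    case (elim x) then show ?case using assms(4) by (auto simp: indicator_def)
  qed
  have m: "(\<lambda>x. indicat_real A x *\<^sub>R (cmod (h x))\<^sup>2) \<in> borel_measurable sg"
    "(\<lambda>x. indicat_real A x *\<^sub>R (cmod (k x))\<^sup>2) \<in> borel_measurable sg"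
    by (rule meas_real[OF ac_on_meas[OF _ sets_borel(3)] assms(3,4) sets_borel(3)]; fact)+
  show "L2_on sg A h \<longleftrightarrow> L2_on sg A k"
    unfolding L2_on_def set_integrable_def by (rule integrable_cong_AE[OF m ae])
  show "(LINT x:A|sg. (cmod (h x))^2) = (LINT x:A|sg. (cmod (k x))^2)"
    unfolding set_lebesgue_integral_def by (rule integral_cong_AE[OF m ae])
qed

text \<open>\<open>u\<close> is bounded as a primitive over \<open>sg\<close>; for \<open>u1\<close>
  the three integrals that make it up are bounded one by one.\<close>

lemma qd_on_bounded:
  assumes Q: "qd_on I u u1 ut" and xy: "x \<in> I" "y \<in> I"
  obtains B where "\<And>s. s \<in> {x..y} \<Longrightarrow> cmod (u s) \<le> B" "\<And>s. s \<in> {x..y} \<Longrightarrow> cmod (u1 s) \<le> B"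
proof (cases "x \<le> y")
  case False
  then show ?thesis using that by simp
next
  case True
  note sub = Icc_subset[OF xy]
  obtain B0 where B0: "\<And>s. s \<in> {x..y} \<Longrightarrow> cmod (u s) \<le> B0"
    using ac_on_bounded[OF qd_onD(1)[OF Q] xy sub sets_borel(3)] by blast
  have mem: "x \<in> {x..y}" "y \<in> {x..y}" using True by auto
  have bd: "\<exists>B. \<forall>s\<in>{x..y}. cmod (LINT t:{x..<s}|M. k t) \<le> B" if k: "set_integrable M {x..<y} k" "sets M = sets borel" for M k
  proof -
    obtain B where "\<And>s. s \<in> {x..y} \<Longrightarrow> cmod (0 + (LINT t:{x..<s}|M. k t)) \<le> B"
      by (rule ac_on_bounded[OF ac_on_integral[OF k, of 0] mem subset_refl k(2)]; rule that; assumption)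
    then have "\<forall>s\<in>{x..y}. cmod (LINT t:{x..<s}|M. k t) \<le> B" by simp
    then show ?thesis ..
  qed
  obtain B1 where B1: "\<forall>s\<in>{x..y}. cmod (LINT t:{x..<s}|ch. u t) \<le> B1"
    using bd[OF qd_onD(2)[OF Q xy True] sets_borel(4)] by blast
  obtain B2 where B2: "\<forall>s\<in>{x..y}. cmod (LINT t:{x..<s}|rp. ut t) \<le> B2"
    using bd[OF qd_onD(3)[OF Q xy True] sets_borel(1)] by blast
  obtain B3 where B3: "\<forall>s\<in>{x..y}. cmod (LINT t:{x..<s}|rn. ut t) \<le> B3"
    using bd[OF qd_onD(4)[OF Q xy True] sets_borel(2)] by blast
  define B where "B = max B0 (cmod (u1 x) + B1 + B2 + B3)"
  have "cmod (u1 s) \<le> B" if s: "s \<in> {x..y}" for s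
  proof -
    have sI: "s \<in> I" "x \<le> s" using s sub by auto
    have "cmod (u1 s) \<le> cmod (u1 x) + cmod (LINT t:{x..<s}|ch. u t) + cmod (LINT t:{x..<s}|rp. ut t) + cmod (LINT t:{x..<s}|rn. ut t)"
      unfolding qd_onD(5)[OF Q xy(1) sI]
      by (rule order_trans[OF norm_triangle_ineq add_right_mono[OF order_trans[OF norm_triangle_ineq4 add_right_mono[OF norm_triangle_ineq]]]])
    also have "\<dots> \<le> cmod (u1 x) + B1 + B2 + B3" using B1 B2 B3 s by (intro add_mono) auto
    finally show ?thesis by (simp add: B_def)
  qed
  moreover have "cmod (u s) \<le> B" if "s \<in> {x..y}" for s using B0[OF that] by (simp add: B_def)
  ultimately show ?thesis using that by blast
qed

text \<open>The square of the H^1 norm, with the derivative as an argument; \<open>H1_norm\<close>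
  selects one by \<open>SOME\<close>.\<close>

definition energy :: "(real \<Rightarrow> complex) \<Rightarrow> (real \<Rightarrow> complex) \<Rightarrow> real" where
  "energy f h = (LINT x:I|ch. (cmod (f x))\<^sup>2) + (LINT x:I|sg. (cmod (h x))\<^sup>2)"

lemma energy_nonneg: "0 \<le> energy f h"
  unfolding energy_def set_lebesgue_integral_def by (intro add_nonneg_nonneg integral_nonneg_AE) auto

lemma H1_norm_eq:
  assumes "ac_on sg I f h" shows "H1_norm a b sg ch f = sqrt (energy f h)"
proof -
  have "AC_deriv a b sg f (SOME h. AC_deriv a b sg f h)"
    by (rule someI[of _ h]) (use assms AC_iff in blast)
  then have "ac_on sg I f (SOME h. AC_deriv a b sg f h)" unfolding AC_iff .
  from L2_sg_unique(2)[OF this assms Ivl_borel subset_refl]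
  show ?thesis unfolding H1_norm_def energy_def by simp
qed

definition H1 :: "(real \<Rightarrow> complex) \<Rightarrow> (real \<Rightarrow> complex) \<Rightarrow> bool" where
  "H1 f h \<longleftrightarrow> ac_on sg I f h \<and> L2_on ch I f \<and> L2_on sg I h"

lemma in_H1_iff:
  assumes "ac_on sg I f h" shows "in_H1 a b sg ch f \<longleftrightarrow> H1 f h"
  unfolding in_H1_def H1_def AC_iff using L2_sg_unique(1)[OF assms _ Ivl_borel subset_refl] assms by blast

lemma in_H1E:
  assumes "in_H1 a b sg ch f" obtains h where "H1 f h"
  using assms unfolding in_H1_def H1_def AC_iff by blast

lemma H1_in: "H1 f h \<Longrightarrow> in_H1 a b sg ch f"
  unfolding in_H1_def H1_def AC_iff by blast

text \<open>The factor 2 comes from |u + v|^2 <= 2 |u|^2 + 2 |v|^2. It takes the place of the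
  triangle inequality and only worsens constants in the Neumann series.\<close>

lemma H1_add:
  assumes "H1 f h" "H1 g k" "meas f" "meas g"
  shows "H1 (\<lambda>x. f x + g x) (\<lambda>x. h x + k x)" "energy (\<lambda>x. f x + g x) (\<lambda>x. h x + k x) \<le> 2 * energy f h + 2 * energy g k"
proof -
  have m: "meas h" "meas k" using assms(1,2) ac_on_meas sets_borel unfolding H1_def by blast+
  have L: "L2_on ch I (\<lambda>x. f x + g x)" "L2_on sg I (\<lambda>x. h x + k x)"
    using assms m unfolding H1_def by (auto intro!: L2_add sets_borel)
  then show "H1 (\<lambda>x. f x + g x) (\<lambda>x. h x + k x)" using ac_on_add assms unfolding H1_def by blast
  have *: "(LINT x:I|M. (cmod (f x + g x))\<^sup>2) \<le> 2 * (LINT x:I|M. (cmod (f x))\<^sup>2) + 2 * (LINT x:I|M. (cmod (g x))\<^sup>2)"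
    if "L2_on M I f" "L2_on M I g" "L2_on M I (\<lambda>x. f x + g x)" for M f g
  proof -
    have "(LINT x:I|M. (cmod (f x + g x))\<^sup>2) \<le> (LINT x:I|M. 2 * (cmod (f x))\<^sup>2 + 2 * (cmod (g x))\<^sup>2)"
      using that unfolding L2_on_def by (intro set_integral_mono sq_add_le set_integral_add(1)) auto
    then show ?thesis using that unfolding L2_on_def by simp
  qed
  show "energy (\<lambda>x. f x + g x) (\<lambda>x. h x + k x) \<le> 2 * energy f h + 2 * energy g k"
    using *[of ch f g] *[of sg h k] L assms unfolding H1_def energy_def by simp
qed

lemma H1_cmult:
  assumes "H1 f h"
  shows "H1 (\<lambda>x. c * f x) (\<lambda>x. c * h x)" "energy (\<lambda>x. c * f x) (\<lambda>x. c * h x) = (cmod c)^2 * energy f h"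
proof -
  show "H1 (\<lambda>x. c * f x) (\<lambda>x. c * h x)"
    using assms ac_on_cmult L2_cmult unfolding H1_def by blast
  show "energy (\<lambda>x. c * f x) (\<lambda>x. c * h x) = (cmod c)^2 * energy f h"
    unfolding energy_def by (simp add: norm_mult power_mult_distrib distrib_left)
qed

text \<open>As \<open>ch\<close> is not zero, some compact interval of an exhaustion carries mass,
  and it keeps its mass when enlarged to contain x and y. Averaging over such an interval controls
  point values by the \<open>ch\<close>-integral of |f|^2.\<close>

lemma ch_pos_interval:
  assumes "x \<in> I" "y \<in> I"
  obtains \<alpha> \<beta> where "\<alpha> \<in> I" "\<beta> \<in> I" "\<alpha> \<le> x" "x \<le> \<beta>" "\<alpha> \<le> y" "y \<le> \<beta>" "0 < measure ch {\<alpha>..\<beta>}"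
proof -
  obtain l u where lu: "I = (\<Union>i::nat. {l i..u i})" "incseq u" "decseq l" "\<And>i. l i \<in> I" "\<And>i. u i \<in> I"
    "\<And>x. x \<in> I \<Longrightarrow> \<exists>i. l i < x" "\<And>x. x \<in> I \<Longrightarrow> \<exists>i. x < u i"
    by (rule I_exhaustion; rule that; assumption)
  have "\<exists>i. emeasure ch {l i..u i} \<noteq> 0"
  proof (rule ccontr)
    assume "\<not> ?thesis"
    then have "(\<Union>i. {l i..u i}) \<in> null_sets ch" using sets_borel by (intro null_sets_UN) auto
    then show False using std lu(1) by (auto simp: standing_def)
  qed
  then obtain i where i: "emeasure ch {l i..u i} \<noteq> 0" by blast
  define \<alpha> where "\<alpha> = min (l i) (min x y)"
  define \<beta> where "\<beta> = max (u i) (max x y)"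
  have ab': "\<alpha> \<in> I" "\<beta> \<in> I" using assms lu(4,5) by (auto simp: \<alpha>_def \<beta>_def min_def max_def)
  have "emeasure ch {l i..u i} \<le> emeasure ch {\<alpha>..\<beta>}"
    by (rule emeasure_mono) (auto simp: sets_borel \<alpha>_def \<beta>_def)
  then have "emeasure ch {\<alpha>..\<beta>} \<noteq> 0" using i by auto
  moreover have "emeasure ch {\<alpha>..\<beta>} < \<infinity>" using lf(4) ab' by (auto simp: loc_finite_on_def)
  ultimately have "0 < measure ch {\<alpha>..\<beta>}" by (auto simp: measure_def enn2real_positive_iff zero_less_iff_neq_zero)
  then show ?thesis by (intro that[OF ab']) (auto simp: \<alpha>_def \<beta>_def)
qed

text \<open>|f(s)| is at most |f(s) - f(t)| + |f(t)|. The first term is bounded by the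
  \<open>sg\<close>-integral of |h|, the second is averaged over t with respect to
  \<open>ch\<close>. Replacing |h| by 1 + |h|^2 and |f| by 1 + |f|^2 makes the energy appear, at the
  price of an additive constant.\<close>

lemma point_bound_affine:
  assumes "x \<in> I" "y \<in> I"
  obtains K where "0 \<le> K" "\<And>f h s. H1 f h \<Longrightarrow> s \<in> {x..y} \<Longrightarrow> cmod (f s) \<le> K * (1 + energy f h)"
proof -
  obtain \<alpha> \<beta> where ab': "\<alpha> \<in> I" "\<beta> \<in> I" "\<alpha> \<le> x" "x \<le> \<beta>" "\<alpha> \<le> y" "y \<le> \<beta>" and c: "0 < measure ch {\<alpha>..\<beta>}"
    by (rule ch_pos_interval[OF assms])
  define c where "c = measure ch {\<alpha>..\<beta>}"
  define S where "S = measure sg {\<alpha>..<\<beta>}"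
  have fc: "emeasure ch {\<alpha>..\<beta>} < \<infinity>" "emeasure sg {\<alpha>..\<beta>} < \<infinity>" using lf ab' by (auto simp: loc_finite_on_def)
  have "emeasure sg {\<alpha>..<\<beta>} \<le> emeasure sg {\<alpha>..\<beta>}" by (rule emeasure_mono) (auto simp: sets_borel)
  then have fs: "emeasure sg {\<alpha>..<\<beta>} < \<infinity>" using fc(2) by (rule le_less_trans)
  have is1: "set_integrable sg {\<alpha>..<\<beta>} (\<lambda>_. 1::real)" and ic1: "set_integrable ch {\<alpha>..\<beta>} (\<lambda>_. r::real)" for r
    unfolding set_integrable_def using fs fc sets_borel by auto
  have c0: "0 < c" "0 \<le> S" using c by (auto simp: c_def S_def)
  have sub: "{\<alpha>..\<beta>} \<subseteq> I" "{\<alpha>..<\<beta>} \<subseteq> I" using Icc_subset[OF ab'(1,2)] I_co[OF ab'(1,2)] by auto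
  \<comment> \<open>The estimate ends with |f(s)| <= 1 + S + e1 + e2 / c, where e1 and e2 are the
    two parts of the energy; the constant dominates each coefficient separately.\<close>
  show ?thesis
  proof (rule that[of "1 + S + 1 + 1 / c"])
    show "0 \<le> 1 + S + 1 + 1 / c" using c0 by simp
    fix f h s assume H: "H1 f h" and "s \<in> {x..y}"
    then have s: "s \<in> {\<alpha>..\<beta>}" using ab' by auto
    have A: "ac_on sg I f h" "L2_on ch I f" "L2_on sg I h" using H unfolding H1_def by auto
    have i2: "set_integrable sg {\<alpha>..<\<beta>} (\<lambda>r. (cmod (h r))^2)" "set_integrable ch {\<alpha>..\<beta>} (\<lambda>r. (cmod (f r))^2)"
      using L2_mono[OF A(3) sub(2) _ sets_borel(3)] L2_mono[OF A(2) sub(1) _ sets_borel(4)] by (auto simp: L2_on_def)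
    define e1 where "e1 = (LINT r:I|sg. (cmod (h r))^2)"
    define e2 where "e2 = (LINT r:I|ch. (cmod (f r))^2)"
    have e0: "0 \<le> e1" "0 \<le> e2" unfolding e1_def e2_def set_lebesgue_integral_def by (intro integral_nonneg_AE; simp)+
    have bh: "(LINT r:{\<alpha>..<\<beta>}|sg. cmod (h r)) \<le> S + e1"
    proof -
      have "(LINT r:{\<alpha>..<\<beta>}|sg. cmod (h r)) \<le> (LINT r:{\<alpha>..<\<beta>}|sg. 1 + (cmod (h r))^2)"
      proof (rule set_integral_mono)
        show "set_integrable sg {\<alpha>..<\<beta>} (\<lambda>r. cmod (h r))"
          by (rule set_integrable_norm[OF ac_onD(1)[OF A(1)]]) (use ab' in auto)
        show "set_integrable sg {\<alpha>..<\<beta>} (\<lambda>r. 1 + (cmod (h r))\<^sup>2)" by (rule set_integral_add(1)[OF is1 i2(1)])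
        show "cmod (h r) \<le> 1 + (cmod (h r))\<^sup>2" for r by (rule le_one_plus_square) simp
      qed
      also have "\<dots> = S + (LINT r:{\<alpha>..<\<beta>}|sg. (cmod (h r))^2)"
        unfolding set_integral_add(2)[OF is1 i2(1)] using sets_borel
        by (simp add: S_def set_lebesgue_integral_def)
      also have "(LINT r:{\<alpha>..<\<beta>}|sg. (cmod (h r))^2) \<le> e1" unfolding e1_def
        by (rule set_integral_mono_set) (use A(3) sub sets_borel in \<open>auto simp: L2_on_def\<close>)
      finally show ?thesis by simp
    qed
    have fst': "cmod (f s) \<le> (1 + S + e1) + (cmod (f t))^2" if t: "t \<in> {\<alpha>..\<beta>}" for t
    proof -
      have "cmod (f s - f t) \<le> S + e1"
        using ac_on_norm_bound[OF A(1) ab'(1,2) sub(1) sets_borel(3) s t] bh by linarith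
      moreover have "cmod (f s) \<le> cmod (f s - f t) + cmod (f t)" using norm_triangle_ineq[of "f s - f t" "f t"] by simp
      moreover have "cmod (f t) \<le> 1 + (cmod (f t))^2"
        by (rule le_one_plus_square) simp
      ultimately show ?thesis by linarith
    qed
    have "(LINT t:{\<alpha>..\<beta>}|ch. cmod (f s)) \<le> (LINT t:{\<alpha>..\<beta>}|ch. (1 + S + e1) + (cmod (f t))^2)"
      by (rule set_integral_mono[OF ic1 set_integral_add(1)[OF ic1 i2(2)] fst'])
    also have "\<dots> = (1 + S + e1) * c + (LINT t:{\<alpha>..\<beta>}|ch. (cmod (f t))^2)"
      unfolding set_integral_add(2)[OF ic1 i2(2)] using sets_borel
      by (simp add: c_def set_lebesgue_integral_def)
    also have "(LINT t:{\<alpha>..\<beta>}|ch. (cmod (f t))^2) \<le> e2" unfolding e2_def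
      by (rule set_integral_mono_set) (use A(2) sub sets_borel in \<open>auto simp: L2_on_def\<close>)
    finally have "cmod (f s) * c \<le> (1 + S + e1) * c + e2"
      using sets_borel by (simp add: c_def set_lebesgue_integral_def mult.commute)
    then have "cmod (f s) \<le> (1 + S + e1) + e2 / c" using c0 by (simp add: field_simps)
    also have "\<dots> \<le> (1 + S + 1 + 1 / c) * (1 + (e1 + e2))"
      using e0 c0 by (simp add: algebra_simps add_divide_distrib)
    finally show "cmod (f s) \<le> (1 + S + 1 + 1 / c) * (1 + energy f h)" unfolding energy_def e1_def e2_def by (simp add: add.commute)
  qed
qed

text \<open>Applying the affine bound to all multiples of f makes it homogeneous, which replaces
  the Cauchy-Schwarz inequality.\<close>

lemma point_bound:
  assumes "x \<in> I" "y \<in> I"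
  obtains K where "0 \<le> K" "\<And>f h s. H1 f h \<Longrightarrow> s \<in> {x..y} \<Longrightarrow> cmod (f s) \<le> K * sqrt (energy f h)"
proof -
  obtain K where K: "0 \<le> K" "\<And>f h s. H1 f h \<Longrightarrow> s \<in> {x..y} \<Longrightarrow> cmod (f s) \<le> K * (1 + energy f h)"
    by (rule point_bound_affine[OF assms]; rule that; assumption)
  show ?thesis
  proof (rule that[of "2 * K"])
    fix f h s assume H: "H1 f h" and s: "s \<in> {x..y}"
    have r: "r * cmod (f s) \<le> K * (1 + r^2 * energy f h)" if "0 \<le> r" for r
      using K(2)[OF H1_cmult(1)[OF H, of "of_real r"] s] that
      unfolding H1_cmult(2)[OF H] by (simp add: norm_mult)
    show "cmod (f s) \<le> 2 * K * sqrt (energy f h)"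
    proof (cases "energy f h = 0")
      case True
      have "cmod (f s) \<le> 0"
      proof (rule ccontr)
        assume n: "\<not> ?thesis"
        \<comment> \<open>At zero energy the bound \<open>K\<close> holds for every multiple of f;
          this multiple is scaled to have absolute value \<open>K + 1\<close> at s.\<close>
        then have "((K + 1) / cmod (f s)) * cmod (f s) \<le> K" using r[of "(K + 1) / cmod (f s)"] True K(1) by simp
        then show False using n by simp
      qed
      then show ?thesis using True by simp
    next
      case False
      then have p: "0 < energy f h" using energy_nonneg[of f h] by simp
      \<comment> \<open>Normalising f to energy 1 turns the affine bound K (1 + 1) into the constant
        2 K.\<close>
      then have "(1 / sqrt (energy f h)) * cmod (f s) \<le> K * (1 + 1)"
        using r[of "1 / sqrt (energy f h)"] by (simp add: power_divide)
      then show ?thesis using p by (simp add: field_simps)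
    qed
  qed (use K in simp)
qed

lemma energy_zero_imp:
  assumes "H1 f h" "energy f h = 0" "s \<in> I" shows "f s = 0"
proof -
  obtain K where K: "0 \<le> K" "\<And>f h t. H1 f h \<Longrightarrow> t \<in> {s..s} \<Longrightarrow> cmod (f t) \<le> K * sqrt (energy f h)"
    by (rule point_bound[OF assms(3,3)]; rule that; assumption)
  show ?thesis using K(2)[OF assms(1), of s] assms(2) by simp
qed

end

section \<open>Boundary forms at an endpoint\<close>

text \<open>The three-term relation between the 2 x 2 minors of four vectors, here the vectors (ft,
  f1) of four pairs at x. It shows how vanishing boundary forms force others to vanish.\<close>

lemma Vw_plucker:
  "Vw f f1 ft g g1 gt x * Vw h h1 ht k k1 kt x + Vw f f1 ft h h1 ht x * Vw k k1 kt g g1 gt x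
    + Vw f f1 ft k k1 kt x * Vw g g1 gt h h1 ht x = 0"
  unfolding Vw_def by algebra

lemma Vw_antisym: "Vw f f1 ft g g1 gt x = - Vw g g1 gt f f1 ft x"
  unfolding Vw_def by algebra

lemma Vw_cnj: "Vw (\<lambda>x. cnj (f x)) (\<lambda>x. cnj (f1 x)) (\<lambda>x. cnj (ft x)) (\<lambda>x. cnj (g x)) (\<lambda>x. cnj (g1 x)) (\<lambda>x. cnj (gt x)) x
   = cnj (Vw f f1 ft g g1 gt x)"
  unfolding Vw_def by simp

lemma Vw_add_left: "Vw (\<lambda>x. f x + h x) (\<lambda>x. f1 x + h1 x) (\<lambda>x. ft x + ht x) g g1 gt x
   = Vw f f1 ft g g1 gt x + Vw h h1 ht g g1 gt x"
  unfolding Vw_def by algebra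

lemma Vw_cmult_left: "Vw (\<lambda>x. c * f x) (\<lambda>x. c * f1 x) (\<lambda>x. c * ft x) g g1 gt x = c * Vw f f1 ft g g1 gt x"
  unfolding Vw_def by algebra

lemma norm_add_two_diff: "cmod (v + p + q - v) \<le> cmod p + cmod q"
  using norm_triangle_ineq[of p q] by (simp add: add.assoc)

text \<open>An endpoint is described by a decreasing sequence of order-convex neighbourhoods with empty
  intersection, which allows both endpoints to be treated at once.\<close>

locale left_definite_end = left_definite +
  fixes D :: "nat \<Rightarrow> real set" and F :: "real filter"
  assumes D_sub: "D n \<subseteq> I" and D_borel: "D n \<in> sets borel" and D_ne: "D n \<noteq> {}"
    and D_conv: "x \<in> D n \<Longrightarrow> y \<in> D n \<Longrightarrow> {x..y} \<subseteq> D n"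
    and D_dec: "decseq D" and D_empty: "(\<Inter>n. D n) = {}"
    and ev_iff: "eventually P F \<longleftrightarrow> (\<exists>n. \<forall>x\<in>D n. P x)"
begin

lemma F_ne: "F \<noteq> bot"
  unfolding trivial_limit_def ev_iff using D_ne by blast

lemma D_mono: "m \<le> n \<Longrightarrow> D n \<subseteq> D m"
  using D_dec by (rule decseqD)

text \<open>The neighbourhoods decrease to the empty set, so the integrals over them tend to 0 by
  continuity from above.\<close>

lemma tail_small:
  fixes k :: "real \<Rightarrow> real"
  assumes k: "set_integrable M (D n) k" and M: "sets M = sets borel" and e: "0 < e"
  obtains m where "n \<le> m" "(LINT x:D m|M. k x) < e"
proof -
  have "(\<lambda>i. LINT x:D (n + i)|M. k x) \<longlonglongrightarrow> (LINT x:(\<Inter>i. D (n + i))|M. k x)"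
  proof (rule set_integral_cont_down)
    show "D (n + i) \<in> sets M" for i using D_borel M by simp
    show "decseq (\<lambda>i. D (n + i))" using D_dec unfolding decseq_def by simp
    show "set_integrable M (D (n + 0)) k" using k by simp
  qed
  moreover have "(\<Inter>i. D (n + i)) = {}"
  proof -
    have "D (n + i) \<subseteq> D i" for i by (rule D_mono) simp
    then show ?thesis using D_empty by blast
  qed
  ultimately have "(\<lambda>i. LINT x:D (n + i)|M. k x) \<longlonglongrightarrow> 0" by (simp add: set_lebesgue_integral_def)
  then have "eventually (\<lambda>i. (LINT x:D (n + i)|M. k x) < e) sequentially" using e by (rule order_tendstoD)
  then obtain i where "(LINT x:D (n + i)|M. k x) < e" by (auto simp: eventually_sequentially)
  then show ?thesis using that[of "n + i"] by simp
qed

definition L2_near where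
  "L2_near n f f1 \<longleftrightarrow> L2_on ch (D n) f \<and> L2_on sg (D n) f1"

lemma L2_near_mono: "L2_near n f f1 \<Longrightarrow> n \<le> m \<Longrightarrow> L2_near m f f1"
  unfolding L2_near_def
  using L2_mono[OF _ D_mono[of n m] D_borel sets_borel(3)] L2_mono[OF _ D_mono[of n m] D_borel sets_borel(4)] by simp

text \<open>The derivative \<open>ft1\<close> of \<open>ft\<close> is carried along because the
  Lagrange identity contains it.\<close>

definition Tmax_near where
  "Tmax_near f f1 ft ft1 \<longleftrightarrow> qd_on I f f1 ft \<and> ac_on sg I ft ft1 \<and> (\<exists>n. L2_near n f f1 \<and> L2_near n ft ft1)"

lemma Tmax_near_meas: assumes "Tmax_near f f1 ft ft1" shows "meas f" "meas f1" "meas ft" "meas ft1"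
proof -
  have Q: "qd_on I f f1 ft" "ac_on sg I ft ft1" using assms unfolding Tmax_near_def by auto
  show "meas f" "meas f1" "meas ft" by (rule qd_on_meas[OF Q(1)])+
  show "meas ft1" by (rule ac_on_meas[OF Q(2) sets_borel(3)])
qed

text \<open>The bound on the oscillation depends on the neighbourhood \<open>D m\<close> but not on
  the two points in it, which is the form needed for a Cauchy criterion.\<close>

lemma lagrange_tail:
  assumes f: "Tmax_near f f1 ft ft1" and g: "Tmax_near g g1 gt gt1"
    and L: "L2_near n f f1" "L2_near n ft ft1" "L2_near n g g1" "L2_near n gt gt1"
  shows "set_integrable sg (D n) (\<lambda>s. cmod (ft1 s * g1 s - gt1 s * f1 s))"
    "set_integrable ch (D n) (\<lambda>s. cmod (ft s * g s - gt s * f s))"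
    "\<And>m x y. n \<le> m \<Longrightarrow> x \<in> D m \<Longrightarrow> y \<in> D m \<Longrightarrow> cmod (Vw f f1 ft g g1 gt y - Vw f f1 ft g g1 gt x)
       \<le> (LINT s:D m|sg. cmod (ft1 s * g1 s - gt1 s * f1 s)) + (LINT s:D m|ch. cmod (ft s * g s - gt s * f s))"
proof -
  note mf = Tmax_near_meas[OF f] and mg = Tmax_near_meas[OF g]
  have i1: "set_integrable sg (D n) (\<lambda>s. ft1 s * g1 s - gt1 s * f1 s)"
    by (intro set_integral_diff(1) L2_prod) (use L mf mg D_borel D_sub sets_borel in \<open>auto simp: L2_near_def\<close>)
  have i2: "set_integrable ch (D n) (\<lambda>s. ft s * g s - gt s * f s)"
    by (intro set_integral_diff(1) L2_prod) (use L mf mg D_borel D_sub sets_borel in \<open>auto simp: L2_near_def\<close>)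
  note j1 = set_integrable_norm[OF i1] and j2 = set_integrable_norm[OF i2]
  have Q: "qd_on I f f1 ft" "ac_on sg I ft ft1" "qd_on I g g1 gt" "ac_on sg I gt gt1" using f g unfolding Tmax_near_def by auto
  have *: "cmod (Vw f f1 ft g g1 gt y - Vw f f1 ft g g1 gt x)
       \<le> (LINT s:D m|sg. cmod (ft1 s * g1 s - gt1 s * f1 s)) + (LINT s:D m|ch. cmod (ft s * g s - gt s * f s))"
    if m: "n \<le> m" and xy: "x \<in> D m" "y \<in> D m" "x \<le> y" for m x y
  proof -
    have sub: "{x..y} \<subseteq> I" using Icc_subset D_sub xy by blast
    have sub2: "{x..<y} \<subseteq> D m" using D_conv[OF xy(1,2)] by auto
    note l = lagrange[OF Q xy(3) sub]
    have k1: "set_integrable sg (D m) (\<lambda>s. cmod (ft1 s * g1 s - gt1 s * f1 s))"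
      by (rule set_integrable_subset[OF j1]) (use D_borel sets_borel D_mono[OF m] in auto)
    have k2: "set_integrable ch (D m) (\<lambda>s. cmod (ft s * g s - gt s * f s))"
      by (rule set_integrable_subset[OF j2]) (use D_borel sets_borel D_mono[OF m] in auto)
    have "cmod (Vw f f1 ft g g1 gt y - Vw f f1 ft g g1 gt x)
      \<le> cmod (LINT s:{x..<y}|sg. ft1 s * g1 s - gt1 s * f1 s) + cmod (LINT s:{x..<y}|ch. ft s * g s - gt s * f s)"
      unfolding l(3) by (rule norm_add_two_diff)
    also have "\<dots> \<le> (LINT s:{x..<y}|sg. cmod (ft1 s * g1 s - gt1 s * f1 s)) + (LINT s:{x..<y}|ch. cmod (ft s * g s - gt s * f s))"
      by (intro add_mono set_integral_norm_bound l(1,2))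
    also have "\<dots> \<le> (LINT s:D m|sg. cmod (ft1 s * g1 s - gt1 s * f1 s)) + (LINT s:D m|ch. cmod (ft s * g s - gt s * f s))"
      by (rule add_mono[OF set_integral_mono_set[OF k1 sub2] set_integral_mono_set[OF k2 sub2]]) (simp_all add: sets_borel)
    finally show ?thesis .
  qed
  show "set_integrable sg (D n) (\<lambda>s. cmod (ft1 s * g1 s - gt1 s * f1 s))"
    "set_integrable ch (D n) (\<lambda>s. cmod (ft s * g s - gt s * f s))"
    by (rule j1, rule j2)
  fix m x y assume m: "n \<le> m" "x \<in> D m" "y \<in> D m"
  show "cmod (Vw f f1 ft g g1 gt y - Vw f f1 ft g g1 gt x)
     \<le> (LINT s:D m|sg. cmod (ft1 s * g1 s - gt1 s * f1 s)) + (LINT s:D m|ch. cmod (ft s * g s - gt s * f s))"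
  proof (cases "x \<le> y")
    case True then show ?thesis by (rule *[OF m])
  next
    case False
    then have "y \<le> x" by simp
    then show ?thesis using *[OF m(1,3,2)] by (simp add: norm_minus_commute)
  qed
qed

text \<open>The oscillation over \<open>D m\<close> is at most a tail of two convergent integrals,
  so the form satisfies the Cauchy criterion at the endpoint.\<close>

lemma Vw_convergent:
  assumes f: "Tmax_near f f1 ft ft1" and g: "Tmax_near g g1 gt gt1"
  obtains L where "((\<lambda>x. Vw f f1 ft g g1 gt x) \<longlongrightarrow> L) F"
proof -
  define V where "V = (\<lambda>x. Vw f f1 ft g g1 gt x)"
  obtain n1 n2 where L: "L2_near n1 f f1" "L2_near n1 ft ft1" "L2_near n2 g g1" "L2_near n2 gt gt1"
    using f g unfolding Tmax_near_def by blast
  define n where "n = max n1 n2"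
  have "L2_near n f f1" "L2_near n ft ft1" "L2_near n g g1" "L2_near n gt gt1"
    using L by (auto elim!: L2_near_mono simp: n_def)
  note n = lagrange_tail[OF f g this]
  have small: "\<exists>m. \<forall>x\<in>D m. \<forall>y\<in>D m. cmod (V y - V x) < e" if e: "0 < e" for e
  proof -
    obtain m1 where m1: "n \<le> m1" "(LINT s:D m1|sg. cmod (ft1 s * g1 s - gt1 s * f1 s)) < e / 2"
      by (rule tail_small[OF n(1) sets_borel(3), of "e / 2"]) (use e in auto)
    obtain m2 where m2: "n \<le> m2" "(LINT s:D m2|ch. cmod (ft s * g s - gt s * f s)) < e / 2"
      by (rule tail_small[OF n(2) sets_borel(4), of "e / 2"]) (use e in auto)
    define m where "m = max m1 m2"
    have s: "D m \<subseteq> D m1" "D m \<subseteq> D m2" "D m1 \<subseteq> D n" "D m2 \<subseteq> D n" "n \<le> m"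
      using m1(1) m2(1) D_mono by (auto simp: m_def)
    have i1: "set_integrable sg (D m1) (\<lambda>s. cmod (ft1 s * g1 s - gt1 s * f1 s))"
      by (rule set_integrable_subset[OF n(1)]) (use s D_borel sets_borel in auto)
    have i2: "set_integrable ch (D m2) (\<lambda>s. cmod (ft s * g s - gt s * f s))"
      by (rule set_integrable_subset[OF n(2)]) (use s D_borel sets_borel in auto)
    have "(LINT s:D m|sg. cmod (ft1 s * g1 s - gt1 s * f1 s)) \<le> (LINT s:D m1|sg. cmod (ft1 s * g1 s - gt1 s * f1 s))"
      by (rule set_integral_mono_set[OF i1 s(1)]) (simp_all add: D_borel sets_borel)
    moreover have "(LINT s:D m|ch. cmod (ft s * g s - gt s * f s)) \<le> (LINT s:D m2|ch. cmod (ft s * g s - gt s * f s))"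
      by (rule set_integral_mono_set[OF i2 s(2)]) (simp_all add: D_borel sets_borel)
    ultimately have "cmod (V y - V x) < e" if "x \<in> D m" "y \<in> D m" for x y
      using n(3)[OF s(5) that] m1(2) m2(2) unfolding V_def by linarith
    then show ?thesis by blast
  qed
  \<comment> \<open>One point from each neighbourhood gives a Cauchy sequence and thereby a
    candidate for the limit along \<open>F\<close>.\<close>
  define X where "X = (\<lambda>i. SOME x. x \<in> D i)"
  have X: "X i \<in> D i" for i unfolding X_def using D_ne[of i] by (simp add: some_in_eq)
  have "Cauchy (\<lambda>i. V (X i))"
  proof (rule CauchyI)
    fix e :: real assume "0 < e"
    then obtain m where m: "\<And>x y. x \<in> D m \<Longrightarrow> y \<in> D m \<Longrightarrow> cmod (V y - V x) < e" using small by blast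
    have "X i \<in> D m" if "m \<le> i" for i using X[of i] D_mono[OF that] by blast
    then show "\<exists>M. \<forall>i\<ge>M. \<forall>j\<ge>M. cmod (V (X i) - V (X j)) < e" using m by blast
  qed
  then obtain L where L: "(\<lambda>i. V (X i)) \<longlonglongrightarrow> L" using Cauchy_convergent unfolding convergent_def by blast
  have "(V \<longlongrightarrow> L) F"
  proof (rule tendstoI)
    fix e :: real assume e: "0 < e"
    then obtain m where m: "\<And>x y. x \<in> D m \<Longrightarrow> y \<in> D m \<Longrightarrow> cmod (V y - V x) < e / 2" using small[of "e / 2"] by auto
    have "eventually (\<lambda>i. dist (V (X i)) L < e / 2) sequentially" using L e by (intro tendstoD) auto
    then obtain N where N: "\<And>i. N \<le> i \<Longrightarrow> dist (V (X i)) L < e / 2" by (auto simp: eventually_sequentially)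
    define i where "i = max N m"
    have Xi: "X i \<in> D m" using X[of i] D_mono[of m i] unfolding i_def by auto
    have "dist (V x) L < e" if "x \<in> D m" for x
    proof -
      have "dist (V x) (V (X i)) < e / 2" using m[OF Xi that] by (simp add: dist_norm)
      moreover have "dist (V (X i)) L < e / 2" by (rule N) (simp add: i_def)
      ultimately show ?thesis using dist_triangle[of "V x" L "V (X i)"] by linarith
    qed
    then show "eventually (\<lambda>x. dist (V x) L < e) F" unfolding ev_iff by blast
  qed
  then show ?thesis using that unfolding V_def by blast
qed

text \<open>Cramer's rule writes u in terms of f, g and the boundary forms V(u,f), V(u,g). By the Lagrange
  identity the variation of these forms near the endpoint is at most half of their supremum,
  so they are bounded, and u inherits square integrability from f and g.\<close>

lemma cramer_bound:
  assumes f: "Tmax_near f f1 ft ft1" and g: "Tmax_near g g1 gt gt1"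
    and L: "((\<lambda>x. Vw f f1 ft g g1 gt x) \<longlongrightarrow> L) F" "L \<noteq> 0"
    and u: "qd_on I u u1 (\<lambda>x. z * u x)" and z: "z \<noteq> 0"
  obtains n where "L2_near n u u1"
proof -
  let ?Vf = "\<lambda>x. Vw u u1 (\<lambda>x. z * u x) f f1 ft x" and ?Vg = "\<lambda>x. Vw u u1 (\<lambda>x. z * u x) g g1 gt x"
  define N where "N = (\<lambda>x. cmod (?Vf x) + cmod (?Vg x))"
  \<comment> \<open>The constant is 2 / |L| because |V(f,g)| stays above |L| / 2 close to the
    endpoint.\<close>
  define c where "c = 2 / cmod L"
  have c: "0 \<le> c" "0 < cmod L" using L(2) by (auto simp: c_def)
  note mf = Tmax_near_meas[OF f] and mg = Tmax_near_meas[OF g] and mu = qd_on_meas[OF u]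
  have "eventually (\<lambda>x. dist (Vw f f1 ft g g1 gt x) L < cmod L / 2) F" using L by (intro tendstoD) auto
  then obtain n0 where n0: "\<And>x. x \<in> D n0 \<Longrightarrow> dist (Vw f f1 ft g g1 gt x) L < cmod L / 2" unfolding ev_iff by blast
  have low: "cmod L / 2 \<le> cmod (Vw f f1 ft g g1 gt x)" if "x \<in> D n0" for x
    using n0[OF that] norm_triangle_ineq2[of L "L - Vw f f1 ft g g1 gt x"]
    by (simp add: dist_norm norm_minus_commute)
  have solve: "cmod (z * u x) \<le> c * N x * (cmod (ft x) + cmod (gt x))" "cmod (u1 x) \<le> c * N x * (cmod (f1 x) + cmod (g1 x))"
    if x: "x \<in> D n0" for x
  proof -
    \<comment> \<open>Cramer's rule in a form that covers both components: (w, p, q) is (z u, ft,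
      gt) or (u1, f1, g1).\<close>
    have div: "cmod w \<le> c * N x * (cmod p + cmod q)" if e: "w * Vw f f1 ft g g1 gt x = ?Vg x * p - ?Vf x * q" for w p q
    proof -
      have "cmod w * (cmod L / 2) \<le> cmod w * cmod (Vw f f1 ft g g1 gt x)" by (rule mult_left_mono[OF low[OF x]]) simp
      also have "\<dots> = cmod (?Vg x * p - ?Vf x * q)" by (simp add: e[symmetric] norm_mult)
      also have "\<dots> \<le> cmod (?Vg x) * cmod p + cmod (?Vf x) * cmod q"
        using norm_triangle_ineq4[of "?Vg x * p" "?Vf x * q"] by (simp add: norm_mult)
      also have "\<dots> \<le> N x * cmod p + N x * cmod q"
        unfolding N_def by (intro add_mono mult_right_mono) auto
      finally show ?thesis using c(2) by (simp add: c_def field_simps)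
    qed
    show "cmod (z * u x) \<le> c * N x * (cmod (ft x) + cmod (gt x))"
      by (rule div) (unfold Vw_def, algebra)
    show "cmod (u1 x) \<le> c * N x * (cmod (f1 x) + cmod (g1 x))"
      by (rule div) (unfold Vw_def, algebra)
  qed
  obtain n1 n2 where n: "L2_near n1 f f1" "L2_near n1 ft ft1" "L2_near n2 g g1" "L2_near n2 gt gt1"
    using f g unfolding Tmax_near_def by blast
  define n where "n = max n0 (max n1 n2)"
  have Ln: "L2_near n f f1" "L2_near n ft ft1" "L2_near n g g1" "L2_near n gt gt1" and n0n: "n0 \<le> n"
    using n by (auto elim!: L2_near_mono simp: n_def)
  \<comment> \<open>\<open>Ks\<close> and \<open>Kc\<close> majorise the sum of the Lagrange
    integrands of V(u,f) and V(u,g) after u and u1 are replaced by their Cramer bounds with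
    \<open>N\<close> set to 1. The factor 1 / |z| in \<open>Kc\<close> appears since Cramer's rule
    bounds z u.\<close>
  define Ks where "Ks = (\<lambda>s. c * ((cmod (f1 s) + cmod (g1 s)) * (cmod (z * f1 s) + cmod (ft1 s) + cmod (z * g1 s) + cmod (gt1 s))))"
  define Kc where "Kc = (\<lambda>s. c / cmod z * ((cmod (ft s) + cmod (gt s)) * (cmod (z * f s) + cmod (ft s) + cmod (z * g s) + cmod (gt s))))"
  have prod: "set_integrable M (D n) (\<lambda>s. cmod (p s) * cmod (q s))"
    if "L2_on M (D n) p" "L2_on M (D n) q" "meas p" "meas q" "sets M = sets borel" for M p q
    using set_integrable_norm[OF L2_prod[OF that(1-4) D_borel D_sub that(5)]] by (simp add: norm_mult)
  have iKs: "set_integrable sg (D n) Ks" unfolding Ks_def distrib_left distrib_right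
    by (intro set_integral_add(1) set_integrable_mult_right prod)
      (use Ln mf mg sets_borel in \<open>auto simp: L2_near_def intro: L2_cmult meas_cmult\<close>)
  have iKc: "set_integrable ch (D n) Kc" unfolding Kc_def distrib_left distrib_right
    by (intro set_integral_add(1) set_integrable_mult_right prod)
      (use Ln mf mg sets_borel in \<open>auto simp: L2_near_def intro: L2_cmult meas_cmult\<close>)
  have Kpos: "0 \<le> Ks s" "0 \<le> Kc s" for s using c unfolding Ks_def Kc_def by auto
  \<comment> \<open>A quarter for each of the two measures leaves a total variation of at most half
    of the supremum.\<close>
  obtain m1 where m1: "n \<le> m1" "(LINT s:D m1|sg. Ks s) < 1 / 4"
    by (rule tail_small[OF iKs sets_borel(3), of "1 / 4"]) auto
  obtain m2 where m2: "n \<le> m2" "(LINT s:D m2|ch. Kc s) < 1 / 4"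
    by (rule tail_small[OF iKc sets_borel(4), of "1 / 4"]) auto
  define m where "m = max m1 m2"
  have nm: "n \<le> m" "m1 \<le> m" "m2 \<le> m" "n0 \<le> m" using m1 m2 n0n by (auto simp: m_def)
  have cs: "set_integrable sg A Ks" "(LINT s:A|sg. Ks s) \<le> 1 / 4" "set_integrable ch A Kc" "(LINT s:A|ch. Kc s) \<le> 1 / 4"
    if A: "A \<subseteq> D m" "A \<in> sets borel" for A
  proof -
    have "A \<subseteq> D n" "A \<subseteq> D m1" "A \<subseteq> D m2" "D m1 \<subseteq> D n" "D m2 \<subseteq> D n" 
      using A(1) D_mono nm m1(1) m2(1) by blast+
    note s = this
    show "set_integrable sg A Ks" "set_integrable ch A Kc"
      using set_integrable_subset[OF iKs _ s(1)] set_integrable_subset[OF iKc _ s(1)] A sets_borel by auto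
    have "(LINT s:A|sg. Ks s) \<le> (LINT s:D m1|sg. Ks s)"
      by (rule set_integral_mono_set[OF set_integrable_subset[OF iKs _ s(4)] s(2)]) (use A D_borel sets_borel Kpos in auto)
    then show "(LINT s:A|sg. Ks s) \<le> 1 / 4" using m1 by linarith
    have "(LINT s:A|ch. Kc s) \<le> (LINT s:D m2|ch. Kc s)"
      by (rule set_integral_mono_set[OF set_integrable_subset[OF iKc _ s(5)] s(3)]) (use A D_borel sets_borel Kpos in auto)
    then show "(LINT s:A|ch. Kc s) \<le> 1 / 4" using m2 by linarith
  qed
  have Q: "qd_on I f f1 ft" "ac_on sg I ft ft1" "qd_on I g g1 gt" "ac_on sg I gt gt1" using f g unfolding Tmax_near_def by auto
  have uz: "ac_on sg I (\<lambda>x. z * u x) (\<lambda>x. z * u1 x)" by (rule ac_on_cmult[OF qd_onD(1)[OF u]])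
  \<comment> \<open>If \<open>N\<close> is at most B between two points near the endpoint, its
    values there differ by at most B / 2.\<close>
  have step: "N p \<le> N q + B * (1 / 2)"
    if pq: "p \<in> D m" "q \<in> D m" and B: "\<And>s. s \<in> {min p q..max p q} \<Longrightarrow> N s \<le> B" "0 \<le> B" for p q B
  proof -
    define x where "x = min p q"
    define y where "y = max p q"
    have xy: "x \<in> D m" "y \<in> D m" "x \<le> y" using pq by (auto simp: x_def y_def min_def max_def)
    have sub: "{x..y} \<subseteq> I" using Icc_subset D_sub xy by blast
    have sub2: "{x..<y} \<subseteq> D m" using D_conv[OF xy(1,2)] by auto
    note lf = lagrange[OF u uz Q(1,2) xy(3) sub] and lg = lagrange[OF u uz Q(3,4) xy(3) sub]
    note cs' = cs[OF sub2, simplified]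
    have Ns: "N s \<le> B" "0 \<le> N s" "s \<in> D n0" if "s \<in> {x..<y}" for s
    proof -
      show "N s \<le> B" using B(1) that by (auto simp: x_def y_def)
      show "0 \<le> N s" by (simp add: N_def)
      show "s \<in> D n0" using that sub2 D_mono[OF nm(4)] by blast
    qed
    have dif: "cmod (Vw u u1 (\<lambda>x. z * u x) h h1 ht y - Vw u u1 (\<lambda>x. z * u x) h h1 ht x)
       \<le> (LINT s:{x..<y}|sg. cmod (z * u1 s * h1 s - ht1 s * u1 s)) + (LINT s:{x..<y}|ch. cmod (z * u s * h s - ht s * u s))"
      if "qd_on I h h1 ht" "ac_on sg I ht ht1" for h h1 ht ht1
    proof -
      note l = lagrange[OF u uz that xy(3) sub]
      have "cmod (Vw u u1 (\<lambda>x. z * u x) h h1 ht y - Vw u u1 (\<lambda>x. z * u x) h h1 ht x)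
        \<le> cmod (LINT s:{x..<y}|sg. z * u1 s * h1 s - ht1 s * u1 s) + cmod (LINT s:{x..<y}|ch. z * u s * h s - ht s * u s)"
        unfolding l(3) by (rule norm_add_two_diff)
      also have "\<dots> \<le> (LINT s:{x..<y}|sg. cmod (z * u1 s * h1 s - ht1 s * u1 s)) + (LINT s:{x..<y}|ch. cmod (z * u s * h s - ht s * u s))"
        by (intro add_mono set_integral_norm_bound l(1,2))
      finally show ?thesis .
    qed
    have b1: "cmod (z * u1 s * h1 s - ht1 s * u1 s) \<le> c * B * (cmod (f1 s) + cmod (g1 s)) * (cmod (z * h1 s) + cmod (ht1 s))"
      if "s \<in> {x..<y}" for s h1 ht1
    proof -
      have "z * u1 s * h1 s - ht1 s * u1 s = u1 s * (z * h1 s - ht1 s)" by algebra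
      then have "cmod (z * u1 s * h1 s - ht1 s * u1 s) \<le> cmod (u1 s) * (cmod (z * h1 s) + cmod (ht1 s))"
        by (simp only: norm_mult[of "u1 s"]) (intro mult_left_mono norm_triangle_ineq4 norm_ge_zero)
      also have "\<dots> \<le> (c * B * (cmod (f1 s) + cmod (g1 s))) * (cmod (z * h1 s) + cmod (ht1 s))"
      proof (rule mult_right_mono)
        have "cmod (u1 s) \<le> c * N s * (cmod (f1 s) + cmod (g1 s))" by (rule solve(2)[OF Ns(3)[OF that]])
        also have "\<dots> \<le> c * B * (cmod (f1 s) + cmod (g1 s))"
          using Ns[OF that] c by (intro mult_right_mono mult_left_mono) auto
        finally show "cmod (u1 s) \<le> c * B * (cmod (f1 s) + cmod (g1 s))" .
      qed simp
      finally show ?thesis .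
    qed
    have b2: "cmod (z * u s * h s - ht s * u s) \<le> c / cmod z * B * (cmod (ft s) + cmod (gt s)) * (cmod (z * h s) + cmod (ht s))"
      if "s \<in> {x..<y}" for s h ht
    proof -
      have "z * u s * h s - ht s * u s = u s * (z * h s - ht s)" by algebra
      then have "cmod (z * u s * h s - ht s * u s) \<le> cmod (u s) * (cmod (z * h s) + cmod (ht s))"
        by (simp only: norm_mult[of "u s"]) (intro mult_left_mono norm_triangle_ineq4 norm_ge_zero)
      also have "\<dots> \<le> (c / cmod z * B * (cmod (ft s) + cmod (gt s))) * (cmod (z * h s) + cmod (ht s))"
      proof (rule mult_right_mono)
        have "cmod z * cmod (u s) \<le> c * N s * (cmod (ft s) + cmod (gt s))" using solve(1)[OF Ns(3)[OF that]] by (simp add: norm_mult)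
        also have "\<dots> \<le> c * B * (cmod (ft s) + cmod (gt s))"
          using Ns[OF that] c by (intro mult_right_mono mult_left_mono) auto
        finally show "cmod (u s) \<le> c / cmod z * B * (cmod (ft s) + cmod (gt s))" using z by (simp add: field_simps)
      qed simp
      finally show ?thesis .
    qed
    have bor: "{x..<y} \<in> sets borel" by simp
    have alg: "k * B * r * (p + q) + k * B * r * (p' + q') = B * (k * (r * (p + q + p' + q')))" for k r p q p' q' :: real
      by algebra
    have isB: "set_integrable sg {x..<y} (\<lambda>s. B * Ks s)" "set_integrable ch {x..<y} (\<lambda>s. B * Kc s)"
      using cs[OF sub2 bor] by simp_all
    have s1: "(LINT s:{x..<y}|sg. cmod (z * u1 s * f1 s - ft1 s * u1 s)) + (LINT s:{x..<y}|sg. cmod (z * u1 s * g1 s - gt1 s * u1 s))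
      \<le> B * (1 / 4)"
    proof -
      note i1 = set_integrable_norm[OF lf(1)] and i2 = set_integrable_norm[OF lg(1)]
      have "(LINT s:{x..<y}|sg. cmod (z * u1 s * f1 s - ft1 s * u1 s)) + (LINT s:{x..<y}|sg. cmod (z * u1 s * g1 s - gt1 s * u1 s))
        = (LINT s:{x..<y}|sg. cmod (z * u1 s * f1 s - ft1 s * u1 s) + cmod (z * u1 s * g1 s - gt1 s * u1 s))"
        by (rule set_integral_add(2)[OF i1 i2, symmetric])
      also have "\<dots> \<le> (LINT s:{x..<y}|sg. B * Ks s)"
      proof (rule set_integral_mono[OF set_integral_add(1)[OF i1 i2] isB(1)])
        fix s assume s: "s \<in> {x..<y}"
        show "cmod (z * u1 s * f1 s - ft1 s * u1 s) + cmod (z * u1 s * g1 s - gt1 s * u1 s) \<le> B * Ks s"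
          using add_mono[OF b1[OF s, of f1 ft1] b1[OF s, of g1 gt1]] unfolding Ks_def by (simp add: algebra_simps)
      qed
      also have "\<dots> = B * (LINT s:{x..<y}|sg. Ks s)" by simp
      also have "\<dots> \<le> B * (1 / 4)" using cs(2)[OF sub2 bor] B(2) by (rule mult_left_mono)
      finally show ?thesis .
    qed
    have s2: "(LINT s:{x..<y}|ch. cmod (z * u s * f s - ft s * u s)) + (LINT s:{x..<y}|ch. cmod (z * u s * g s - gt s * u s))
      \<le> B * (1 / 4)"
    proof -
      note i1 = set_integrable_norm[OF lf(2)] and i2 = set_integrable_norm[OF lg(2)]
      have "(LINT s:{x..<y}|ch. cmod (z * u s * f s - ft s * u s)) + (LINT s:{x..<y}|ch. cmod (z * u s * g s - gt s * u s))
        = (LINT s:{x..<y}|ch. cmod (z * u s * f s - ft s * u s) + cmod (z * u s * g s - gt s * u s))"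
        by (rule set_integral_add(2)[OF i1 i2, symmetric])
      also have "\<dots> \<le> (LINT s:{x..<y}|ch. B * Kc s)"
      proof (rule set_integral_mono[OF set_integral_add(1)[OF i1 i2] isB(2)])
        fix s assume s: "s \<in> {x..<y}"
        show "cmod (z * u s * f s - ft s * u s) + cmod (z * u s * g s - gt s * u s) \<le> B * Kc s"
          using add_mono[OF b2[OF s, of f ft] b2[OF s, of g gt]] unfolding Kc_def alg by (simp only: add.assoc)
      qed
      also have "\<dots> = B * (LINT s:{x..<y}|ch. Kc s)" by simp
      also have "\<dots> \<le> B * (1 / 4)" using cs(4)[OF sub2 bor] B(2) by (rule mult_left_mono)
      finally show ?thesis .
    qed
    have "\<bar>N y - N x\<bar> \<le> cmod (?Vf y - ?Vf x) + cmod (?Vg y - ?Vg x)"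
      using norm_triangle_ineq3[of "?Vf y" "?Vf x"] norm_triangle_ineq3[of "?Vg y" "?Vg x"] unfolding N_def by linarith
    also have "\<dots> \<le> B * (1 / 2)" using dif[OF Q(1,2)] dif[OF Q(3,4)] s1 s2 by linarith
    finally have "\<bar>N y - N x\<bar> \<le> B * (1 / 2)" .
    moreover have "p = x \<and> q = y \<or> p = y \<and> q = x" by (auto simp: x_def y_def)
    ultimately show ?thesis by (elim disjE conjE; simp only: abs_le_iff; linarith)
  qed
  obtain q where q: "q \<in> D m" using D_ne by blast
  have bound: "N p \<le> 2 * N q" if p: "p \<in> D m" for p
  proof -
    define x where "x = min p q"
    define y where "y = max p q"
    have xy: "x \<in> D m" "y \<in> D m" "x \<le> y" using p q by (auto simp: x_def y_def min_def max_def)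
    have xyI: "x \<in> I" "y \<in> I" using xy D_sub by blast+
    note sub = Icc_subset[OF xyI]
    note [simp] = sets_borel
    \<comment> \<open>The inequality B <= N q + B / 2 can be solved for the supremum B only if B is
      finite, so boundedness on the compact interval has to come first.\<close>
    have fin: "\<exists>B. \<forall>s\<in>{x..y}. N s \<le> B"
    proof -
      have bd: "\<exists>B. \<forall>s\<in>{x..y}. cmod (Vw u u1 (\<lambda>x. z * u x) h h1 ht s) \<le> B" 
        if h: "qd_on I h h1 ht" "ac_on sg I ht ht1" for h h1 ht ht1
      proof -
        obtain B1 where B1: "\<And>s. s \<in> {x..y} \<Longrightarrow> cmod (u s) \<le> B1" "\<And>s. s \<in> {x..y} \<Longrightarrow> cmod (u1 s) \<le> B1"
          by (rule qd_on_bounded[OF u xyI]; rule that; assumption)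
        obtain B2 where B2: "\<And>s. s \<in> {x..y} \<Longrightarrow> cmod (h1 s) \<le> B2"
          by (rule qd_on_bounded[OF h(1) xyI]; rule that; assumption)
        obtain B3 where B3: "\<And>s. s \<in> {x..y} \<Longrightarrow> cmod (ht s) \<le> B3"
          by (rule ac_on_bounded[OF h(2) xyI sub sets_borel(3)]; rule that; assumption)
        have "cmod (Vw u u1 (\<lambda>x. z * u x) h h1 ht s) \<le> cmod z * B1 * B2 + B1 * B3" if s: "s \<in> {x..y}" for s
        proof -
          have "cmod (Vw u u1 (\<lambda>x. z * u x) h h1 ht s) \<le> cmod z * cmod (u s) * cmod (h1 s) + cmod (u1 s) * cmod (ht s)"
            unfolding Vw_def norm_mult[symmetric] by (rule norm_triangle_ineq4)
          also have "\<dots> \<le> cmod z * B1 * B2 + B1 * B3"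
            using B1[OF s] B2[OF s] B3[OF s] order_trans[OF norm_ge_zero B1(1)[OF s]]
            by (intro add_mono mult_mono mult_left_mono) auto
          finally show ?thesis .
        qed
        then show ?thesis by blast
      qed
      obtain B1 where "\<forall>s\<in>{x..y}. cmod (?Vf s) \<le> B1" using bd[OF Q(1,2)] by blast
      moreover obtain B2 where "\<forall>s\<in>{x..y}. cmod (?Vg s) \<le> B2" using bd[OF Q(3,4)] by blast
      ultimately have "\<forall>s\<in>{x..y}. N s \<le> B1 + B2" unfolding N_def by (auto intro: add_mono)
      then show ?thesis by blast
    qed
    then have bdd: "bdd_above (N ` {x..y})" by (auto simp: bdd_above_def)
    define B where "B = (SUP s\<in>{x..y}. N s)"
    have le: "N s \<le> B" if "s \<in> {x..y}" for s unfolding B_def using that bdd by (rule cSUP_upper)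
    have pq': "p \<in> {x..y}" "q \<in> {x..y}" by (auto simp: x_def y_def)
    have B0: "0 \<le> B" using le[OF pq'(1)] by (rule order_trans[rotated]) (simp add: N_def)
    have "N s \<le> N q + B * (1 / 2)" if s: "s \<in> {x..y}" for s
    proof (rule step[OF _ q _ B0])
      show "s \<in> D m" using s D_conv[OF xy(1,2)] by blast
      fix t assume "t \<in> {min s q..max s q}"
      then have "t \<in> {x..y}" using s pq' by auto
      then show "N t \<le> B" by (rule le)
    qed
    then have "(SUP s\<in>{x..y}. N s) \<le> N q + B * (1 / 2)" using pq' by (intro cSUP_least) auto
    then have "B \<le> N q + B * (1 / 2)" by (simp only: B_def[symmetric])
    then show ?thesis using le[OF pq'(1)] by linarith
  qed
  have L2m: "L2_near m f f1" "L2_near m ft ft1" "L2_near m g g1" "L2_near m gt gt1" using Ln nm by (auto elim: L2_near_mono)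
  have est: "cmod w ^ 2 \<le> (c * (2 * N q))^2 * (2 * (cmod p)^2 + 2 * (cmod r)^2)"
    if w: "cmod w \<le> c * N x * (cmod p + cmod r)" and x: "x \<in> D m" for w x p r
  proof -
    have "cmod w \<le> (c * (2 * N q)) * (cmod p + cmod r)"
      using w mult_right_mono[OF mult_left_mono[OF bound[OF x] c(1)], of "cmod p + cmod r"] by (simp add: order_trans)
    then have "cmod w ^ 2 \<le> ((c * (2 * N q)) * (cmod p + cmod r))^2" by (rule power_mono) simp
    also have "\<dots> = (c * (2 * N q))^2 * (cmod p + cmod r)^2" by (rule power_mult_distrib)
    also have "\<dots> \<le> (c * (2 * N q))^2 * (2 * (cmod p)^2 + 2 * (cmod r)^2)"
    proof (rule mult_left_mono)
      show "(cmod p + cmod r)\<^sup>2 \<le> 2 * (cmod p)^2 + 2 * (cmod r)^2"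
        using zero_le_power2[of "cmod p - cmod r"] by (simp add: power2_eq_square algebra_simps)
    qed simp
    finally show ?thesis .
  qed
  have "L2_on sg (D m) u1"
  proof (rule L2_bound[OF _ mu(2) D_borel D_sub sets_borel(3)])
    show "set_integrable sg (D m) (\<lambda>x. (c * (2 * N q))^2 * (2 * (cmod (f1 x))^2 + 2 * (cmod (g1 x))^2))"
      using L2m unfolding L2_near_def L2_on_def by (intro set_integrable_mult_right set_integral_add(1)) auto
    show "(cmod (u1 x))\<^sup>2 \<le> (c * (2 * N q))^2 * (2 * (cmod (f1 x))^2 + 2 * (cmod (g1 x))^2)" if x: "x \<in> D m" for x
      by (rule est[OF solve(2) x]) (use x D_mono[OF nm(4)] in blast)
  qed
  moreover have "L2_on ch (D m) (\<lambda>x. z * u x)"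
  proof (rule L2_bound[OF _ mu(3) D_borel D_sub sets_borel(4)])
    show "set_integrable ch (D m) (\<lambda>x. (c * (2 * N q))^2 * (2 * (cmod (ft x))^2 + 2 * (cmod (gt x))^2))"
      using L2m unfolding L2_near_def L2_on_def by (intro set_integrable_mult_right set_integral_add(1)) auto
    show "(cmod (z * u x))\<^sup>2 \<le> (c * (2 * N q))^2 * (2 * (cmod (ft x))^2 + 2 * (cmod (gt x))^2)" if x: "x \<in> D m" for x
      by (rule est[OF solve(1) x]) (use x D_mono[OF nm(4)] in blast)
  qed
  then have "L2_on ch (D m) (\<lambda>x. (1 / z) * (z * u x))" by (rule L2_cmult)
  then have "L2_on ch (D m) u" using z by simp
  ultimately show ?thesis using that[of m] unfolding L2_near_def by blast
qed

end

section \<open>Boundary conditions at one endpoint\<close>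

context left_definite_end begin

definition lc where
  "lc \<longleftrightarrow> (\<forall>z. z \<noteq> 0 \<longrightarrow> (\<forall>u u1. qd_on I u u1 (\<lambda>x. z * u x) \<longrightarrow> (\<exists>n. L2_near n u u1)))"

definition V0 where
  "V0 f f1 ft v v1 vt \<longleftrightarrow> ((\<lambda>x. Vw f f1 ft (cnj \<circ> v) (cnj \<circ> v1) (cnj \<circ> vt) x) \<longlongrightarrow> 0) F"

definition bc_fun where
  "bc_fun v v1 vt \<longleftrightarrow> (\<exists>vt1. Tmax_near v v1 vt vt1) \<and> V0 v v1 vt v v1 vt \<and>
     (\<exists>f f1 ft ft1. Tmax_near f f1 ft ft1 \<and> \<not> V0 f f1 ft v v1 vt)"

definition S_near where
  "S_near v v1 vt f f1 ft ft1 \<longleftrightarrow> Tmax_near f f1 ft ft1 \<and> (lc \<longrightarrow> V0 f f1 ft v v1 vt)"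

lemma V0_iff: "V0 f f1 ft v v1 vt \<longleftrightarrow>
    ((\<lambda>x. Vw f f1 ft (\<lambda>x. cnj (v x)) (\<lambda>x. cnj (v1 x)) (\<lambda>x. cnj (vt x)) x) \<longlongrightarrow> 0) F"
  unfolding V0_def comp_def by (rule refl)

lemma L2_near_add:
  assumes "L2_near n f f1" "L2_near n g g1" "meas f" "meas f1" "meas g" "meas g1"
  shows "L2_near n (\<lambda>x. f x + g x) (\<lambda>x. f1 x + g1 x)"
  using assms unfolding L2_near_def
  by (intro conjI L2_add D_borel D_sub sets_borel) simp_all

lemma L2_near_cmult: "L2_near n f f1 \<Longrightarrow> L2_near n (\<lambda>x. c * f x) (\<lambda>x. c * f1 x)"
  unfolding L2_near_def by (intro conjI L2_cmult) simp_all

lemma Tmax_near_add: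
  assumes f: "Tmax_near f f1 ft ft1" and g: "Tmax_near g g1 gt gt1"
  shows "Tmax_near (\<lambda>x. f x + g x) (\<lambda>x. f1 x + g1 x) (\<lambda>x. ft x + gt x) (\<lambda>x. ft1 x + gt1 x)"
proof -
  obtain n1 n2 where n: "L2_near n1 f f1" "L2_near n1 ft ft1" "L2_near n2 g g1" "L2_near n2 gt gt1"
    using f g unfolding Tmax_near_def by blast
  have L: "L2_near (max n1 n2) f f1" "L2_near (max n1 n2) ft ft1" "L2_near (max n1 n2) g g1" "L2_near (max n1 n2) gt gt1"
    using n by (auto elim!: L2_near_mono)
  have "L2_near (max n1 n2) (\<lambda>x. f x + g x) (\<lambda>x. f1 x + g1 x) \<and> L2_near (max n1 n2) (\<lambda>x. ft x + gt x) (\<lambda>x. ft1 x + gt1 x)"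
    by (intro conjI L2_near_add L Tmax_near_meas[OF f] Tmax_near_meas[OF g])
  then show ?thesis using f g qd_on_add ac_on_add unfolding Tmax_near_def by blast
qed

lemma Tmax_near_cmult: "Tmax_near f f1 ft ft1 \<Longrightarrow> Tmax_near (\<lambda>x. c * f x) (\<lambda>x. c * f1 x) (\<lambda>x. c * ft x) (\<lambda>x. c * ft1 x)"
  using qd_on_cmult ac_on_cmult L2_near_cmult unfolding Tmax_near_def by blast

lemma Tmax_near_cnj: 
  assumes "Tmax_near f f1 ft ft1"
  shows "Tmax_near (\<lambda>x. cnj (f x)) (\<lambda>x. cnj (f1 x)) (\<lambda>x. cnj (ft x)) (\<lambda>x. cnj (ft1 x))"
proof -
  have "L2_near n f f1 \<Longrightarrow> L2_near n (\<lambda>x. cnj (f x)) (\<lambda>x. cnj (f1 x))" for n f f1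
    unfolding L2_near_def L2_on_def by simp
  then show ?thesis using assms qd_on_cnj ac_on_cnj unfolding Tmax_near_def by blast
qed

lemma V0_add: 
  assumes "V0 f f1 ft v v1 vt" "V0 g g1 gt v v1 vt"
  shows "V0 (\<lambda>x. f x + g x) (\<lambda>x. f1 x + g1 x) (\<lambda>x. ft x + gt x) v v1 vt"
  using tendsto_add[OF assms[unfolded V0_def]] unfolding V0_def Vw_add_left by simp

lemma V0_cmult:
  assumes "V0 f f1 ft v v1 vt"
  shows "V0 (\<lambda>x. c * f x) (\<lambda>x. c * f1 x) (\<lambda>x. c * ft x) v v1 vt"
  using tendsto_mult_left[OF assms[unfolded V0_def], of c] unfolding V0_def Vw_cmult_left by simp

lemma S_near_add:
  "S_near v v1 vt f f1 ft ft1 \<Longrightarrow> S_near v v1 vt g g1 gt gt1 \<Longrightarrow>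
   S_near v v1 vt (\<lambda>x. f x + g x) (\<lambda>x. f1 x + g1 x) (\<lambda>x. ft x + gt x) (\<lambda>x. ft1 x + gt1 x)"
  using Tmax_near_add V0_add unfolding S_near_def by blast

lemma S_near_cmult:
  "S_near v v1 vt f f1 ft ft1 \<Longrightarrow> S_near v v1 vt (\<lambda>x. c * f x) (\<lambda>x. c * f1 x) (\<lambda>x. c * ft x) (\<lambda>x. c * ft1 x)"
  using Tmax_near_cmult V0_cmult unfolding S_near_def by blast

lemma Vw_lim_zero_of_not_lc:
  assumes "\<not> lc" "Tmax_near f f1 ft ft1" "Tmax_near g g1 gt gt1"
  shows "((\<lambda>x. Vw f f1 ft g g1 gt x) \<longlongrightarrow> 0) F"
proof -
  obtain L where L: "((\<lambda>x. Vw f f1 ft g g1 gt x) \<longlongrightarrow> L) F" by (rule Vw_convergent[OF assms(2,3)])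
  have "L = 0"
  proof (rule ccontr)
    assume n: "L \<noteq> 0"
    have "\<exists>n. L2_near n u u1" if "z \<noteq> 0" "qd_on I u u1 (\<lambda>x. z * u x)" for z u u1
      using cramer_bound[OF assms(2,3) L n that(2,1)] by blast
    then show False using assms(1) unfolding lc_def by blast
  qed
  then show ?thesis using L by simp
qed

text \<open>Boundary forms of pairs in T_max always have limits, so failing to tend to 0 means
  having a non-zero limit. The pair k obtained here is the test vector in the Pluecker
  arguments.\<close>

lemma bc_fun_test:
  assumes "bc_fun v v1 vt"
  obtains k k1 kt kt1 L where "Tmax_near k k1 kt kt1" "L \<noteq> 0"
    "((\<lambda>x. Vw k k1 kt (\<lambda>x. cnj (v x)) (\<lambda>x. cnj (v1 x)) (\<lambda>x. cnj (vt x)) x) \<longlongrightarrow> L) F"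
proof -
  obtain vt1 k k1 kt kt1 where v: "Tmax_near v v1 vt vt1" and k: "Tmax_near k k1 kt kt1" and n: "\<not> V0 k k1 kt v v1 vt"
    using assms unfolding bc_fun_def by blast
  obtain L where L: "((\<lambda>x. Vw k k1 kt (\<lambda>x. cnj (v x)) (\<lambda>x. cnj (v1 x)) (\<lambda>x. cnj (vt x)) x) \<longlongrightarrow> L) F"
    by (rule Vw_convergent[OF k Tmax_near_cnj[OF v]])
  then have "L \<noteq> 0" using n unfolding V0_iff by blast
  then show ?thesis by (rule that[OF k _ L])
qed

text \<open>At a limit-circle endpoint the boundary form has rank two there, so the Pluecker
  relation forces the form to vanish on the boundary condition.\<close>

lemma S_near_orthogonal:
  assumes v: "lc \<Longrightarrow> bc_fun v v1 vt" and f: "S_near v v1 vt f f1 ft ft1" and g: "S_near v v1 vt g g1 gt gt1"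
  shows "((\<lambda>x. Vw f f1 ft g g1 gt x) \<longlongrightarrow> 0) F"
proof (cases lc)
  case False
  then show ?thesis using Vw_lim_zero_of_not_lc f g unfolding S_near_def by blast
next
  case True
  define w where "w = (\<lambda>x. cnj (v x))"
  define w1 where "w1 = (\<lambda>x. cnj (v1 x))"
  define wt where "wt = (\<lambda>x. cnj (vt x))"
  have fT: "Tmax_near f f1 ft ft1" and gT: "Tmax_near g g1 gt gt1" using f g unfolding S_near_def by auto
  have fw: "((\<lambda>x. Vw f f1 ft w w1 wt x) \<longlongrightarrow> 0) F" and gw: "((\<lambda>x. Vw g g1 gt w w1 wt x) \<longlongrightarrow> 0) F"
    using f g True unfolding S_near_def V0_iff w_def w1_def wt_def by auto
  obtain k k1 kt kt1 L where k: "Tmax_near k k1 kt kt1" "L \<noteq> 0" and L: "((\<lambda>x. Vw k k1 kt w w1 wt x) \<longlongrightarrow> L) F"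
    unfolding w_def w1_def wt_def using bc_fun_test[OF v[OF True]] by blast
  obtain A where A: "((\<lambda>x. Vw f f1 ft g g1 gt x) \<longlongrightarrow> A) F" by (rule Vw_convergent[OF fT gT])
  obtain B where B: "((\<lambda>x. Vw k k1 kt g g1 gt x) \<longlongrightarrow> B) F" by (rule Vw_convergent[OF k(1) gT])
  obtain C where C: "((\<lambda>x. Vw f f1 ft k k1 kt x) \<longlongrightarrow> C) F" by (rule Vw_convergent[OF fT k(1)])
  \<comment> \<open>In the Pluecker relation for f, g, cnj v, k the terms with V(f, cnj v) and V(g,
    cnj v) tend to 0, which leaves the limit of V(f,g) times - L.\<close>
  have "((\<lambda>x. Vw f f1 ft g g1 gt x * Vw w w1 wt k k1 kt x + Vw f f1 ft w w1 wt x * Vw k k1 kt g g1 gt x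
    + Vw f f1 ft k k1 kt x * Vw g g1 gt w w1 wt x) \<longlongrightarrow> A * (- L) + 0 * B + C * 0) F"
    unfolding Vw_antisym[of w w1 wt] by (intro tendsto_intros A B C L fw gw)
  then have "((\<lambda>x. 0) \<longlongrightarrow> A * (- L)) F" unfolding Vw_plucker by simp
  then have "A * (- L) = 0" using tendsto_unique[OF F_ne _ tendsto_const] by metis
  then show ?thesis using A k(2) by simp
qed

text \<open>Conjugating the condition on f gives V(cnj f, v) = 0 instead of V(cnj f, cnj v) = 0. The
  self-orthogonality V(v, cnj v) = 0 closes this gap: in the Pluecker relation for cnj f, cnj v, v,
  cnj k only V(cnj f, cnj v) V(v, cnj k) remains, and its second factor tends to - cnj L, which is
  not 0.\<close>

lemma S_near_cnj:
  assumes v: "lc \<Longrightarrow> bc_fun v v1 vt" and f: "S_near v v1 vt f f1 ft ft1"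
  shows "S_near v v1 vt (\<lambda>x. cnj (f x)) (\<lambda>x. cnj (f1 x)) (\<lambda>x. cnj (ft x)) (\<lambda>x. cnj (ft1 x))"
proof -
  have T: "Tmax_near f f1 ft ft1" using f unfolding S_near_def by simp
  have "V0 (\<lambda>x. cnj (f x)) (\<lambda>x. cnj (f1 x)) (\<lambda>x. cnj (ft x)) v v1 vt" if l: lc
  proof -
    note b = v[OF l]
    obtain vt1 where vT: "Tmax_near v v1 vt vt1" and vv: "V0 v v1 vt v v1 vt" using b unfolding bc_fun_def by blast
    let ?w = "\<lambda>x. cnj (v x)" and ?w1 = "\<lambda>x. cnj (v1 x)" and ?wt = "\<lambda>x. cnj (vt x)"
    let ?f = "\<lambda>x. cnj (f x)" and ?f1 = "\<lambda>x. cnj (f1 x)" and ?ft = "\<lambda>x. cnj (ft x)"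
    obtain k k1 kt kt1 L where k: "Tmax_near k k1 kt kt1" "L \<noteq> 0" and L: "((\<lambda>x. Vw k k1 kt ?w ?w1 ?wt x) \<longlongrightarrow> L) F"
      using bc_fun_test[OF b] by blast
    let ?k = "\<lambda>x. cnj (k x)" and ?k1 = "\<lambda>x. cnj (k1 x)" and ?kt = "\<lambda>x. cnj (kt x)"
    obtain A where A: "((\<lambda>x. Vw ?f ?f1 ?ft ?w ?w1 ?wt x) \<longlongrightarrow> A) F"
      by (rule Vw_convergent[OF Tmax_near_cnj[OF T] Tmax_near_cnj[OF vT]])
    obtain B where B: "((\<lambda>x. Vw ?k ?k1 ?kt ?w ?w1 ?wt x) \<longlongrightarrow> B) F"
      by (rule Vw_convergent[OF Tmax_near_cnj[OF k(1)] Tmax_near_cnj[OF vT]])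
    obtain C where C: "((\<lambda>x. Vw ?f ?f1 ?ft ?k ?k1 ?kt x) \<longlongrightarrow> C) F"
      by (rule Vw_convergent[OF Tmax_near_cnj[OF T] Tmax_near_cnj[OF k(1)]])
    have fv: "((\<lambda>x. Vw ?f ?f1 ?ft v v1 vt x) \<longlongrightarrow> 0) F"
    proof -
      have "((\<lambda>x. cnj (Vw f f1 ft ?w ?w1 ?wt x)) \<longlongrightarrow> cnj 0) F"
        using f l unfolding S_near_def V0_iff by (intro tendsto_cnj) simp
      then show ?thesis unfolding Vw_cnj[symmetric] by simp
    qed
    have vk: "((\<lambda>x. Vw v v1 vt ?k ?k1 ?kt x) \<longlongrightarrow> - cnj L) F"
    proof -
      have "((\<lambda>x. - cnj (Vw k k1 kt ?w ?w1 ?wt x)) \<longlongrightarrow> - cnj L) F" by (intro tendsto_intros L)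
      then show ?thesis unfolding Vw_cnj[symmetric] Vw_antisym[of v v1 vt] by simp
    qed
    have wv: "((\<lambda>x. Vw ?w ?w1 ?wt v v1 vt x) \<longlongrightarrow> - 0) F"
      unfolding Vw_antisym[of ?w ?w1 ?wt] using vv unfolding V0_iff by (intro tendsto_minus)
    have "((\<lambda>x. Vw ?f ?f1 ?ft ?w ?w1 ?wt x * Vw v v1 vt ?k ?k1 ?kt x + Vw ?f ?f1 ?ft v v1 vt x * Vw ?k ?k1 ?kt ?w ?w1 ?wt x
      + Vw ?f ?f1 ?ft ?k ?k1 ?kt x * Vw ?w ?w1 ?wt v v1 vt x) \<longlongrightarrow> A * (- cnj L) + 0 * B + C * (- 0)) F"
      by (intro tendsto_intros A B C fv vk wv)
    then have "((\<lambda>x. 0) \<longlongrightarrow> A * (- cnj L)) F" unfolding Vw_plucker by simp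
    then have "A * (- cnj L) = 0" using tendsto_unique[OF F_ne _ tendsto_const] by metis
    then show ?thesis using A k(2) unfolding V0_iff by simp
  qed
  then show ?thesis using Tmax_near_cnj[OF T] unfolding S_near_def by blast
qed

text \<open>Here \<open>N\<close> \<alpha> stands for the points of \<open>I\<close> on one side of
  \<alpha>, as in \<open>H1_near_a\<close> and \<open>H1_near_b\<close>. Uniqueness of the
  derivative allows the existentially quantified one to be replaced by the given
  \<open>k\<close>.\<close>

lemma near_iff:
  assumes N: "\<And>n. \<exists>\<alpha>\<in>I. D n = N \<alpha>" "\<And>\<alpha>. \<alpha> \<in> I \<Longrightarrow> \<exists>n. D n \<subseteq> N \<alpha>"
    "\<And>\<alpha>. N \<alpha> \<in> sets borel" "\<And>\<alpha>. N \<alpha> \<subseteq> I" and k: "ac_on sg I f k"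
  shows "(\<exists>h. AC_deriv a b sg f h \<and> (\<exists>\<alpha>\<in>I. L2_on ch (N \<alpha>) f \<and> L2_on sg (N \<alpha>) h)) \<longleftrightarrow> (\<exists>n. L2_near n f k)"
proof
  assume "\<exists>h. AC_deriv a b sg f h \<and> (\<exists>\<alpha>\<in>I. L2_on ch (N \<alpha>) f \<and> L2_on sg (N \<alpha>) h)"
  then obtain h \<alpha> where h: "ac_on sg I f h" "\<alpha> \<in> I" "L2_on ch (N \<alpha>) f" "L2_on sg (N \<alpha>) h" unfolding AC_iff by blast
  have "L2_on sg (N \<alpha>) k" using L2_sg_unique(1)[OF h(1) k N(3,4)] h(4) by simp
  moreover obtain n where "D n \<subseteq> N \<alpha>" using N(2) h(2) by blast
  ultimately have "L2_near n f k" using h(3) L2_mono[OF _ _ D_borel] sets_borel unfolding L2_near_def by blast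
  then show "\<exists>n. L2_near n f k" ..
next
  assume "\<exists>n. L2_near n f k"
  then show "\<exists>h. AC_deriv a b sg f h \<and> (\<exists>\<alpha>\<in>I. L2_on ch (N \<alpha>) f \<and> L2_on sg (N \<alpha>) h)"
    using N(1) k unfolding L2_near_def AC_iff by metis
qed

end

section \<open>The two endpoints as instances of the abstract one\<close>

context left_definite begin

lemma left_end:
  obtains D where "left_definite_end a b rp rn sg ch D (at_a a)" "\<And>n. \<exists>\<alpha>\<in>I. D n = {x \<in> I. x < \<alpha>}"
    "\<And>\<alpha>. \<alpha> \<in> I \<Longrightarrow> \<exists>n. D n \<subseteq> {x \<in> I. x < \<alpha>}"
proof -
  obtain l u where lu: "I = (\<Union>i::nat. {l i..u i})" "incseq u" "decseq l" "\<And>i. l i \<in> I" "\<And>i. u i \<in> I"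
    "\<And>x. x \<in> I \<Longrightarrow> \<exists>i. l i < x" "\<And>x. x \<in> I \<Longrightarrow> \<exists>i. x < u i"
    by (rule I_exhaustion; rule that; assumption)
  define D where "D = (\<lambda>n. {x \<in> I. x < l n})"
  have ne: "D n \<noteq> {}" for n using lu(4) lu(6)[OF lu(4)[of n]] unfolding D_def by blast
  have sub: "\<exists>n. D n \<subseteq> {x \<in> I. x < \<alpha>}" if "\<alpha> \<in> I" for \<alpha>
  proof -
    obtain n where "l n < \<alpha>" using lu(6) \<open>\<alpha> \<in> I\<close> by blast
    then have "D n \<subseteq> {x \<in> I. x < \<alpha>}" unfolding D_def by auto
    then show ?thesis ..
  qed
  \<comment> \<open>Points close to the left endpoint lie in \<open>I\<close> because
    \<open>l 0\<close> already lies below b.\<close>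
  have up: "x \<in> I" if "a < ereal x" "x \<le> l 0" for x
  proof -
    have "ereal x \<le> ereal (l 0)" "ereal (l 0) < b" using that lu(4)[of 0] by (auto simp: Ivl_def)
    then have "ereal x < b" by (rule le_less_trans)
    then show ?thesis using that unfolding Ivl_def by simp
  qed
  have ev: "eventually P (at_a a) \<longleftrightarrow> (\<exists>n. \<forall>x\<in>D n. P x)" for P
  proof (cases "a = -\<infinity>")
    case True
    show ?thesis
    proof
      assume "eventually P (at_a a)"
      then obtain N where N: "\<And>x. x \<le> N \<Longrightarrow> P x" using True by (auto simp: at_a_def eventually_at_bot_linorder)
      have "min N (l 0) \<in> I" by (rule up) (auto simp: True)
      then obtain n where "D n \<subseteq> {x \<in> I. x < min N (l 0)}" using sub by blast
      then have "\<forall>x\<in>D n. P x" using N by auto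
      then show "\<exists>n. \<forall>x\<in>D n. P x" ..
    next
      assume "\<exists>n. \<forall>x\<in>D n. P x"
      then obtain n where n: "\<And>x. x \<in> D n \<Longrightarrow> P x" by blast
      \<comment> \<open>Subtracting 1 turns the non-strict bound from the filter at minus infinity
        into the strict one in \<open>D n\<close>.\<close>
      have "P x" if x: "x \<le> min (l 0) (l n) - 1" for x
      proof (rule n)
        have "x \<in> I" by (rule up) (use x True in auto)
        then show "x \<in> D n" using x unfolding D_def by auto
      qed
      then show "eventually P (at_a a)" using True by (auto simp: at_a_def eventually_at_bot_linorder)
    qed
  next
    case False
    then obtain r where r: "a = ereal r" using lu(4)[of 0] by (cases a) (auto simp: Ivl_def)
    have at: "at_a a = at_right r" by (simp add: at_a_def r)
    show ?thesis
    proof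
      assume "eventually P (at_a a)"
      then obtain c where c: "r < c" "\<And>y. r < y \<Longrightarrow> y < c \<Longrightarrow> P y" unfolding at eventually_at_right_field by blast
      have "r < l 0" using lu(4)[of 0] by (simp add: Ivl_def r)
      then have "min c (l 0) \<in> I" using c(1) by (intro up) (auto simp: r)
      then obtain n where n: "D n \<subseteq> {x \<in> I. x < min c (l 0)}" using sub by blast
      have "P x" if "x \<in> D n" for x
        by (rule c(2)) (use that n in \<open>auto simp: D_def Ivl_def r\<close>)
      then show "\<exists>n. \<forall>x\<in>D n. P x" by blast
    next
      assume "\<exists>n. \<forall>x\<in>D n. P x"
      then obtain n where n: "\<And>x. x \<in> D n \<Longrightarrow> P x" by blast
      have l: "r < l n" "r < l 0" using lu(4) by (auto simp: Ivl_def r)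
      have "P y" if y: "r < y" "y < min (l 0) (l n)" for y
      proof (rule n)
        have "y \<in> I" by (rule up) (use y in \<open>auto simp: r\<close>)
        then show "y \<in> D n" using y unfolding D_def by auto
      qed
      then show "eventually P (at_a a)" unfolding at eventually_at_right_field
        using l by (intro exI[of _ "min (l 0) (l n)"]) auto
    qed
  qed
  have "left_definite_end a b rp rn sg ch D (at_a a)"
  proof
    show "D n \<subseteq> I" for n unfolding D_def by auto
    have "D n = I \<inter> {..<l n}" for n unfolding D_def by auto
    then show "D n \<in> sets borel" for n using Ivl_borel by simp
    show "D n \<noteq> {}" for n by (rule ne)
    show "{x..y} \<subseteq> D n" if "x \<in> D n" "y \<in> D n" for x y n
      using that Icc_subset[of x y] unfolding D_def by (auto simp: subset_iff)
    show "decseq D" unfolding D_def using decseqD[OF lu(3)] by (auto simp: decseq_def intro: less_le_trans)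
    show "(\<Inter>n. D n) = {}" 
    proof -
      have "\<exists>n. x \<notin> D n" for x
      proof (cases "x \<in> I")
        case True
        then obtain i where "l i < x" using lu(6) by blast
        then have "x \<notin> D i" unfolding D_def by simp
        then show ?thesis ..
      qed (auto simp: D_def)
      then show ?thesis by blast
    qed
    show "eventually P (at_a a) \<longleftrightarrow> (\<exists>n. \<forall>x\<in>D n. P x)" for P by (rule ev)
  qed
  then show ?thesis by (rule that) (use lu(4) sub in \<open>auto simp: D_def\<close>)
qed

lemma right_end:
  obtains D where "left_definite_end a b rp rn sg ch D (at_b b)" "\<And>n. \<exists>\<beta>\<in>I. D n = {x \<in> I. \<beta> < x}"
    "\<And>\<beta>. \<beta> \<in> I \<Longrightarrow> \<exists>n. D n \<subseteq> {x \<in> I. \<beta> < x}"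
proof -
  obtain l u where lu: "I = (\<Union>i::nat. {l i..u i})" "incseq u" "decseq l" "\<And>i. l i \<in> I" "\<And>i. u i \<in> I"
    "\<And>x. x \<in> I \<Longrightarrow> \<exists>i. l i < x" "\<And>x. x \<in> I \<Longrightarrow> \<exists>i. x < u i"
    by (rule I_exhaustion; rule that; assumption)
  define D where "D = (\<lambda>n. {x \<in> I. u n < x})"
  have ne: "D n \<noteq> {}" for n using lu(5) lu(7)[OF lu(5)[of n]] unfolding D_def by blast
  have sub: "\<exists>n. D n \<subseteq> {x \<in> I. \<beta> < x}" if "\<beta> \<in> I" for \<beta>
  proof -
    obtain n where "\<beta> < u n" using lu(7) \<open>\<beta> \<in> I\<close> by blast
    then have "D n \<subseteq> {x \<in> I. \<beta> < x}" unfolding D_def by auto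
    then show ?thesis ..
  qed
  have up: "x \<in> I" if "ereal x < b" "u 0 \<le> x" for x
  proof -
    have "ereal (u 0) \<le> ereal x" "a < ereal (u 0)" using that lu(5)[of 0] by (auto simp: Ivl_def)
    then have "a < ereal x" using less_le_trans by blast
    then show ?thesis using that unfolding Ivl_def by simp
  qed
  have ev: "eventually P (at_b b) \<longleftrightarrow> (\<exists>n. \<forall>x\<in>D n. P x)" for P
  proof (cases "b = \<infinity>")
    case True
    show ?thesis
    proof
      assume "eventually P (at_b b)"
      then obtain N where N: "\<And>x. N \<le> x \<Longrightarrow> P x" using True by (auto simp: at_b_def eventually_at_top_linorder)
      have "max N (u 0) \<in> I" by (rule up) (simp_all add: True del: ereal_max)
      then obtain n where "D n \<subseteq> {x \<in> I. max N (u 0) < x}" using sub by blast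
      then have "\<forall>x\<in>D n. P x" using N by auto
      then show "\<exists>n. \<forall>x\<in>D n. P x" ..
    next
      assume "\<exists>n. \<forall>x\<in>D n. P x"
      then obtain n where n: "\<And>x. x \<in> D n \<Longrightarrow> P x" by blast
      have "P x" if x: "max (u 0) (u n) + 1 \<le> x" for x
      proof (rule n)
        have "x \<in> I" by (rule up) (use x True in auto)
        then show "x \<in> D n" using x unfolding D_def by auto
      qed
      then show "eventually P (at_b b)" using True by (auto simp: at_b_def eventually_at_top_linorder)
    qed
  next
    case False
    then obtain r where r: "b = ereal r" using lu(5)[of 0] by (cases b) (auto simp: Ivl_def)
    have at: "at_b b = at_left r" by (simp add: at_b_def r)
    show ?thesis
    proof
      assume "eventually P (at_b b)"
      then obtain c where c: "c < r" "\<And>y. c < y \<Longrightarrow> y < r \<Longrightarrow> P y" unfolding at eventually_at_left_field by blast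
      have "u 0 < r" using lu(5)[of 0] by (simp add: Ivl_def r)
      then have "max c (u 0) \<in> I" using c(1) by (intro up) (auto simp: r)
      then obtain n where n: "D n \<subseteq> {x \<in> I. max c (u 0) < x}" using sub by blast
      have "P x" if "x \<in> D n" for x
        by (rule c(2)) (use that n in \<open>auto simp: D_def Ivl_def r\<close>)
      then show "\<exists>n. \<forall>x\<in>D n. P x" by blast
    next
      assume "\<exists>n. \<forall>x\<in>D n. P x"
      then obtain n where n: "\<And>x. x \<in> D n \<Longrightarrow> P x" by blast
      have l: "u n < r" "u 0 < r" using lu(5) by (auto simp: Ivl_def r)
      have "P y" if y: "y < r" "max (u 0) (u n) < y" for y
      proof (rule n)
        have "y \<in> I" by (rule up) (use y in \<open>auto simp: r\<close>)
        then show "y \<in> D n" using y unfolding D_def by auto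
      qed
      then show "eventually P (at_b b)" unfolding at eventually_at_left_field
        using l by (intro exI[of _ "max (u 0) (u n)"]) auto
    qed
  qed
  have "left_definite_end a b rp rn sg ch D (at_b b)"
  proof
    show "D n \<subseteq> I" for n unfolding D_def by auto
    have "D n = I \<inter> {u n<..}" for n unfolding D_def by auto
    then show "D n \<in> sets borel" for n using Ivl_borel by simp
    show "D n \<noteq> {}" for n by (rule ne)
    show "{x..y} \<subseteq> D n" if "x \<in> D n" "y \<in> D n" for x y n
      using that Icc_subset[of x y] unfolding D_def by (auto simp: subset_iff)
    show "decseq D" unfolding D_def using incseqD[OF lu(2)] by (auto simp: decseq_def intro: le_less_trans)
    show "(\<Inter>n. D n) = {}" 
    proof -
      have "\<exists>n. x \<notin> D n" for x
      proof (cases "x \<in> I")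
        case True
        then obtain i where "x < u i" using lu(7) by blast
        then have "x \<notin> D i" unfolding D_def by simp
        then show ?thesis ..
      qed (auto simp: D_def)
      then show ?thesis by blast
    qed
    show "eventually P (at_b b) \<longleftrightarrow> (\<exists>n. \<forall>x\<in>D n. P x)" for P by (rule ev)
  qed
  then show ?thesis by (rule that) (use lu(5) sub in \<open>auto simp: D_def\<close>)
qed

end

section \<open>The Weyl solution at i\<close>

lemma set_integrable_increasing:
  fixes k :: "real \<Rightarrow> real"
  assumes i: "\<And>n. set_integrable M (A n) k" and inc: "incseq A" and pos: "\<And>x. 0 \<le> k x"
    and bd: "\<And>n. (LINT x:A n|M. k x) \<le> B"
  shows "set_integrable M (\<Union>n. A n) k"
proof -
  let ?f = "\<lambda>n x. indicat_real (A n) x *\<^sub>R k x"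
  have m: "mono (\<lambda>n. ?f n x)" for x
    using inc pos by (auto simp: mono_def incseq_def indicator_def)
  have mi: "incseq (\<lambda>n. LINT x|M. ?f n x)"
    unfolding incseq_def using i m by (auto intro!: integral_mono simp: set_integrable_def mono_def)
  have "\<forall>n. (LINT x|M. ?f n x) \<le> B" using bd by (simp add: set_lebesgue_integral_def)
  then obtain L where L: "(\<lambda>n. LINT x|M. ?f n x) \<longlonglongrightarrow> L" using incseq_convergent[OF mi] by blast
  have lim: "(\<lambda>n. ?f n x) \<longlonglongrightarrow> indicat_real (\<Union>n. A n) x *\<^sub>R k x" for x
    by (intro tendsto_intros LIMSEQ_indicator_incseq inc)
  have ms: "(\<lambda>x. indicat_real (\<Union>n. A n) x *\<^sub>R k x) \<in> borel_measurable M"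
    by (rule borel_measurable_LIMSEQ_metric[OF _ lim]) (use i in \<open>auto simp: set_integrable_def\<close>)
  show ?thesis unfolding set_integrable_def
    by (rule integrable_monotone_convergence[where f = ?f, OF _ _ _ L ms]) (use i m lim in \<open>auto simp: set_integrable_def\<close>)
qed

context left_definite begin

text \<open>Global square integrability is part of the conclusion of the first half: vanishing
  integrals over all [x,y) make u and u1 zero almost everywhere for their measures, so the global
  energy exists and is 0.\<close>

lemma zero_energy_imp:
  assumes Q: "qd_on I u u1 ut" and s: "s \<in> I"
    and z: "\<And>x y. x \<in> I \<Longrightarrow> y \<in> I \<Longrightarrow> x \<le> y \<Longrightarrow>
      set_integrable sg {x..<y} (\<lambda>t. (cmod (u1 t))^2) \<and> (LINT t:{x..<y}|sg. (cmod (u1 t))^2) = 0 \<and>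
      set_integrable ch {x..<y} (\<lambda>t. (cmod (u t))^2) \<and> (LINT t:{x..<y}|ch. (cmod (u t))^2) = 0"
  shows "u s = 0"
proof -
  have ae: "AE t in M. indicat_real I t *\<^sub>R (cmod (k t))^2 = 0"
    if k: "\<And>x y. x \<in> I \<Longrightarrow> y \<in> I \<Longrightarrow> x \<le> y \<Longrightarrow> set_integrable M {x..<y} (\<lambda>t. (cmod (k t))^2)
       \<and> (LINT t:{x..<y}|M. (cmod (k t))^2) = 0" for M and k :: "real \<Rightarrow> complex"
  proof -
    have "AE t in M. t \<in> I \<longrightarrow> k t = 0"
    proof (rule AE_Ivl_intervals)
      fix x y assume "x \<in> I" "y \<in> I" "x \<le> y"
      note kk = k[OF this]
      have "integrable M (\<lambda>t. indicat_real {x..<y} t *\<^sub>R (cmod (k t))^2)" using kk by (simp add: set_integrable_def)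
      moreover have "(LINT t|M. indicat_real {x..<y} t *\<^sub>R (cmod (k t))^2) = 0" using kk by (simp add: set_lebesgue_integral_def)
      ultimately have "AE t in M. indicat_real {x..<y} t *\<^sub>R (cmod (k t))^2 = 0"
        by (subst (asm) integral_nonneg_eq_0_iff_AE) auto
      then show "AE t in M. t \<in> {x..<y} \<longrightarrow> k t = 0" by eventually_elim auto
    qed
    then show ?thesis by eventually_elim (auto simp: indicator_def)
  qed
  note m = qd_on_meas[OF Q]
  have *: "L2_on M I k \<and> (LINT t:I|M. (cmod (k t))^2) = 0"
    if a: "AE t in M. indicat_real I t *\<^sub>R (cmod (k t))^2 = 0" and mk: "meas k" "sets M = sets borel" for M k
  proof
    note mm = meas_real(1)[OF mk(1) Ivl_borel subset_refl mk(2)]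
    show "L2_on M I k" unfolding L2_on_def set_integrable_def
      using integrable_cong_AE[OF mm borel_measurable_const a] by simp
    show "(LINT t:I|M. (cmod (k t))^2) = 0" unfolding set_lebesgue_integral_def
      using integral_cong_AE[OF mm borel_measurable_const a] by simp
  qed
  have "L2_on sg I u1 \<and> (LINT t:I|sg. (cmod (u1 t))^2) = 0"
    by (rule *[OF ae m(2) sets_borel(3)]) (use z in blast)
  moreover have "L2_on ch I u \<and> (LINT t:I|ch. (cmod (u t))^2) = 0"
    by (rule *[OF ae m(1) sets_borel(4)]) (use z in blast)
  ultimately have "H1 u u1" "energy u u1 = 0" using qd_onD(1)[OF Q] unfolding H1_def energy_def by auto
  then show ?thesis using s by (rule energy_zero_imp)
qed

text \<open>The Lagrange identity for u and cnj u at the spectral parameter i: the form equals 2 i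
  Re (u cnj(u1)) and the integrands equal 2 i |u1|^2 and 2 i |u|^2, so that a common factor 2 i
  cancels.\<close>

lemma energy_identity:
  assumes u: "qd_on I u u1 (\<lambda>x. \<i> * u x)" and xy: "x \<in> I" "y \<in> I" "x \<le> y"
  shows "set_integrable sg {x..<y} (\<lambda>t. (cmod (u1 t))^2)" "set_integrable ch {x..<y} (\<lambda>t. (cmod (u t))^2)"
    "Re (u y * cnj (u1 y)) = Re (u x * cnj (u1 x)) + (LINT t:{x..<y}|sg. (cmod (u1 t))^2) + (LINT t:{x..<y}|ch. (cmod (u t))^2)"
proof -
  have uc: "qd_on I (\<lambda>x. cnj (u x)) (\<lambda>x. cnj (u1 x)) (\<lambda>x. cnj (\<i> * u x))" by (rule qd_on_cnj[OF u])
  have a: "ac_on sg I (\<lambda>x. \<i> * u x) (\<lambda>x. \<i> * u1 x)" by (rule ac_on_cmult[OF qd_onD(1)[OF u]])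
  note l = lagrange[OF u a uc ac_on_cnj[OF a] xy(3) Icc_subset[OF xy(1,2)]]
  have e: "\<i> * w * cnj w - cnj (\<i> * w) * w = 2 * \<i> * of_real ((cmod w)^2)" for w
    by (simp add: complex_norm_square[symmetric] algebra_simps)
  have e1: "(\<lambda>s. \<i> * u1 s * cnj (u1 s) - cnj (\<i> * u1 s) * u1 s) = (\<lambda>s. 2 * \<i> * of_real ((cmod (u1 s))^2))"
    "(\<lambda>s. \<i> * u s * cnj (u s) - cnj (\<i> * u s) * u s) = (\<lambda>s. 2 * \<i> * of_real ((cmod (u s))^2))"
    unfolding e by (rule refl)+
  have si: "set_integrable M S (\<lambda>t. (k t)::real)" if "set_integrable M S (\<lambda>s. 2 * \<i> * complex_of_real (k s))" for M S k
  proof -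
    have "set_integrable M S (\<lambda>s. complex_of_real (k s))" using that by simp
    moreover have "(\<lambda>s. indicat_real S s *\<^sub>R complex_of_real (k s)) = (\<lambda>s. complex_of_real (indicat_real S s *\<^sub>R k s))"
      by (simp add: fun_eq_iff scaleR_conv_of_real)
    ultimately show ?thesis unfolding set_integrable_def by (simp only: complex_of_real_integrable_eq)
  qed
  show "set_integrable sg {x..<y} (\<lambda>t. (cmod (u1 t))^2)" "set_integrable ch {x..<y} (\<lambda>t. (cmod (u t))^2)"
    by (rule si[OF l(1)[unfolded e1]], rule si[OF l(2)[unfolded e1]])
  have V: "Vw u u1 (\<lambda>x. \<i> * u x) (\<lambda>x. cnj (u x)) (\<lambda>x. cnj (u1 x)) (\<lambda>x. cnj (\<i> * u x)) t = 2 * \<i> * of_real (Re (u t * cnj (u1 t)))" for t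
    by (simp add: Vw_def complex_eq_iff algebra_simps)
  have ic: "(LINT s:S|M. 2 * \<i> * complex_of_real (k s)) = 2 * \<i> * complex_of_real (LINT s:S|M. k s)" for S M k
    by (simp add: set_integral_complex_of_real)
  have "2 * \<i> * complex_of_real (Re (u y * cnj (u1 y))) = 2 * \<i> * complex_of_real (Re (u x * cnj (u1 x)) 
     + (LINT t:{x..<y}|sg. (cmod (u1 t))^2) + (LINT t:{x..<y}|ch. (cmod (u t))^2))"
    using l(3) unfolding e1 V ic by (simp only: of_real_add distrib_left)
  moreover have "2 * \<i> \<noteq> (0::complex)" by simp
  ultimately show "Re (u y * cnj (u1 y)) = Re (u x * cnj (u1 x)) + (LINT t:{x..<y}|sg. (cmod (u1 t))^2) + (LINT t:{x..<y}|ch. (cmod (u t))^2)"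
    using mult_left_cancel of_real_eq_iff by blast
qed

lemma energy_mono:
  assumes u: "qd_on I u u1 (\<lambda>x. \<i> * u x)" and xy: "x \<in> I" "y \<in> I" "x \<le> y"
  shows "Re (u x * cnj (u1 x)) \<le> Re (u y * cnj (u1 y))"
proof -
  have "0 \<le> (LINT t:{x..<y}|sg. (cmod (u1 t))^2)" "0 \<le> (LINT t:{x..<y}|ch. (cmod (u t))^2)"
    unfolding set_lebesgue_integral_def by (intro integral_nonneg_AE; simp)+
  then show ?thesis using energy_identity(3)[OF assms] by linarith
qed

end

text \<open>The assumptions \<open>to_left\<close>, \<open>to_right\<close> and \<open>cover\<close>
  retain the only geometric facts used about the two endpoints: their neighbourhoods finally leave
  every point behind, and what two of them miss lies in a compact interval.\<close>

locale left_definite_bc = left_definite a b rp rn sg ch +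
  L: left_definite_end a b rp rn sg ch Da Fa + R: left_definite_end a b rp rn sg ch Db Fb
  for a b rp rn sg ch Da Fa Db Fb +
  fixes va va1 vat vb vb1 vbt :: "real \<Rightarrow> complex"
  assumes to_left: "x \<in> I \<Longrightarrow> \<exists>n. \<forall>y\<in>Da n. y \<le> x"
    and to_right: "x \<in> I \<Longrightarrow> \<exists>n. \<forall>y\<in>Db n. x \<le> y"
    and cover: "\<exists>x\<in>I. \<exists>y\<in>I. I \<subseteq> Da n \<union> {x..y} \<union> Db m"
    and bca: "L.lc \<Longrightarrow> L.bc_fun va va1 vat" and bcb: "R.lc \<Longrightarrow> R.bc_fun vb vb1 vbt"
begin

abbreviation "sola z u u1 \<equiv> L.S_near va va1 vat u u1 (\<lambda>x. z * u x) (\<lambda>x. z * u1 x)"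
abbreviation "solb z u u1 \<equiv> R.S_near vb vb1 vbt u u1 (\<lambda>x. z * u x) (\<lambda>x. z * u1 x)"

text \<open>Together with u its conjugate lies in S near the endpoint, so the form of the two tends
  to 0, and Re (u cnj(u1)) is half of the imaginary part of that form. The endpoint is a parameter
  since both sides are needed.\<close>

lemma energy_tendsto_zero:
  assumes E: "left_definite_end a b rp rn sg ch D F" 
    and v: "left_definite_end.lc a b rp rn sg ch D \<Longrightarrow> left_definite_end.bc_fun a b rp rn sg ch D F v v1 vt"
    and u: "left_definite_end.S_near a b rp rn sg ch D F v v1 vt u u1 (\<lambda>x. \<i> * u x) (\<lambda>x. \<i> * u1 x)"
  shows "((\<lambda>x. Re (u x * cnj (u1 x))) \<longlongrightarrow> 0) F"
proof -
  interpret E: left_definite_end a b rp rn sg ch D F by (rule E)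
  have "((\<lambda>x. Vw u u1 (\<lambda>x. \<i> * u x) (\<lambda>x. cnj (u x)) (\<lambda>x. cnj (u1 x)) (\<lambda>x. cnj (\<i> * u x)) x) \<longlongrightarrow> 0) F"
    by (rule E.S_near_orthogonal[OF v u E.S_near_cnj[OF v u]])
  then have l: "((\<lambda>x. Im (Vw u u1 (\<lambda>x. \<i> * u x) (\<lambda>x. cnj (u x)) (\<lambda>x. cnj (u1 x)) (\<lambda>x. cnj (\<i> * u x)) x) / 2) \<longlongrightarrow> Im 0 / 2) F"
    by (intro tendsto_intros) simp_all
  have e: "Im (Vw u u1 (\<lambda>x. \<i> * u x) (\<lambda>x. cnj (u x)) (\<lambda>x. cnj (u1 x)) (\<lambda>x. cnj (\<i> * u x)) x) / 2 = Re (u x * cnj (u1 x))" for x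
    by (simp add: Vw_def algebra_simps)
  show ?thesis using l unfolding e by simp
qed

text \<open>The energy of u increases from the limit 0 at the left endpoint, hence is non-negative.
  If it were identically 0, every local energy would vanish and u would be trivial.\<close>

lemma energy_positive:
  assumes u: "sola \<i> u u1" and nt: "\<exists>x\<in>I. u x \<noteq> 0"
  obtains x0 where "x0 \<in> I" "0 < Re (u x0 * cnj (u1 x0))"
proof -
  define w where "w = (\<lambda>x. Re (u x * cnj (u1 x)))"
  have Q: "qd_on I u u1 (\<lambda>x. \<i> * u x)" using u unfolding L.S_near_def L.Tmax_near_def by simp
  have lim: "(w \<longlongrightarrow> 0) Fa" unfolding w_def
    by (rule energy_tendsto_zero[OF L.left_definite_end_axioms bca u])
  have nonneg: "0 \<le> w x" if x: "x \<in> I" for x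
  proof (rule tendsto_upperbound[OF lim _ L.F_ne])
    obtain n where "\<And>y. y \<in> Da n \<Longrightarrow> y \<le> x" using to_left[OF x] by blast
    then have "\<forall>y\<in>Da n. w y \<le> w x" using energy_mono[OF Q _ x] L.D_sub unfolding w_def by blast
    then show "eventually (\<lambda>y. w y \<le> w x) Fa" unfolding L.ev_iff by blast
  qed
  have "\<exists>x\<in>I. w x \<noteq> 0"
  proof (rule ccontr)
    assume "\<not> ?thesis"
    then have w0: "w x = 0" if "x \<in> I" for x using that by blast
    have z: "set_integrable sg {x..<y} (\<lambda>t. (cmod (u1 t))^2) \<and> (LINT t:{x..<y}|sg. (cmod (u1 t))^2) = 0 \<and>
      set_integrable ch {x..<y} (\<lambda>t. (cmod (u t))^2) \<and> (LINT t:{x..<y}|ch. (cmod (u t))^2) = 0"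
      if xy: "x \<in> I" "y \<in> I" "x \<le> y" for x y
    proof -
      note e = energy_identity[OF Q xy]
      have "0 \<le> (LINT t:{x..<y}|sg. (cmod (u1 t))^2)" "0 \<le> (LINT t:{x..<y}|ch. (cmod (u t))^2)"
        unfolding set_lebesgue_integral_def by (intro integral_nonneg_AE; simp)+
      moreover have "(LINT t:{x..<y}|sg. (cmod (u1 t))^2) + (LINT t:{x..<y}|ch. (cmod (u t))^2) = 0"
        using e(3) w0[OF xy(1)] w0[OF xy(2)] unfolding w_def by linarith
      ultimately show ?thesis using e(1,2) by auto
    qed
    have "u s = 0" if "s \<in> I" for s by (rule zero_energy_imp[OF Q that z])
    then show False using nt by blast
  qed
  then obtain x0 where "x0 \<in> I" "w x0 \<noteq> 0" by blast
  then show ?thesis using that[of x0] nonneg[of x0] unfolding w_def by auto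
qed

text \<open>As a function of m this is a real quadratic polynomial whose leading coefficient is the
  energy of p; where that is positive, the sublevel sets are bounded discs.\<close>

lemma Re_energy_add:
  "Re ((t + m * p) * cnj (t1 + m * p1)) = Re (t * cnj t1) + Re (m * (p * cnj t1 + cnj t * p1)) + (cmod m)^2 * Re (p * cnj p1)"
proof -
  have "(t + m * p) * cnj (t1 + m * p1) = t * cnj t1 + m * (p * cnj t1) + cnj m * (t * cnj p1) + (m * cnj m) * (p * cnj p1)"
    by (simp add: algebra_simps)
  moreover have "m * cnj m = of_real ((cmod m)^2)" by (rule complex_norm_square[symmetric])
  moreover have "Re (cnj m * (t * cnj p1)) = Re (m * (cnj t * p1))"
    by (metis complex_cnj_cnj complex_cnj_mult cnj.simps(1))
  ultimately show ?thesis by (simp add: distrib_left)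
qed

lemma solb_from_L2:
  assumes "qd_on I u u1 (\<lambda>x. z * u x)" "R.L2_near n u u1"
  shows "R.Tmax_near u u1 (\<lambda>x. z * u x) (\<lambda>x. z * u1 x)"
  unfolding R.Tmax_near_def using assms(1) ac_on_cmult[OF qd_onD(1)[OF assms(1)]] assms(2) R.L2_near_cmult[OF assms(2)] by blast

text \<open>The Weyl discs at i are the sets of m for which Re (u cnj(u1)) at x is at most 0, where
  u = t + m p. They shrink as x increases, and they are bounded because p is in S near the left endpoint.\<close>

lemma weyl_solution_lp:
  assumes p: "sola \<i> p p1" and nt: "\<exists>x\<in>I. p x \<noteq> 0" and t: "qd_on I t t1 (\<lambda>x. \<i> * t x)"
  obtains m n where "R.L2_near n (\<lambda>x. t x + m * p x) (\<lambda>x. t1 x + m * p1 x)"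
proof -
  have Qp: "qd_on I p p1 (\<lambda>x. \<i> * p x)" using p unfolding L.S_near_def L.Tmax_near_def by simp
  define w where "w = (\<lambda>m x. Re ((t x + m * p x) * cnj (t1 x + m * p1 x)))"
  have Qu: "qd_on I (\<lambda>x. t x + m * p x) (\<lambda>x. t1 x + m * p1 x) (\<lambda>x. \<i> * (t x + m * p x))" for m
  proof (rule qd_on_cong[OF qd_on_add[OF t qd_on_cmult[OF Qp, of m]] I_co])
    show "\<i> * t x + m * (\<i> * p x) = \<i> * (t x + m * p x)" for x by (simp add: algebra_simps)
  qed simp_all
  obtain x0 where x0: "x0 \<in> I" "0 < Re (p x0 * cnj (p1 x0))" by (rule energy_positive[OF p nt])
  define A where "A = Re (p x0 * cnj (p1 x0))"
  have ppos: "p y \<noteq> 0" if "y \<in> I" "x0 \<le> y" for y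
    using energy_mono[OF Qp x0(1) that] x0(2) by auto
  have "\<exists>y. \<forall>n. y n \<in> Db n \<and> x0 \<le> y n"
  proof (rule choice, rule allI)
    fix n
    obtain k where k: "\<And>y. y \<in> Db k \<Longrightarrow> x0 \<le> y" using to_right[OF x0(1)] by blast
    obtain y where "y \<in> Db (max n k)" using R.D_ne by blast
    then have "y \<in> Db n" "y \<in> Db k" using R.D_mono[of n "max n k"] R.D_mono[of k "max n k"] by auto
    then show "\<exists>y. y \<in> Db n \<and> x0 \<le> y" using k by blast
  qed
  then obtain y where y: "\<And>n. y n \<in> Db n" "\<And>n. x0 \<le> y n" by blast
  have yI: "y n \<in> I" for n using y(1) R.D_sub by blast
  \<comment> \<open>With this parameter t + m p vanishes at \<open>y n\<close>, so its energy there
    is 0 and m belongs to the disc at \<open>y n\<close>.\<close>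
  define ms where "ms = (\<lambda>n. - t (y n) / p (y n))"
  have w0: "w (ms n) (y n) = 0" for n
  proof -
    have "t (y n) + ms n * p (y n) = 0" using ppos[OF yI y(2), of n] by (simp add: ms_def)
    then show ?thesis unfolding w_def by simp
  qed
  have wle: "w (ms n) x \<le> 0" if "x \<in> I" "x \<le> y n" for n x
    using energy_mono[OF Qu that(1) yI that(2), of "ms n"] w0[of n] unfolding w_def by simp
  define K where "K = cmod (p x0 * cnj (t1 x0) + cnj (t x0) * p1 x0)"
  define C where "C = \<bar>Re (t x0 * cnj (t1 x0))\<bar>"
  \<comment> \<open>With m denoting |ms n|, membership in the disc at x0 gives A m^2 <= K m + C. The
    summand 1 of the bound makes m > 1 in the contrary case, so that C can be replaced by C
    m.\<close>
  have bd: "cmod (ms n) \<le> 1 + (K + C) / A" for n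
  proof (rule ccontr)
    let ?m = "cmod (ms n)"
    assume "\<not> ?thesis"
    then have g: "1 + (K + C) / A < ?m" by simp
    have A0: "0 < A" "0 \<le> K" "0 \<le> C" using x0 by (auto simp: A_def K_def C_def)
    have m1: "1 < ?m" using g A0 by (smt (verit) divide_nonneg_pos add_nonneg_nonneg)
    have "K + C < A * ?m" using g A0 by (simp add: field_simps)
    then have "(K + C) * ?m < (A * ?m) * ?m" using m1 by (intro mult_strict_right_mono) auto
    moreover have "C \<le> C * ?m" using m1 A0 by (simp add: mult_le_cancel_left1)
    moreover have "\<bar>Re (ms n * (p x0 * cnj (t1 x0) + cnj (t x0) * p1 x0))\<bar> \<le> ?m * K"
      unfolding K_def norm_mult[symmetric] by (rule abs_Re_le_cmod)
    moreover have "Re (t x0 * cnj (t1 x0)) + Re (ms n * (p x0 * cnj (t1 x0) + cnj (t x0) * p1 x0)) + ?m^2 * A \<le> 0"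
      using wle[OF x0(1) y(2), of n] unfolding w_def Re_energy_add A_def .
    ultimately show False unfolding C_def by (simp add: power2_eq_square algebra_simps)
  qed
  have "bounded (range ms)" using bd by (auto simp: bounded_iff)
  then obtain m r where r: "strict_mono r" and lim: "(ms \<circ> r) \<longlonglongrightarrow> m"
    using bounded_imp_convergent_subsequence by blast
  \<comment> \<open>A fixed x lies to the left of all but finitely many of the chosen points, so the
    limit parameter belongs to the disc at x.\<close>
  have wm: "w m x \<le> 0" if x: "x \<in> I" for x
  proof (rule LIMSEQ_le_const2)
    show "(\<lambda>i. w ((ms \<circ> r) i) x) \<longlonglongrightarrow> w m x" unfolding w_def by (intro tendsto_intros lim)
    obtain k where k: "\<And>y. y \<in> Db k \<Longrightarrow> x \<le> y" using to_right[OF x] by blast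
    have "x \<le> y (r i)" if "k \<le> i" for i
    proof (rule k)
      have "k \<le> r i" using that seq_suble[OF r, of i] by simp
      then show "y (r i) \<in> Db k" using y(1)[of "r i"] R.D_mono by blast
    qed
    then show "\<exists>N. \<forall>n\<ge>N. w ((ms \<circ> r) n) x \<le> 0" using wle[OF x] by auto
  qed
  define u where "u = (\<lambda>x. t x + m * p x)"
  define u1 where "u1 = (\<lambda>x. t1 x + m * p1 x)"
  have Q: "qd_on I u u1 (\<lambda>x. \<i> * u x)" using Qu[of m] unfolding u_def u1_def .
  have wu: "w m x = Re (u x * cnj (u1 x))" for x by (simp add: w_def u_def u1_def)
  obtain l v where lv: "I = (\<Union>i::nat. {l i..v i})" "incseq v" "decseq l" "\<And>i. l i \<in> I" "\<And>i. v i \<in> I"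
    "\<And>x. x \<in> I \<Longrightarrow> \<exists>i. l i < x" "\<And>x. x \<in> I \<Longrightarrow> \<exists>i. x < v i"
    by (rule I_exhaustion; rule that; assumption)
  define S where "S = (\<lambda>i. {x0..<v i})"
  have incS: "incseq S" unfolding S_def using incseqD[OF lv(2)] by (auto simp: incseq_def intro: less_le_trans)
  \<comment> \<open>The energy at \<open>v i\<close> is at most 0, so by the energy identity both
    integrals are at most minus the energy at x0, uniformly in i.\<close>
  have bnd: "set_integrable sg (S i) (\<lambda>x. (cmod (u1 x))^2) \<and> (LINT x:S i|sg. (cmod (u1 x))^2) \<le> - w m x0 \<and>
    set_integrable ch (S i) (\<lambda>x. (cmod (u x))^2) \<and> (LINT x:S i|ch. (cmod (u x))^2) \<le> - w m x0" for i
  proof (cases "x0 \<le> v i")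
    case True
    note e = energy_identity[OF Q x0(1) lv(5) True]
    have "0 \<le> (LINT t:S i|sg. (cmod (u1 t))^2)" "0 \<le> (LINT t:S i|ch. (cmod (u t))^2)"
      unfolding set_lebesgue_integral_def by (intro integral_nonneg_AE; simp)+
    then show ?thesis using e wm[OF lv(5), of i] unfolding S_def wu by linarith
  next
    case False
    then have "S i = {}" by (simp add: S_def)
    then show ?thesis using wm[OF x0(1)] by (simp add: set_lebesgue_integral_def)
  qed
  have U: "set_integrable sg (\<Union>i. S i) (\<lambda>x. (cmod (u1 x))^2)"
    by (rule set_integrable_increasing[OF _ incS, where B = "- w m x0"]) (use bnd in simp_all)
  have U': "set_integrable ch (\<Union>i. S i) (\<lambda>x. (cmod (u x))^2)"
    by (rule set_integrable_increasing[OF _ incS, where B = "- w m x0"]) (use bnd in simp_all)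
  obtain n where n: "\<And>y. y \<in> Db n \<Longrightarrow> x0 \<le> y" using to_right[OF x0(1)] by blast
  have sub: "Db n \<subseteq> (\<Union>i. S i)"
  proof
    fix s assume s: "s \<in> Db n"
    then have "s \<in> I" using R.D_sub by blast
    then obtain i where "s < v i" using lv(7) by blast
    then show "s \<in> (\<Union>i. S i)" using n[OF s] by (auto simp: S_def)
  qed
  have "R.L2_near n u u1" unfolding R.L2_near_def L2_on_def
    using set_integrable_subset[OF U _ sub] set_integrable_subset[OF U' _ sub] R.D_borel sets_borel by simp
  then show ?thesis using that unfolding u_def u1_def by blast
qed

lemma weyl_solution:
  assumes p: "sola \<i> p p1" and nt: "\<exists>x\<in>I. p x \<noteq> 0" and t: "qd_on I t t1 (\<lambda>x. \<i> * t x)"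
  obtains m where "solb \<i> (\<lambda>x. t x + m * p x) (\<lambda>x. t1 x + m * p1 x)"
proof (cases R.lc)
  case False
  obtain m n where mn: "R.L2_near n (\<lambda>x. t x + m * p x) (\<lambda>x. t1 x + m * p1 x)" by (rule weyl_solution_lp[OF assms])
  have Qp: "qd_on I p p1 (\<lambda>x. \<i> * p x)" using p unfolding L.S_near_def L.Tmax_near_def by simp
  have Qu: "qd_on I (\<lambda>x. t x + m * p x) (\<lambda>x. t1 x + m * p1 x) (\<lambda>x. \<i> * (t x + m * p x))"
  proof (rule qd_on_cong[OF qd_on_add[OF t qd_on_cmult[OF Qp, of m]] I_co])
    show "\<i> * t x + m * (\<i> * p x) = \<i> * (t x + m * p x)" for x by (simp add: algebra_simps)
  qed simp_all
  show ?thesis by (rule that[of m]) (use solb_from_L2[OF Qu mn] False in \<open>simp add: R.S_near_def\<close>)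
next
  case True
  have Qp: "qd_on I p p1 (\<lambda>x. \<i> * p x)" using p unfolding L.S_near_def L.Tmax_near_def by simp
  have TNs: "R.Tmax_near u u1 (\<lambda>x. \<i> * u x) (\<lambda>x. \<i> * u1 x)" if Q: "qd_on I u u1 (\<lambda>x. \<i> * u x)" for u u1
  proof -
    obtain n where "R.L2_near n u u1" using True Q complex_i_not_zero unfolding R.lc_def by blast
    then show ?thesis by (rule solb_from_L2[OF Q])
  qed
  obtain vt1 where v: "R.Tmax_near vb vb1 vbt vt1" using bcb[OF True] unfolding R.bc_fun_def by blast
  obtain L1 where L1: "((\<lambda>x. Vw t t1 (\<lambda>x. \<i> * t x) (\<lambda>x. cnj (vb x)) (\<lambda>x. cnj (vb1 x)) (\<lambda>x. cnj (vbt x)) x) \<longlongrightarrow> L1) Fb"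
    by (rule R.Vw_convergent[OF TNs[OF t] R.Tmax_near_cnj[OF v]])
  obtain L2 where L2: "((\<lambda>x. Vw p p1 (\<lambda>x. \<i> * p x) (\<lambda>x. cnj (vb x)) (\<lambda>x. cnj (vb1 x)) (\<lambda>x. cnj (vbt x)) x) \<longlongrightarrow> L2) Fb"
    by (rule R.Vw_convergent[OF TNs[OF Qp] R.Tmax_near_cnj[OF v]])
  \<comment> \<open>Were it 0, p would satisfy the boundary condition at b as well and its energy
    would tend to 0 there; but it increases and is positive at x0. This allows m to be found from
    the linear equation L1 + m L2 = 0.\<close>
  have "L2 \<noteq> 0"
  proof
    assume "L2 = 0"
    then have S: "solb \<i> p p1" using TNs[OF Qp] L2 unfolding R.S_near_def R.V0_iff by simp
    have lim: "((\<lambda>x. Re (p x * cnj (p1 x))) \<longlongrightarrow> 0) Fb"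
      by (rule energy_tendsto_zero[OF R.left_definite_end_axioms bcb S])
    obtain x0 where x0: "x0 \<in> I" "0 < Re (p x0 * cnj (p1 x0))" by (rule energy_positive[OF p nt])
    have "Re (p x0 * cnj (p1 x0)) \<le> 0"
    proof (rule tendsto_lowerbound[OF lim _ R.F_ne])
      obtain n where "\<And>y. y \<in> Db n \<Longrightarrow> x0 \<le> y" using to_right[OF x0(1)] by blast
      then have "\<forall>y\<in>Db n. Re (p x0 * cnj (p1 x0)) \<le> Re (p y * cnj (p1 y))"
        using energy_mono[OF Qp x0(1)] R.D_sub by blast
      then show "eventually (\<lambda>y. Re (p x0 * cnj (p1 x0)) \<le> Re (p y * cnj (p1 y))) Fb" unfolding R.ev_iff by blast
    qed
    then show False using x0(2) by simp
  qed
  define m where "m = - L1 / L2"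
  have e: "(\<lambda>x. \<i> * t x + m * (\<i> * p x)) = (\<lambda>x. \<i> * (t x + m * p x))"
    "(\<lambda>x. \<i> * t1 x + m * (\<i> * p1 x)) = (\<lambda>x. \<i> * (t1 x + m * p1 x))" by (simp_all add: algebra_simps)
  have "((\<lambda>x. Vw (\<lambda>x. t x + m * p x) (\<lambda>x. t1 x + m * p1 x) (\<lambda>x. \<i> * t x + m * (\<i> * p x))
     (\<lambda>x. cnj (vb x)) (\<lambda>x. cnj (vb1 x)) (\<lambda>x. cnj (vbt x)) x) \<longlongrightarrow> L1 + m * L2) Fb"
    unfolding Vw_add_left Vw_cmult_left by (intro tendsto_intros L1 L2)
  moreover have "L1 + m * L2 = 0" using \<open>L2 \<noteq> 0\<close> by (simp add: m_def)
  ultimately have "R.V0 (\<lambda>x. t x + m * p x) (\<lambda>x. t1 x + m * p1 x) (\<lambda>x. \<i> * (t x + m * p x)) vb vb1 vbt"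
    unfolding R.V0_iff e by simp
  moreover have "R.Tmax_near (\<lambda>x. t x + m * p x) (\<lambda>x. t1 x + m * p1 x) (\<lambda>x. \<i> * (t x + m * p x)) (\<lambda>x. \<i> * (t1 x + m * p1 x))"
    using R.Tmax_near_add[OF TNs[OF t] R.Tmax_near_cmult[OF TNs[OF Qp], of m]] unfolding e .
  ultimately show ?thesis by (intro that[of m]) (simp add: R.S_near_def)
qed

end

section \<open>The resolvent near a point of the resolvent set\<close>

text \<open>The weight d goes with the factors p and s, of which only an energy bound is known, and
  1 / d with q and r, whose integrals near the endpoint can be made small.\<close>

lemma young_norm:
  assumes "0 < d"
  shows "cmod (p * q - r * s) \<le> d * ((cmod p)^2 + (cmod s)^2) + (1 / d) * ((cmod q)^2 + (cmod r)^2)"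
proof -
  have y: "x * y \<le> d * x^2 + (1 / d) * y^2" if "0 \<le> x" "0 \<le> y" for x y :: real
  proof -
    have "0 \<le> (d * x - y)^2 / d" using assms by simp
    also have "(d * x - y)^2 / d = d * x^2 + (1 / d) * y^2 - 2 * (x * y)"
      using assms by (simp add: power2_eq_square field_simps)
    finally have "2 * (x * y) \<le> d * x^2 + (1 / d) * y^2" by simp
    moreover have "0 \<le> x * y" using that by simp
    ultimately show ?thesis by linarith
  qed
  have "cmod (p * q - r * s) \<le> cmod p * cmod q + cmod s * cmod r"
    using norm_triangle_ineq4[of "p * q" "r * s"] by (simp add: norm_mult mult.commute)
  also have "\<dots> \<le> (d * (cmod p)^2 + (1 / d) * (cmod q)^2) + (d * (cmod s)^2 + (1 / d) * (cmod r)^2)"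
    by (intro add_mono y norm_ge_zero)
  finally show ?thesis by (simp add: distrib_left)
qed

context left_definite_end begin

text \<open>Two limits have to be interchanged, n to infinity and x to the endpoint. The estimate
  \<open>est\<close> bounds the form of the n-th pair at x by the energy bound K and a tail of the
  fixed pair w, uniformly in n, so it survives the pointwise limit in n.\<close>

lemma V0_closed:
  assumes v: "Tmax_near v v1 vt vt1"
    and T: "\<And>n. qd_on I (f n) (f1 n) (ft n)" "\<And>n. H1 (f n) (f1 n)" "\<And>n. H1 (ft n) (ft1 n)"
    and bd: "\<And>n. energy (f n) (f1 n) \<le> K" "\<And>n. energy (ft n) (ft1 n) \<le> K"
    and V: "\<And>n. V0 (f n) (f1 n) (ft n) v v1 vt"
    and lim: "\<And>x. x \<in> I \<Longrightarrow> (\<lambda>n. f1 n x) \<longlonglongrightarrow> g1 x" "\<And>x. x \<in> I \<Longrightarrow> (\<lambda>n. ft n x) \<longlonglongrightarrow> gt x"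
  shows "V0 g g1 gt v v1 vt"
proof -
  define w where "w = (\<lambda>x. cnj (v x))"
  define w1 where "w1 = (\<lambda>x. cnj (v1 x))"
  define wt where "wt = (\<lambda>x. cnj (vt x))"
  define wt1 where "wt1 = (\<lambda>x. cnj (vt1 x))"
  have W: "Tmax_near w w1 wt wt1" unfolding w_def w1_def wt_def wt1_def by (rule Tmax_near_cnj[OF v])
  note mw = Tmax_near_meas[OF W]
  have Vw0: "((\<lambda>x. Vw (f n) (f1 n) (ft n) w w1 wt x) \<longlongrightarrow> 0) F" for n
    using V[of n] unfolding V0_iff w_def w1_def wt_def .
  obtain n0 where n0: "L2_near n0 w w1" "L2_near n0 wt wt1" using W unfolding Tmax_near_def by blast
  have LT: "L2_near m (f n) (f1 n)" "L2_near m (ft n) (ft1 n)" for m n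
    using T(2,3)[of n] L2_mono[OF _ D_sub[of m] D_borel[of m]] sets_borel unfolding H1_def L2_near_def by auto
  have TT: "Tmax_near (f n) (f1 n) (ft n) (ft1 n)" for n
    using T(1,3)[of n] LT unfolding Tmax_near_def H1_def by blast
  have est: "cmod (Vw (f n) (f1 n) (ft n) w w1 wt x) \<le> 2 * d * K + (1 / d) *
      ((LINT s:D m|sg. (cmod (w1 s))^2 + (cmod (wt1 s))^2) + (LINT s:D m|ch. (cmod (w s))^2 + (cmod (wt s))^2))"
    if m: "n0 \<le> m" and x: "x \<in> D m" and d: "0 < d" for n m x d
  proof -
    note wm = L2_near_mono[OF n0(1) m] L2_near_mono[OF n0(2) m]
    note l = lagrange_tail[OF TT W LT[of m n] wm]
    have i: "set_integrable sg (D m) (\<lambda>s. (cmod (ft1 n s))^2 + (cmod (f1 n s))^2)"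
      "set_integrable sg (D m) (\<lambda>s. (cmod (w1 s))^2 + (cmod (wt1 s))^2)"
      "set_integrable ch (D m) (\<lambda>s. (cmod (ft n s))^2 + (cmod (f n s))^2)"
      "set_integrable ch (D m) (\<lambda>s. (cmod (w s))^2 + (cmod (wt s))^2)"
      using LT[of m n] wm unfolding L2_near_def L2_on_def by (intro set_integral_add(1); simp)+
    have "(LINT s:D m|sg. cmod (ft1 n s * w1 s - wt1 s * f1 n s)) \<le>
      (LINT s:D m|sg. d * ((cmod (ft1 n s))^2 + (cmod (f1 n s))^2) + (1 / d) * ((cmod (w1 s))^2 + (cmod (wt1 s))^2))"
      by (intro set_integral_mono l(1) set_integral_add(1) set_integrable_mult_right i young_norm d)
    also have "\<dots> = d * (LINT s:D m|sg. (cmod (ft1 n s))^2 + (cmod (f1 n s))^2) + (1 / d) * (LINT s:D m|sg. (cmod (w1 s))^2 + (cmod (wt1 s))^2)"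
      by (subst set_integral_add(2)) (intro set_integrable_mult_right i | simp)+
    finally have A: "(LINT s:D m|sg. cmod (ft1 n s * w1 s - wt1 s * f1 n s)) \<le>
      d * (LINT s:D m|sg. (cmod (ft1 n s))^2 + (cmod (f1 n s))^2) + (1 / d) * (LINT s:D m|sg. (cmod (w1 s))^2 + (cmod (wt1 s))^2)" .
    have "(LINT s:D m|ch. cmod (ft n s * w s - wt s * f n s)) \<le>
      (LINT s:D m|ch. d * ((cmod (ft n s))^2 + (cmod (f n s))^2) + (1 / d) * ((cmod (w s))^2 + (cmod (wt s))^2))"
      by (intro set_integral_mono l(2) set_integral_add(1) set_integrable_mult_right i young_norm d)
    also have "\<dots> = d * (LINT s:D m|ch. (cmod (ft n s))^2 + (cmod (f n s))^2) + (1 / d) * (LINT s:D m|ch. (cmod (w s))^2 + (cmod (wt s))^2)"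
      by (subst set_integral_add(2)) (intro set_integrable_mult_right i | simp)+
    finally have B: "(LINT s:D m|ch. cmod (ft n s * w s - wt s * f n s)) \<le>
      d * (LINT s:D m|ch. (cmod (ft n s))^2 + (cmod (f n s))^2) + (1 / d) * (LINT s:D m|ch. (cmod (w s))^2 + (cmod (wt s))^2)" .
    have e: "(LINT s:D m|M. (cmod (p s))^2 + (cmod (q s))^2) \<le> (LINT s:I|M. (cmod (p s))^2) + (LINT s:I|M. (cmod (q s))^2)"
      if "L2_on M I p" "L2_on M I q" "sets M = sets borel" for M p q
    proof -
      have "(LINT s:D m|M. (cmod (p s))^2 + (cmod (q s))^2) \<le> (LINT s:I|M. (cmod (p s))^2 + (cmod (q s))^2)"
        by (rule set_integral_mono_set[OF set_integral_add(1)])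
          (use that D_sub D_borel in \<open>auto simp: L2_on_def\<close>)
      also have "\<dots> = (LINT s:I|M. (cmod (p s))^2) + (LINT s:I|M. (cmod (q s))^2)"
        by (rule set_integral_add(2)) (use that in \<open>auto simp: L2_on_def\<close>)
      finally show ?thesis .
    qed
    have "(LINT s:D m|sg. (cmod (ft1 n s))^2 + (cmod (f1 n s))^2) + (LINT s:D m|ch. (cmod (ft n s))^2 + (cmod (f n s))^2)
      \<le> energy (f n) (f1 n) + energy (ft n) (ft1 n)"
      using e[of sg "ft1 n" "f1 n"] e[of ch "ft n" "f n"] T(2,3)[of n] sets_borel unfolding H1_def energy_def by auto
    also have "\<dots> \<le> 2 * K" using bd[of n] by simp
    finally have C: "d * ((LINT s:D m|sg. (cmod (ft1 n s))^2 + (cmod (f1 n s))^2) + (LINT s:D m|ch. (cmod (ft n s))^2 + (cmod (f n s))^2)) \<le> d * (2 * K)"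
      using d by (intro mult_left_mono) auto
    let ?T = "2 * d * K + (1 / d) *
      ((LINT s:D m|sg. (cmod (w1 s))^2 + (cmod (wt1 s))^2) + (LINT s:D m|ch. (cmod (w s))^2 + (cmod (wt s))^2))"
    have dif: "cmod (Vw (f n) (f1 n) (ft n) w w1 wt x - Vw (f n) (f1 n) (ft n) w w1 wt y) \<le> ?T" if "y \<in> D m" for y
    proof -
      have "cmod (Vw (f n) (f1 n) (ft n) w w1 wt x - Vw (f n) (f1 n) (ft n) w w1 wt y)
        \<le> (LINT s:D m|sg. cmod (ft1 n s * w1 s - wt1 s * f1 n s)) + (LINT s:D m|ch. cmod (ft n s * w s - wt s * f n s))"
        by (rule l(3)[OF order_refl that x])
      also have "\<dots> \<le> ?T" using A B C by (simp add: distrib_left)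
      finally show ?thesis .
    qed
    \<comment> \<open>Letting y tend to the endpoint, where the form of the n-th pair vanishes,
      turns the bound on the difference into a bound at x itself.\<close>
    show ?thesis
    proof (rule tendsto_upperbound[OF _ _ F_ne])
      show "((\<lambda>y. cmod (Vw (f n) (f1 n) (ft n) w w1 wt x - Vw (f n) (f1 n) (ft n) w w1 wt y)) \<longlongrightarrow> cmod (Vw (f n) (f1 n) (ft n) w w1 wt x)) F"
        using tendsto_norm[OF tendsto_diff[OF tendsto_const Vw0]] by simp
      show "eventually (\<lambda>y. cmod (Vw (f n) (f1 n) (ft n) w w1 wt x - Vw (f n) (f1 n) (ft n) w w1 wt y) \<le> ?T) F"
        unfolding ev_iff using dif by blast
    qed
  qed
  have glim: "cmod (Vw g g1 gt w w1 wt x) \<le> B" if x: "x \<in> I" and B: "\<And>n. cmod (Vw (f n) (f1 n) (ft n) w w1 wt x) \<le> B" for x B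
  proof (rule LIMSEQ_le_const2)
    show "(\<lambda>n. cmod (Vw (f n) (f1 n) (ft n) w w1 wt x)) \<longlonglongrightarrow> cmod (Vw g g1 gt w w1 wt x)"
      unfolding Vw_def by (intro tendsto_intros lim x)
  qed (use B in blast)
  have "((\<lambda>x. Vw g g1 gt w w1 wt x) \<longlongrightarrow> 0) F"
  proof (rule tendstoI)
    fix e :: real assume e: "0 < e"
    \<comment> \<open>This weight keeps the first part 2 d K below e / 2; the absolute value and the
      summand 1 keep the denominator positive.\<close>
    define d where "d = e / (4 * (\<bar>K\<bar> + 1))"
    have d: "0 < d" using e by (simp add: d_def)
    have "2 * d * K \<le> 2 * d * (\<bar>K\<bar> + 1)" using d by (intro mult_left_mono) auto
    also have "\<dots> = e / 2" by (simp add: d_def field_simps)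
    finally have dK: "2 * d * K \<le> e / 2" .
    have i: "set_integrable sg (D n0) (\<lambda>s. (cmod (w1 s))^2 + (cmod (wt1 s))^2)"
      "set_integrable ch (D n0) (\<lambda>s. (cmod (w s))^2 + (cmod (wt s))^2)"
      using n0 unfolding L2_near_def L2_on_def by (intro set_integral_add(1); simp)+
    \<comment> \<open>Two tails below d e / 5, divided by d, contribute at most 2 e / 5, so the sum
      with e / 2 stays strictly below e.\<close>
    have de: "0 < d * e / 5" using d e by simp
    obtain m1 where m1: "n0 \<le> m1" "(LINT s:D m1|sg. (cmod (w1 s))^2 + (cmod (wt1 s))^2) < d * e / 5"
      by (rule tail_small[OF i(1) sets_borel(3) de])
    obtain m2 where m2: "n0 \<le> m2" "(LINT s:D m2|ch. (cmod (w s))^2 + (cmod (wt s))^2) < d * e / 5"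
      by (rule tail_small[OF i(2) sets_borel(4) de])
    define m where "m = max m1 m2"
    have mm: "n0 \<le> m" "D m \<subseteq> D m1" "D m \<subseteq> D m2" "D m1 \<subseteq> D n0" "D m2 \<subseteq> D n0"
      using m1(1) m2(1) D_mono by (auto simp: m_def)
    have "(LINT s:D m|sg. (cmod (w1 s))^2 + (cmod (wt1 s))^2) \<le> (LINT s:D m1|sg. (cmod (w1 s))^2 + (cmod (wt1 s))^2)"
      by (rule set_integral_mono_set[OF set_integrable_subset[OF i(1) _ mm(4)] mm(2)]) (use D_borel sets_borel in auto)
    moreover have "(LINT s:D m|ch. (cmod (w s))^2 + (cmod (wt s))^2) \<le> (LINT s:D m2|ch. (cmod (w s))^2 + (cmod (wt s))^2)"
      by (rule set_integral_mono_set[OF set_integrable_subset[OF i(2) _ mm(5)] mm(3)]) (use D_borel sets_borel in auto)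
    ultimately have "(LINT s:D m|sg. (cmod (w1 s))^2 + (cmod (wt1 s))^2) + (LINT s:D m|ch. (cmod (w s))^2 + (cmod (wt s))^2) \<le> 2 * (d * e / 5)"
      using m1 m2 by linarith
    then have "(1 / d) * ((LINT s:D m|sg. (cmod (w1 s))^2 + (cmod (wt1 s))^2) + (LINT s:D m|ch. (cmod (w s))^2 + (cmod (wt s))^2)) \<le> (1 / d) * (2 * (d * e / 5))"
      using d by (intro mult_left_mono) auto
    also have "\<dots> = 2 * e / 5" using d by simp
    finally have small: "2 * d * K + (1 / d) * ((LINT s:D m|sg. (cmod (w1 s))^2 + (cmod (wt1 s))^2) + (LINT s:D m|ch. (cmod (w s))^2 + (cmod (wt s))^2)) \<le> e / 2 + 2 * e / 5"
      using dK by linarith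
    have "dist (Vw g g1 gt w w1 wt x) 0 < e" if x: "x \<in> D m" for x
    proof -
      have "cmod (Vw g g1 gt w w1 wt x) \<le> e / 2 + 2 * e / 5"
        by (rule glim) (use x D_sub in blast, rule order_trans[OF est[OF mm(1) x d] small])
      then show ?thesis using e by (simp add: dist_norm)
    qed
    then show "eventually (\<lambda>x. dist (Vw g g1 gt w w1 wt x) 0 < e) F" unfolding ev_iff by blast
  qed
  then show ?thesis unfolding V0_iff w_def w1_def wt_def .
qed

end

section \<open>Pointwise limits of sequences with bounded energy\<close>

context left_definite begin

lemma meas_LIMSEQ:
  assumes "\<And>n. meas (g n)" "\<And>x. x \<in> I \<Longrightarrow> (\<lambda>n. g n x) \<longlonglongrightarrow> h x"
  shows "meas h"
  unfolding meas_def
proof (rule borel_measurable_LIMSEQ_metric)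
  show "(\<lambda>x. indicat_real I x *\<^sub>R g n x) \<in> borel_measurable borel" for n using assms(1) unfolding meas_def .
  show "(\<lambda>n. indicat_real I x *\<^sub>R g n x) \<longlonglongrightarrow> indicat_real I x *\<^sub>R h x" for x
    using assms(2) by (cases "x \<in> I") auto
qed

lemma dominated_interval:
  assumes g: "\<And>n. meas (g n)" "\<And>x. x \<in> I \<Longrightarrow> (\<lambda>n. g n x) \<longlonglongrightarrow> h x"
    and xy: "x \<in> I" "y \<in> I" and M: "loc_finite_on a b M"
    and B: "\<And>n s. s \<in> {x..<y} \<Longrightarrow> cmod (g n s) \<le> B"
  shows "set_integrable M {x..<y} h" "(\<lambda>n. LINT s:{x..<y}|M. g n s) \<longlonglongrightarrow> (LINT s:{x..<y}|M. h s)"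
proof -
  have sM: "sets M = sets borel" using M by (simp add: loc_finite_on_def)
  have "emeasure M {x..<y} \<le> emeasure M {x..y}" by (rule emeasure_mono) (auto simp: sM)
  also have "\<dots> < \<infinity>" using M xy by (simp add: loc_finite_on_def)
  finally have fin: "emeasure M {x..<y} < \<infinity>" .
  have w: "integrable M (\<lambda>s. indicat_real {x..<y} s *\<^sub>R B)" using fin sM by simp
  have sub: "{x..<y} \<subseteq> I" by (rule I_co[OF xy])
  have ms: "(\<lambda>s. indicat_real {x..<y} s *\<^sub>R g n s) \<in> borel_measurable M" for n
    by (rule meas_measurable[OF g(1) _ sub sM]) simp
  have mh: "(\<lambda>s. indicat_real {x..<y} s *\<^sub>R h s) \<in> borel_measurable M"
    by (rule meas_measurable[OF meas_LIMSEQ[of g h] _ sub sM]) (use g in auto)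
  have lim: "AE s in M. (\<lambda>n. indicat_real {x..<y} s *\<^sub>R g n s) \<longlonglongrightarrow> indicat_real {x..<y} s *\<^sub>R h s"
    using g(2) sub by (intro AE_I2) (auto simp: indicator_def)
  have bd: "AE s in M. norm (indicat_real {x..<y} s *\<^sub>R g n s) \<le> indicat_real {x..<y} s *\<^sub>R B" for n
    using B by (intro AE_I2) (auto simp: indicator_def)
  show "set_integrable M {x..<y} h" unfolding set_integrable_def
    by (rule integrable_dominated_convergence[OF mh ms w lim bd])
  show "(\<lambda>n. LINT s:{x..<y}|M. g n s) \<longlonglongrightarrow> (LINT s:{x..<y}|M. h s)" unfolding set_lebesgue_integral_def
    by (rule integral_dominated_convergence[OF mh ms w lim bd])
qed

lemma L2_fatou:
  assumes g: "\<And>n. meas (g n)" "\<And>x. x \<in> I \<Longrightarrow> (\<lambda>n. g n x) \<longlonglongrightarrow> h x"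
    and M: "sets M = sets borel" and L: "\<And>n. L2_on M I (g n)" "\<And>n. (LINT x:I|M. (cmod (g n x))^2) \<le> K"
  shows "L2_on M I h"
proof -
  let ?u = "\<lambda>n x. indicat_real I x *\<^sub>R (cmod (g n x))^2" and ?h = "\<lambda>x. indicat_real I x *\<^sub>R (cmod (h x))^2"
  have mu: "?u n \<in> borel_measurable M" for n by (rule meas_real(1)[OF g(1) Ivl_borel subset_refl M])
  have mh: "?h \<in> borel_measurable M" by (rule meas_real(1)[OF meas_LIMSEQ[OF g] Ivl_borel subset_refl M])
  have lim: "(\<lambda>n. ?u n x) \<longlonglongrightarrow> ?h x" for x
    using g(2) by (cases "x \<in> I") (auto intro!: tendsto_intros)
  have "(\<integral>\<^sup>+x. ennreal (?h x) \<partial>M) = (\<integral>\<^sup>+x. liminf (\<lambda>n. ennreal (?u n x)) \<partial>M)"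
    by (intro nn_integral_cong lim_imp_Liminf[symmetric] tendsto_ennrealI lim) simp
  also have "\<dots> \<le> liminf (\<lambda>n. \<integral>\<^sup>+x. ennreal (?u n x) \<partial>M)"
    by (rule nn_integral_liminf) (use mu in measurable)
  also have "\<dots> \<le> liminf (\<lambda>n. ennreal K)"
  proof (rule Liminf_mono, rule always_eventually, rule allI)
    fix n
    have "(\<integral>\<^sup>+x. ennreal (?u n x) \<partial>M) = ennreal (LINT x|M. ?u n x)"
      by (rule nn_integral_eq_integral) (use L(1)[of n] in \<open>auto simp: L2_on_def set_integrable_def\<close>)
    also have "\<dots> \<le> ennreal K" using L(2)[of n] unfolding set_lebesgue_integral_def by (rule ennreal_leI)
    finally show "(\<integral>\<^sup>+x. ennreal (?u n x) \<partial>M) \<le> ennreal K" .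
  qed
  also have "\<dots> < \<infinity>" by (simp add: Liminf_const)
  finally have "(\<integral>\<^sup>+x. ennreal (?h x) \<partial>M) < \<infinity>" .
  then show ?thesis unfolding L2_on_def set_integrable_def
    by (intro integrableI_nonneg mh) auto
qed

lemma sg_pos: 
  assumes "x \<in> I" "y \<in> I" "x < y" shows "0 < measure sg {x..<y}"
proof -
  define c where "c = (x + y) / 2"
  define e where "e = (y - x) / 2"
  have cI: "c \<in> I" by (rule Ivl_convex[OF assms(1,2)]) (use assms(3) in \<open>auto simp: c_def\<close>)
  have "0 < e" using assms(3) by (simp add: e_def)
  then have "0 < emeasure sg (ball c e)" using std cI by (simp add: standing_def)
  also have "ball c e \<subseteq> {x..<y}" by (auto simp: c_def e_def dist_real_def abs_if field_simps split: if_splits)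
  then have "emeasure sg (ball c e) \<le> emeasure sg {x..<y}" by (intro emeasure_mono) (auto simp: sets_borel)
  finally have 1: "0 < emeasure sg {x..<y}" .
  have "emeasure sg {x..<y} \<le> emeasure sg {x..y}" by (rule emeasure_mono) (auto simp: sets_borel)
  also have "\<dots> < \<infinity>" using lf(3) assms by (simp add: loc_finite_on_def)
  finally show ?thesis using 1 by (simp add: measure_def enn2real_positive_iff)
qed

text \<open>The quasi-derivatives converge pointwise because f(y) - f(x) equals
  f1(x) sg([x,y)) plus an integral of the differences f1(s) - f1(x), which only involve f and ft.\<close>

lemma qd_on_closed:
  assumes T: "\<And>n. qd_on I (f n) (f1 n) (ft n)" "\<And>n. H1 (f n) (f1 n)" "\<And>n. H1 (ft n) (ft1 n)"
    and bd: "\<And>n. energy (f n) (f1 n) \<le> K" "\<And>n. energy (ft n) (ft1 n) \<le> K"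
    and lim: "\<And>x. x \<in> I \<Longrightarrow> (\<lambda>n. f n x) \<longlonglongrightarrow> g x" "\<And>x. x \<in> I \<Longrightarrow> (\<lambda>n. ft n x) \<longlonglongrightarrow> gt x"
  obtains g1 where "qd_on I g g1 gt" "H1 g g1" "\<And>x. x \<in> I \<Longrightarrow> (\<lambda>n. f1 n x) \<longlonglongrightarrow> g1 x"
proof -
  note m = qd_on_meas[OF T(1)]
  have pb: "\<exists>B. \<forall>n. \<forall>s\<in>{x..y}. cmod (p n s) \<le> B"
    if xy: "x \<in> I" "y \<in> I" and H: "\<And>n. H1 (p n) (q n)" "\<And>n. energy (p n) (q n) \<le> K" for x y and p q :: "nat \<Rightarrow> real \<Rightarrow> complex"
  proof -
    obtain C where C: "0 \<le> C" "\<And>f h s. H1 f h \<Longrightarrow> s \<in> {x..y} \<Longrightarrow> cmod (f s) \<le> C * sqrt (energy f h)"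
      by (rule point_bound[OF xy]; rule that; assumption)
    have "cmod (p n s) \<le> C * sqrt K" if "s \<in> {x..y}" for n s
      using C(2)[OF H(1) that, of n] mult_left_mono[OF real_sqrt_le_mono[OF H(2)[of n]] C(1)] by linarith
    then show ?thesis by blast
  qed
  have f_int: "set_integrable ch {x..<y} g \<and> (\<lambda>n. LINT s:{x..<y}|ch. f n s) \<longlonglongrightarrow> (LINT s:{x..<y}|ch. g s)"
    and t_int: "loc_finite_on a b M \<Longrightarrow> set_integrable M {x..<y} gt \<and> (\<lambda>n. LINT s:{x..<y}|M. ft n s) \<longlonglongrightarrow> (LINT s:{x..<y}|M. gt s)"
    if xy: "x \<in> I" "y \<in> I" for x y M
  proof -
    obtain B where B: "\<forall>n. \<forall>s\<in>{x..y}. cmod (f n s) \<le> B" using pb[of x y f f1, OF xy T(2) bd(1)] by blast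
    show "set_integrable ch {x..<y} g \<and> (\<lambda>n. LINT s:{x..<y}|ch. f n s) \<longlonglongrightarrow> (LINT s:{x..<y}|ch. g s)"
      using dominated_interval[OF m(1) lim(1) xy lf(4), of B] B by simp
    obtain B' where B': "\<forall>n. \<forall>s\<in>{x..y}. cmod (ft n s) \<le> B'" using pb[of x y ft ft1, OF xy T(3) bd(2)] by blast
    show "set_integrable M {x..<y} gt \<and> (\<lambda>n. LINT s:{x..<y}|M. ft n s) \<longlonglongrightarrow> (LINT s:{x..<y}|M. gt s)"
      if M: "loc_finite_on a b M"
      using dominated_interval[OF m(3) lim(2) xy M, of B'] B' by simp
  qed
  define J where "J = (\<lambda>x y. (LINT s:{x..<y}|ch. g s) - (LINT s:{x..<y}|rp. gt s) + (LINT s:{x..<y}|rn. gt s))"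
  \<comment> \<open>Increments of f1 involve only the integrals of f and ft, so they converge before
    anything is known about f1 itself.\<close>
  have d_lim: "(\<lambda>n. f1 n y - f1 n x) \<longlonglongrightarrow> J x y" if xy: "x \<in> I" "y \<in> I" "x \<le> y" for x y
  proof -
    have "(\<lambda>n. (LINT s:{x..<y}|ch. f n s) - (LINT s:{x..<y}|rp. ft n s) + (LINT s:{x..<y}|rn. ft n s)) \<longlonglongrightarrow> J x y"
      unfolding J_def using f_int[OF xy(1,2)] t_int[OF xy(1,2) lf(1)] t_int[OF xy(1,2) lf(2)] by (intro tendsto_intros) auto
    moreover have "f1 n y - f1 n x = (LINT s:{x..<y}|ch. f n s) - (LINT s:{x..<y}|rp. ft n s) + (LINT s:{x..<y}|rn. ft n s)" for n
      using qd_onD(5)[OF T(1) xy, of n] by simp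
    ultimately show ?thesis by simp
  qed
  have d_bd: "\<exists>B. \<forall>n. \<forall>s\<in>{x..y}. cmod (f1 n s - f1 n x) \<le> B" if xy: "x \<in> I" "y \<in> I" for x y
  proof -
    obtain B where B: "\<forall>n. \<forall>s\<in>{x..y}. cmod (f n s) \<le> B" using pb[of x y f f1, OF xy T(2) bd(1)] by blast
    obtain B' where B': "\<forall>n. \<forall>s\<in>{x..y}. cmod (ft n s) \<le> B'" using pb[of x y ft ft1, OF xy T(3) bd(2)] by blast
    have ib: "cmod (LINT r:{x..<s}|M. p r) \<le> \<bar>C\<bar> * measure M {x..<y}"
      if i: "set_integrable M {x..<s} p" and C: "\<And>r. r \<in> {x..y} \<Longrightarrow> cmod (p r) \<le> C" and s: "s \<in> {x..y}" and M: "loc_finite_on a b M" for M p C s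
    proof -
      have sM: "sets M = sets borel" using M by (simp add: loc_finite_on_def)
      have "emeasure M {x..<y} \<le> emeasure M {x..y}" by (rule emeasure_mono) (auto simp: sM)
      also have "\<dots> < \<infinity>" using M xy by (simp add: loc_finite_on_def)
      finally have fin: "emeasure M {x..<y} < \<infinity>" .
      have c: "set_integrable M {x..<y} (\<lambda>_. \<bar>C\<bar>)" unfolding set_integrable_def using fin sM by simp
      have "cmod (LINT r:{x..<s}|M. p r) \<le> (LINT r:{x..<s}|M. cmod (p r))" by (rule set_integral_norm_bound[OF i])
      also have "\<dots> \<le> (LINT r:{x..<s}|M. \<bar>C\<bar>)"
      proof (rule set_integral_mono[OF set_integrable_norm[OF i] set_integrable_subset[OF c]])
        show "cmod (p r) \<le> \<bar>C\<bar>" if "r \<in> {x..<s}" for r using C[of r] that s by auto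
      qed (use s sM in auto)
      also have "\<dots> \<le> (LINT r:{x..<y}|M. \<bar>C\<bar>)" by (rule set_integral_mono_set[OF c]) (use s sM in auto)
      also have "\<dots> = \<bar>C\<bar> * measure M {x..<y}" using sM by (simp add: set_lebesgue_integral_def)
      finally show ?thesis .
    qed
    have "cmod (f1 n s - f1 n x) \<le> \<bar>B\<bar> * measure ch {x..<y} + \<bar>B'\<bar> * measure rp {x..<y} + \<bar>B'\<bar> * measure rn {x..<y}"
      if s: "s \<in> {x..y}" for n s
    proof -
      have sI: "s \<in> I" using s Icc_subset[OF xy] by blast
      have xs: "x \<le> s" using s by simp
      have "f1 n s - f1 n x = (LINT r:{x..<s}|ch. f n r) - (LINT r:{x..<s}|rp. ft n r) + (LINT r:{x..<s}|rn. ft n r)"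
        using qd_onD(5)[OF T(1) xy(1) sI xs, of n] by simp
      also have "cmod \<dots> \<le> cmod (LINT r:{x..<s}|ch. f n r) + cmod (LINT r:{x..<s}|rp. ft n r) + cmod (LINT r:{x..<s}|rn. ft n r)"
        by (intro order_trans[OF norm_triangle_ineq] add_right_mono norm_triangle_ineq4)
      also have "\<dots> \<le> \<bar>B\<bar> * measure ch {x..<y} + \<bar>B'\<bar> * measure rp {x..<y} + \<bar>B'\<bar> * measure rn {x..<y}"
        by (intro add_mono ib qd_onD(2-4)[OF T(1) xy(1) sI xs] s lf) (use B B' in auto)
      finally show ?thesis .
    qed
    then show ?thesis by blast
  qed
  have conv: "\<exists>L. (\<lambda>n. f1 n x) \<longlonglongrightarrow> L" if x: "x \<in> I" for x
  proof -
    obtain y where y: "y \<in> I" "x < y" by (rule Ivl_upper[OF x])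
    define S where "S = measure sg {x..<y}"
    have S: "0 < S" unfolding S_def by (rule sg_pos[OF x y])
    \<comment> \<open>The differences converge only at points to the right of x. Cutting them off at
      x gives a sequence with a limit on all of \<open>I\<close>, as dominated convergence is stated
      here.\<close>
    define G where "G = (\<lambda>n s. if s \<in> {x..} then f1 n s - f1 n x else 0)"
    have mG: "meas (G n)" for n unfolding G_def
      by (rule meas_if[OF meas_diff[OF m(2) meas_const] meas_const]) simp
    have limG: "(\<lambda>n. G n s) \<longlonglongrightarrow> (if s \<in> {x..} then J x s else 0)" if "s \<in> I" for s
      unfolding G_def using d_lim[OF x that] by auto
    obtain B where B: "\<forall>n. \<forall>s\<in>{x..y}. cmod (f1 n s - f1 n x) \<le> B" using d_bd[OF x y(1)] by blast
    have BG: "cmod (G n s) \<le> B" if "s \<in> {x..<y}" for n s using B that by (simp add: G_def)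
    note GI = dominated_interval(2)[OF mG limG x y(1) lf(3) BG]
    have "f1 n x = ((f n y - f n x) - (LINT s:{x..<y}|sg. G n s)) / of_real S" for n
    proof -
      have i1: "set_integrable sg {x..<y} (f1 n)" by (rule ac_onD(1)[OF qd_onD(1)[OF T(1)]]) (use x y in auto)
      have "emeasure sg {x..<y} \<le> emeasure sg {x..y}" by (rule emeasure_mono) (auto simp: sets_borel)
      also have "\<dots> < \<infinity>" using lf(3) x y by (simp add: loc_finite_on_def)
      finally have fin: "emeasure sg {x..<y} < \<infinity>" .
      have i2: "set_integrable sg {x..<y} (\<lambda>_. f1 n x)" unfolding set_integrable_def using fin sets_borel by simp
      have "(LINT s:{x..<y}|sg. G n s) = (LINT s:{x..<y}|sg. f1 n s - f1 n x)"
        by (rule set_lebesgue_integral_cong) (auto simp: G_def sets_borel)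
      also have "\<dots> = (LINT s:{x..<y}|sg. f1 n s) - (LINT s:{x..<y}|sg. f1 n x)"
        by (rule set_integral_diff(2)[OF i1 i2])
      also have "(LINT s:{x..<y}|sg. f1 n x) = of_real S * f1 n x"
        using sets_borel by (simp add: set_lebesgue_integral_def S_def scaleR_conv_of_real)
      also have "(LINT s:{x..<y}|sg. f1 n s) = f n y - f n x"
        using ac_onD(2)[OF qd_onD(1)[OF T(1)] x y(1), of n] y(2) by simp
      finally show ?thesis using S by (simp add: field_simps)
    qed
    moreover have "(\<lambda>n. ((f n y - f n x) - (LINT s:{x..<y}|sg. G n s)) / of_real S) \<longlonglongrightarrow>
      ((g y - g x) - (LINT s:{x..<y}|sg. (if s \<in> {x..} then J x s else 0))) / of_real S"
      by (intro tendsto_intros lim GI x y) (use S in auto)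
    ultimately show ?thesis by auto
  qed
  define g1 where "g1 = (\<lambda>x. lim (\<lambda>n. f1 n x))"
  have g1: "(\<lambda>n. f1 n x) \<longlonglongrightarrow> g1 x" if "x \<in> I" for x
    using conv[OF that] unfolding g1_def by (auto simp: limI)
  have A: "ac_on sg I g g1"
  proof (rule ac_onI)
    fix x y assume xy: "x \<in> I" "y \<in> I" "x \<le> y"
    obtain B where B: "\<forall>n. \<forall>s\<in>{x..y}. cmod (f1 n s - f1 n x) \<le> B" using d_bd[OF xy(1,2)] by blast
    obtain B' where B': "\<forall>n. cmod (f1 n x) \<le> B'"
      using convergent_imp_Bseq[OF convergentI[OF g1[OF xy(1)]]] unfolding Bseq_def by blast
    have bb: "cmod (f1 n s) \<le> B + B'" if s: "s \<in> {x..<y}" for n s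
    proof -
      have "cmod (f1 n s) \<le> cmod (f1 n s - f1 n x) + cmod (f1 n x)"
        using norm_triangle_ineq[of "f1 n s - f1 n x" "f1 n x"] by simp
      moreover have "cmod (f1 n s - f1 n x) \<le> B" using B s by simp
      ultimately show ?thesis using B'[rule_format, of n] by linarith
    qed
    note d = dominated_interval[OF m(2) g1 xy(1,2) lf(3) bb]
    show "set_integrable sg {x..<y} g1" by (rule d(1))
    have "(\<lambda>n. f n x + (LINT s:{x..<y}|sg. f1 n s)) \<longlonglongrightarrow> g x + (LINT s:{x..<y}|sg. g1 s)"
      by (intro tendsto_intros lim xy d(2))
    then have "(\<lambda>n. f n y) \<longlonglongrightarrow> g x + (LINT s:{x..<y}|sg. g1 s)"
      unfolding ac_onD(2)[OF qd_onD(1)[OF T(1)] xy] .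
    then show "g y = g x + (LINT s:{x..<y}|sg. g1 s)" using lim(1)[OF xy(2)] LIMSEQ_unique by blast
  qed
  have Q: "qd_on I g g1 gt"
  proof (rule qd_onI[OF A])
    fix x y assume xy: "x \<in> I" "y \<in> I" "x \<le> y"
    show "set_integrable ch {x..<y} g" "set_integrable rp {x..<y} gt" "set_integrable rn {x..<y} gt"
      using f_int[OF xy(1,2)] t_int[OF xy(1,2)] lf by auto
    have "(\<lambda>n. f1 n y - f1 n x) \<longlonglongrightarrow> g1 y - g1 x" by (intro tendsto_intros g1 xy)
    then have "g1 y - g1 x = J x y" using d_lim[OF xy] LIMSEQ_unique by blast
    then show "g1 y = g1 x + (LINT s:{x..<y}|ch. g s) - (LINT s:{x..<y}|rp. gt s) + (LINT s:{x..<y}|rn. gt s)"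
      unfolding J_def by (simp add: algebra_simps)
  qed
  have "L2_on ch I g"
  proof (rule L2_fatou[OF m(1) lim(1) sets_borel(4)])
    fix n
    show "L2_on ch I (f n)" using T(2)[of n] unfolding H1_def by simp
    have "0 \<le> (LINT x:I|sg. (cmod (f1 n x))^2)" unfolding set_lebesgue_integral_def by (intro integral_nonneg_AE) simp
    then show "(LINT x:I|ch. (cmod (f n x))^2) \<le> K" using bd(1)[of n] unfolding energy_def by linarith
  qed
  moreover have "L2_on sg I g1"
  proof (rule L2_fatou[OF m(2) g1 sets_borel(3)])
    fix n
    show "L2_on sg I (f1 n)" using T(2)[of n] unfolding H1_def by simp
    have "0 \<le> (LINT x:I|ch. (cmod (f n x))^2)" unfolding set_lebesgue_integral_def by (intro integral_nonneg_AE) simp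
    then show "(LINT x:I|sg. (cmod (f1 n x))^2) \<le> K" using bd(1)[of n] unfolding energy_def by linarith
  qed
  ultimately have "H1 g g1" using A unfolding H1_def by blast
  then show ?thesis by (rule that[OF Q _ g1])
qed

end

lemma (in left_definite_end) V0_cong:
  assumes "\<And>x. x \<in> I \<Longrightarrow> f1 x = g1 x" "\<And>x. x \<in> I \<Longrightarrow> ft x = gt x"
  shows "V0 f f1 ft v v1 vt \<longleftrightarrow> V0 g g1 gt v v1 vt"
  unfolding V0_def
proof (rule tendsto_cong)
  have "\<forall>x\<in>D 0. Vw f f1 ft (cnj \<circ> v) (cnj \<circ> v1) (cnj \<circ> vt) x = Vw g g1 gt (cnj \<circ> v) (cnj \<circ> v1) (cnj \<circ> vt) x"
    using assms D_sub[of 0] by (auto simp: Vw_def)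
  then show "eventually (\<lambda>x. Vw f f1 ft (cnj \<circ> v) (cnj \<circ> v1) (cnj \<circ> vt) x = Vw g g1 gt (cnj \<circ> v) (cnj \<circ> v1) (cnj \<circ> vt) x) F"
    unfolding ev_iff by blast
qed

context left_definite begin

lemma H1_cong:
  assumes H: "H1 f h" and e: "\<And>x. x \<in> I \<Longrightarrow> f x = g x" "\<And>x. x \<in> I \<Longrightarrow> h x = k x"
  shows "H1 g k" "energy g k = energy f h"
proof -
  have 1: "set_integrable M I (\<lambda>x. (cmod (p x))^2) = set_integrable M I (\<lambda>x. (cmod (q x))^2)"
    if "\<And>x. x \<in> I \<Longrightarrow> p x = q x" for M p q
    by (rule set_integrable_cong) (use that in simp_all)
  have 2: "(LINT x:I|M. (cmod (p x))^2) = (LINT x:I|M. (cmod (q x))^2)"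
    if "\<And>x. x \<in> I \<Longrightarrow> p x = q x" "sets M = sets borel" for M p q
    by (rule set_lebesgue_integral_cong) (use that in simp_all)
  show "H1 g k"
    using H ac_on_cong[of sg I f h g k, OF _ sets_borel(3) I_co e] 1[of f g ch, OF e(1)] 1[of h k sg, OF e(2)]
    unfolding H1_def L2_on_def by simp
  show "energy g k = energy f h"
    unfolding energy_def using 2[of f g ch, OF e(1) sets_borel(4)] 2[of h k sg, OF e(2) sets_borel(3)] by simp
qed

lemma energy_zero_fun: "energy (\<lambda>x. 0) (\<lambda>x. 0) = 0"
  unfolding energy_def by simp

lemma in_H1_cong:
  assumes "in_H1 a b sg ch f" "\<And>x. x \<in> I \<Longrightarrow> f x = g x" shows "in_H1 a b sg ch g"
proof -
  obtain h where "H1 f h" by (rule in_H1E[OF assms(1)])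
  then show ?thesis using H1_cong(1)[of f h g h, OF _ assms(2) refl] H1_in by blast
qed

end

section \<open>The relation S and the Neumann series of its resolvent\<close>

context left_definite_bc begin

text \<open>The quasi-derivative is an argument here, whereas \<open>S_rel\<close> hides it behind
  an existential quantifier: the boundary forms and the energy of a pair refer to it.\<close>

definition in_S where
  "in_S f f1 ft \<longleftrightarrow> qd_on I f f1 ft \<and> H1 f f1 \<and> in_H1 a b sg ch ft \<and>
     (L.lc \<longrightarrow> L.V0 f f1 ft va va1 vat) \<and> (R.lc \<longrightarrow> R.V0 f f1 ft vb vb1 vbt)"

definition in_resolvent where
  "in_resolvent z \<longleftrightarrow> (\<forall>g. in_H1 a b sg ch g \<longrightarrow> (\<exists>f f1 ft. in_S f f1 ft \<and> (\<forall>x\<in>I. ft x - z * f x = g x))) \<and>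
     (\<exists>C. \<forall>f f1 ft. in_S f f1 ft \<longrightarrow> H1_norm a b sg ch f \<le> C * H1_norm a b sg ch (\<lambda>x. ft x - z * f x))"

lemma in_S_cong:
  assumes S: "in_S f f1 ft" and e: "\<And>x. x \<in> I \<Longrightarrow> f x = g x" "\<And>x. x \<in> I \<Longrightarrow> f1 x = g1 x" "\<And>x. x \<in> I \<Longrightarrow> ft x = gt x"
  shows "in_S g g1 gt"
proof -
  have "qd_on I g g1 gt" by (rule qd_on_cong[OF _ I_co e]) (use S in \<open>simp_all add: in_S_def\<close>)
  moreover have "H1 g g1" by (rule H1_cong(1)[OF _ e(1,2)]) (use S in \<open>simp_all add: in_S_def\<close>)
  moreover have "in_H1 a b sg ch gt" by (rule in_H1_cong[OF _ e(3)]) (use S in \<open>simp_all add: in_S_def\<close>)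
  ultimately show ?thesis using S L.V0_cong[of f1 g1 ft gt f va va1 vat g, OF e(2,3)]
    R.V0_cong[of f1 g1 ft gt f vb vb1 vbt g, OF e(2,3)] unfolding in_S_def by blast
qed

lemma in_S_add:
  assumes f: "in_S f f1 ft" and g: "in_S g g1 gt"
  shows "in_S (\<lambda>x. f x + g x) (\<lambda>x. f1 x + g1 x) (\<lambda>x. ft x + gt x)"
proof -
  have Q: "qd_on I f f1 ft" "qd_on I g g1 gt" "H1 f f1" "H1 g g1" using f g unfolding in_S_def by auto
  note m = qd_on_meas[OF Q(1)] qd_on_meas[OF Q(2)]
  obtain ft1 where 1: "H1 ft ft1" using f unfolding in_S_def by (blast elim: in_H1E)
  obtain gt1 where 2: "H1 gt gt1" using g unfolding in_S_def by (blast elim: in_H1E)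
  have "in_H1 a b sg ch (\<lambda>x. ft x + gt x)" by (rule H1_in[OF H1_add(1)[OF 1 2 m(3,6)]])
  then show ?thesis using qd_on_add[OF Q(1,2)] H1_add(1)[OF Q(3,4) m(1,4)] f g L.V0_add R.V0_add
    unfolding in_S_def by blast
qed

lemma in_S_cmult:
  assumes f: "in_S f f1 ft"
  shows "in_S (\<lambda>x. c * f x) (\<lambda>x. c * f1 x) (\<lambda>x. c * ft x)"
proof -
  obtain ft1 where 1: "H1 ft ft1" using f unfolding in_S_def by (blast elim: in_H1E)
  have "in_H1 a b sg ch (\<lambda>x. c * ft x)" by (rule H1_in[OF H1_cmult(1)[OF 1]])
  then show ?thesis using qd_on_cmult[of I f f1 ft c] H1_cmult(1)[of f f1 c] f
      L.V0_cmult[of f f1 ft va va1 vat c] R.V0_cmult[of f f1 ft vb vb1 vbt c]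
    unfolding in_S_def by simp
qed

lemma in_S_zero: "in_S (\<lambda>x. 0) (\<lambda>x. 0) (\<lambda>x. 0)"
proof -
  have A: "ac_on sg I (\<lambda>x. 0) (\<lambda>x. 0)" by (rule ac_onI) (simp_all add: set_integrable_def)
  have H: "H1 (\<lambda>x. 0) (\<lambda>x. 0)" unfolding H1_def L2_on_def using A by (simp add: set_integrable_def)
  have "qd_on I (\<lambda>x. 0) (\<lambda>x. 0) (\<lambda>x. 0)" by (rule qd_onI[OF A]) (simp_all add: set_integrable_def)
  moreover have "Vw (\<lambda>x. 0) (\<lambda>x. 0) (\<lambda>x. 0) v v1 vt = (\<lambda>x. 0)" for v v1 vt by (simp add: Vw_def fun_eq_iff)
  ultimately show ?thesis using H H1_in[OF H] unfolding in_S_def L.V0_def R.V0_def by simp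
qed

lemma in_S_imp_near:
  assumes S: "in_S f f1 ft" and H: "H1 ft ft1"
  shows "L.S_near va va1 vat f f1 ft ft1" "R.S_near vb vb1 vbt f f1 ft ft1"
proof -
  have Q: "qd_on I f f1 ft" "H1 f f1" "ac_on sg I ft ft1" using S H unfolding in_S_def H1_def by auto
  have "L.L2_near 0 p q" "R.L2_near 0 p q" if "H1 p q" for p q
    using that L2_mono[OF _ L.D_sub L.D_borel] L2_mono[OF _ R.D_sub R.D_borel] sets_borel
    unfolding H1_def L.L2_near_def R.L2_near_def by blast+
  then have "L.Tmax_near f f1 ft ft1" "R.Tmax_near f f1 ft ft1" using Q H unfolding L.Tmax_near_def R.Tmax_near_def by blast+
  then show "L.S_near va va1 vat f f1 ft ft1" "R.S_near vb vb1 vbt f f1 ft ft1"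
    using S unfolding in_S_def L.S_near_def R.S_near_def by auto
qed

lemma resolvent_bound:
  assumes "in_resolvent z"
  obtains c where "0 < c" "\<And>f f1 ft g h. in_S f f1 ft \<Longrightarrow> H1 g h \<Longrightarrow> \<forall>x\<in>I. ft x = z * f x + g x \<Longrightarrow> energy f f1 \<le> c * energy g h"
proof -
  obtain C where C: "\<And>f f1 ft. in_S f f1 ft \<Longrightarrow> H1_norm a b sg ch f \<le> C * H1_norm a b sg ch (\<lambda>x. ft x - z * f x)"
    using assms unfolding in_resolvent_def by blast
  \<comment> \<open>Squaring the norm bound gives \<open>C^2\<close>; the added 1 makes the constant
    positive, so that it can be divided by later.\<close>
  show ?thesis
  proof (rule that[of "C^2 + 1"])
    show "0 < C\<^sup>2 + 1" by (simp add: add_nonneg_pos)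
    fix f f1 ft g h assume S: "in_S f f1 ft" and H: "H1 g h" and e: "\<forall>x\<in>I. ft x = z * f x + g x"
    have H': "H1 (\<lambda>x. ft x - z * f x) h" by (rule H1_cong(1)[OF H]) (use e in auto)
    have E: "energy (\<lambda>x. ft x - z * f x) h = energy g h" by (rule H1_cong(2)[OF H]) (use e in auto)
    have "ac_on sg I f f1" "ac_on sg I (\<lambda>x. ft x - z * f x) h" using S H' unfolding in_S_def H1_def by auto
    then have "sqrt (energy f f1) \<le> C * sqrt (energy g h)"
      using C[OF S] by (simp add: H1_norm_eq E)
    then have "(sqrt (energy f f1))^2 \<le> (C * sqrt (energy g h))^2" by (rule power_mono) (simp add: energy_nonneg)
    then have "energy f f1 \<le> C^2 * energy g h" by (simp add: power_mult_distrib energy_nonneg)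
    also have "\<dots> \<le> (C^2 + 1) * energy g h" using energy_nonneg[of g h] by (simp add: distrib_right)
    finally show "energy f f1 \<le> (C\<^sup>2 + 1) * energy g h" .
  qed
qed

text \<open>The function \<open>r n\<close> plays the part of the (n+1)-st power of the resolvent at
  \<open>z0\<close> applied to g, and \<open>Fz z\<close> is the power series in z -
  \<open>z0\<close> with these coefficients. It is summed at each point separately, using that point
  values are bounded by the norm. The last claim excludes eigenfunctions for nearby z, since such f
  satisfies energy f <= c |z - z0|^2 energy f.\<close>

lemma neumann:
  assumes r0: "in_resolvent z0" and H: "H1 g h" and mg: "meas g"
  obtains e and Fz :: "complex \<Rightarrow> real \<Rightarrow> complex" where "0 < e"
    "\<And>z. z \<in> ball z0 e \<Longrightarrow> \<exists>f1. in_S (Fz z) f1 (\<lambda>x. z * Fz z x + g x)"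
    "\<And>x. x \<in> I \<Longrightarrow> (\<lambda>z. Fz z x) holomorphic_on ball z0 e"
    "\<And>z f f1 x. z \<in> ball z0 e \<Longrightarrow> in_S f f1 (\<lambda>x. z * f x) \<Longrightarrow> x \<in> I \<Longrightarrow> f x = 0"
proof -
  obtain c where c0: "0 < c" "\<And>f f1 ft g h. in_S f f1 ft \<Longrightarrow> H1 g h \<Longrightarrow> \<forall>x\<in>I. ft x = z0 * f x + g x \<Longrightarrow> energy f f1 \<le> c * energy g h"
    by (rule resolvent_bound[OF r0]; rule that; assumption)
  have c: "0 < c" "\<And>f f1 ft g h. in_S f f1 ft \<Longrightarrow> H1 g h \<Longrightarrow> (\<And>x. x \<in> I \<Longrightarrow> ft x = z0 * f x + g x) \<Longrightarrow> energy f f1 \<le> c * energy g h"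
    using c0 by simp_all
  have mh: "meas h" using H ac_on_meas[OF _ sets_borel(3)] unfolding H1_def by blast
  \<comment> \<open>Dependent choice of triples: the initial one solves the equation at
    \<open>z0\<close> with right-hand side g, each later one with its predecessor as right-hand
    side.\<close>
  define P where "P = (\<lambda>n::nat. \<lambda>(f, f1, ft). in_S f f1 ft \<and> (n = 0 \<longrightarrow> (\<forall>x\<in>I. ft x = z0 * f x + g x)))"
  define Qr where "Qr = (\<lambda>n::nat. \<lambda>(f, f1::real\<Rightarrow>complex, ft::real\<Rightarrow>complex). \<lambda>(f', f1'::real\<Rightarrow>complex, ft'). \<forall>x\<in>I. ft' x = z0 * f' x + (f x::complex))"
  have solve: "\<exists>f f1 ft. in_S f f1 ft \<and> (\<forall>x\<in>I. ft x = z0 * f x + k x)" if "in_H1 a b sg ch k" for k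
    using r0 that unfolding in_resolvent_def by (metis add.commute diff_add_cancel)
  have "\<exists>x. P 0 x" using solve[OF H1_in[OF H]] unfolding P_def by auto
  moreover have "\<exists>y. P (Suc n) y \<and> Qr n x y" if "P n x" for x n
  proof -
    obtain f f1 ft where x: "x = (f, f1, ft)" by (cases x) auto
    then have "in_H1 a b sg ch f" using that H1_in unfolding P_def in_S_def by auto
    then show ?thesis using solve unfolding P_def Qr_def x by fastforce
  qed
  ultimately obtain tr where tr: "\<And>n. P n (tr n)" "\<And>n. Qr n (tr n) (tr (Suc n))"
    using dependent_nat_choice[of P Qr] by blast
  define r where "r = (\<lambda>n. fst (tr n))"
  define r1 where "r1 = (\<lambda>n. fst (snd (tr n)))"
  define rt where "rt = (\<lambda>n. snd (snd (tr n)))"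
  have trn: "tr n = (r n, r1 n, rt n)" for n by (simp add: r_def r1_def rt_def)
  have rS: "in_S (r n) (r1 n) (rt n)" for n using tr(1)[of n] unfolding trn P_def by simp
  have rt0: "rt 0 x = z0 * r 0 x + g x" if "x \<in> I" for x using tr(1)[of 0] that unfolding trn P_def by simp
  have rtS: "rt (Suc n) x = z0 * r (Suc n) x + r n x" if "x \<in> I" for x n using tr(2)[of n] that unfolding trn Qr_def by simp
  have rH: "H1 (r n) (r1 n)" for n using rS[of n] unfolding in_S_def by simp
  have energy_r: "energy (r n) (r1 n) \<le> c ^ Suc n * energy g h" for n
  proof (induction n)
    case 0 show ?case using c(2)[OF rS H rt0] by simp
  next
    case (Suc n)
    have "energy (r (Suc n)) (r1 (Suc n)) \<le> c * energy (r n) (r1 n)" by (rule c(2)[OF rS rH rtS])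
    also have "\<dots> \<le> c * (c ^ Suc n * energy g h)" using Suc c(1) by (intro mult_left_mono) auto
    finally show ?case by simp
  qed
  \<comment> \<open>For |t| < e one has sqrt c |t| <= 1/4, the ratio of the geometric majorant of
    the series, and c |t|^2 <= 1/16 for the energies.\<close>
  define e where "e = 1 / (4 * sqrt c)"
  have e: "0 < e" using c by (simp add: e_def)
  have te: "c * (cmod t)^2 \<le> 1 / 16" if "cmod t < e" for t
  proof -
    have "sqrt c * cmod t \<le> 1 / 4" using that c(1) by (simp add: e_def field_simps)
    then have "(sqrt c * cmod t)^2 \<le> (1 / 4)^2" using c(1) by (intro power_mono) auto
    then show ?thesis using c(1) by (simp add: power_mult_distrib power_divide)
  qed
  define Fz where "Fz = (\<lambda>z x. \<Sum>n. r n x * (z - z0) ^ n)"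
  have smb: "summable (\<lambda>n. r n x * t ^ n)" if x: "x \<in> I" and t: "cmod t < e" for x t
  proof -
    obtain K where K: "0 \<le> K" "\<And>f h s. H1 f h \<Longrightarrow> s \<in> {x..x} \<Longrightarrow> cmod (f s) \<le> K * sqrt (energy f h)"
      by (rule point_bound[OF x x]; rule that; assumption)
    have s4: "sqrt c * cmod t \<le> 1 / 4" using t c(1) by (simp add: e_def field_simps)
    have nb: "norm (r n x * t ^ n) \<le> (K * sqrt (c * energy g h)) * (1 / 4) ^ n" for n
    proof -
      have "cmod (r n x) \<le> K * sqrt (energy (r n) (r1 n))" by (rule K(2)[OF rH]) simp
      also have "\<dots> \<le> K * sqrt (c ^ Suc n * energy g h)" by (intro mult_left_mono real_sqrt_le_mono energy_r K)
      also have "\<dots> = K * (sqrt c ^ n * sqrt (c * energy g h))" by (simp add: real_sqrt_mult real_sqrt_power)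
      finally have "cmod (r n x) * cmod t ^ n \<le> K * (sqrt c ^ n * sqrt (c * energy g h)) * cmod t ^ n" by (intro mult_right_mono) auto
      also have "\<dots> = (K * sqrt (c * energy g h)) * (sqrt c * cmod t) ^ n" by (simp add: power_mult_distrib)
      also have "\<dots> \<le> (K * sqrt (c * energy g h)) * (1 / 4) ^ n"
        using s4 K(1) c(1) energy_nonneg[of g h] by (intro mult_left_mono power_mono) auto
      finally show ?thesis by (simp add: norm_mult norm_power)
    qed
    have sm: "summable (\<lambda>n. (K * sqrt (c * energy g h)) * (1 / 4 :: real) ^ n)"
      by (rule summable_mult, rule summable_geometric) simp
    show ?thesis by (rule summable_comparison_test'[OF sm]) (rule nb)
  qed
  show ?thesis
  proof (rule that[OF e])
    show "(\<lambda>z. Fz z x) holomorphic_on ball z0 e" if x: "x \<in> I" for x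
    proof (rule power_series_holomorphic)
      fix w assume "w \<in> ball z0 e"
      then have "cmod (w - z0) < e" by (simp add: dist_norm norm_minus_commute)
      then show "(\<lambda>n. r n x * (w - z0) ^ n) sums Fz w x" unfolding Fz_def using smb[OF x] by (intro summable_sums)
    qed
  next
    fix z f f1 x assume z: "z \<in> ball z0 e" and S: "in_S f f1 (\<lambda>x. z * f x)" and x: "x \<in> I"
    have t: "cmod (z - z0) < e" using z by (simp add: dist_norm norm_minus_commute)
    have Hf: "H1 f f1" using S unfolding in_S_def by simp
    \<comment> \<open>The eigenvalue equation is read as z f = z0 f + (z - z0) f, a resolvent
      equation at \<open>z0\<close> with right-hand side (z - z0) f.\<close>
    have "energy f f1 \<le> c * energy (\<lambda>x. (z - z0) * f x) (\<lambda>x. (z - z0) * f1 x)"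
      by (rule c(2)[OF S H1_cmult(1)[OF Hf]]) (simp add: algebra_simps)
    also have "\<dots> = (c * (cmod (z - z0))^2) * energy f f1" by (simp add: H1_cmult(2)[OF Hf])
    also have "\<dots> \<le> 1 / 16 * energy f f1" by (intro mult_right_mono te[OF t] energy_nonneg)
    finally have "energy f f1 = 0" using energy_nonneg[of f f1] by simp
    then show "f x = 0" by (rule energy_zero_imp[OF Hf _ x])
  next
    fix z assume "z \<in> ball z0 e"
    then have t: "cmod (z - z0) < e" by (simp add: dist_norm norm_minus_commute)
    define t where "t = z - z0"
    define S where "S = (\<lambda>N x. \<Sum>n<N. r n x * t ^ n)"
    define S1 where "S1 = (\<lambda>N x. \<Sum>n<N. r1 n x * t ^ n)"
    define St where "St = (\<lambda>N x. \<Sum>n<N. rt n x * t ^ n)"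
    have SS: "in_S (S N) (S1 N) (St N)" for N
    proof (induction N)
      case 0 show ?case unfolding S_def S1_def St_def using in_S_zero by simp
    next
      case (Suc N)
      show ?case
        by (rule in_S_cong[OF in_S_add[OF Suc in_S_cmult[OF rS, of "t ^ N" N]]])
          (simp_all add: S_def S1_def St_def mult.commute)
    qed
    \<comment> \<open>A partial sum solves the equation at \<open>z0\<close> whose right-hand side
      contains the preceding partial sum; the index shift is the telescoping of the Neumann
      series.\<close>
    have Steq: "St (Suc N) x = z0 * S (Suc N) x + (g x + t * S N x)" if x: "x \<in> I" for N x
    proof (induction N)
      case 0 show ?case using rt0[OF x] by (simp add: St_def S_def)
    next
      case (Suc N)
      have "St (Suc (Suc N)) x = St (Suc N) x + (z0 * r (Suc N) x + r N x) * t ^ Suc N"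
        using rtS[OF x] by (simp add: St_def)
      also have "\<dots> = z0 * (S (Suc N) x + r (Suc N) x * t ^ Suc N) + (g x + t * (S N x + r N x * t ^ N))"
        unfolding Suc by (simp add: algebra_simps)
      finally show ?case by (simp add: S_def)
    qed
    have SH: "H1 (S N) (S1 N)" and Sm: "meas (S N)" for N
      using SS[of N] qd_on_meas unfolding in_S_def by blast+
    have gtH: "H1 (\<lambda>x. g x + t * S N x) (\<lambda>x. h x + t * S1 N x)"
      "energy (\<lambda>x. g x + t * S N x) (\<lambda>x. h x + t * S1 N x) \<le> 2 * energy g h + 2 * ((cmod t)^2 * energy (S N) (S1 N))" for N
      using H1_add[OF H H1_cmult(1)[OF SH, of t N] mg meas_cmult[OF Sm]] unfolding H1_cmult(2)[OF SH] by auto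
    \<comment> \<open>A bound preserved by the recursion of the energies: E(N+1) <= K / 2 + 2 K /
      16, which is at most K.\<close>
    define K where "K = 4 * c * energy g h"
    have K0: "0 \<le> K" using c(1) energy_nonneg[of g h] by (simp add: K_def)
    have enS: "energy (S N) (S1 N) \<le> K" for N
    proof (induction N)
      case 0 show ?case using K0 by (simp add: S_def S1_def energy_zero_fun)
    next
      case (Suc N)
      have "energy (S (Suc N)) (S1 (Suc N)) \<le> c * energy (\<lambda>x. g x + t * S N x) (\<lambda>x. h x + t * S1 N x)"
        by (rule c(2)[OF SS gtH(1) Steq])
      also have "\<dots> \<le> c * (2 * energy g h + 2 * ((cmod t)^2 * energy (S N) (S1 N)))"
        using gtH(2) c(1) by (intro mult_left_mono) auto
      also have "\<dots> = K / 2 + 2 * ((c * (cmod t)^2) * energy (S N) (S1 N))" by (simp add: K_def algebra_simps)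
      also have "\<dots> \<le> K / 2 + 2 * (1 / 16 * K)"
        using Suc te[OF t] K0 energy_nonneg[of "S N" "S1 N"] unfolding t_def
        by (intro add_left_mono mult_left_mono mult_mono) auto
      also have "\<dots> \<le> K" using K0 by simp
      finally show ?case .
    qed
    \<comment> \<open>The values of tau are rewritten through the partial sums themselves, so their
      convergence and energy bounds follow from those of \<open>S\<close>.\<close>
    define ft where "ft = (\<lambda>N x. z0 * S (Suc N) x + (g x + t * S N x))"
    define ft1 where "ft1 = (\<lambda>N x. z0 * S1 (Suc N) x + (h x + t * S1 N x))"
    have SRN: "in_S (S (Suc N)) (S1 (Suc N)) (ft N)" for N
      by (rule in_S_cong[OF SS refl refl]) (unfold ft_def, rule Steq)
    have ftH: "H1 (ft N) (ft1 N)" "energy (ft N) (ft1 N) \<le> 2 * ((cmod z0)^2 * K) + 2 * (2 * energy g h + 2 * ((cmod t)^2 * K))" for N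
    proof -
      note A = H1_add[OF H1_cmult(1)[OF SH, of z0 "Suc N"] gtH(1)[of N] meas_cmult[OF Sm] meas_add[OF mg meas_cmult[OF Sm]]]
      show "H1 (ft N) (ft1 N)" unfolding ft_def ft1_def by (rule A(1))
      have "energy (ft N) (ft1 N) \<le> 2 * ((cmod z0)^2 * energy (S (Suc N)) (S1 (Suc N))) + 2 * energy (\<lambda>x. g x + t * S N x) (\<lambda>x. h x + t * S1 N x)"
        using A(2) unfolding H1_cmult(2)[OF SH] ft_def ft1_def .
      also have "\<dots> \<le> 2 * ((cmod z0)^2 * K) + 2 * (2 * energy g h + 2 * ((cmod t)^2 * K))"
      proof (intro add_mono mult_left_mono enS)
        show "energy (\<lambda>x. g x + t * S N x) (\<lambda>x. h x + t * S1 N x) \<le> 2 * energy g h + 2 * ((cmod t)\<^sup>2 * K)"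
          using gtH(2)[of N] mult_left_mono[OF enS[of N], of "2 * (cmod t)^2"] by simp
      qed auto
      finally show "energy (ft N) (ft1 N) \<le> 2 * ((cmod z0)^2 * K) + 2 * (2 * energy g h + 2 * ((cmod t)^2 * K))" .
    qed
    define K' where "K' = K + (2 * ((cmod z0)^2 * K) + 2 * (2 * energy g h + 2 * ((cmod t)^2 * K)))"
    have KK: "K \<le> K'" "2 * ((cmod z0)^2 * K) + 2 * (2 * energy g h + 2 * ((cmod t)^2 * K)) \<le> K'"
      using K0 energy_nonneg[of g h] by (auto simp: K'_def)
    have limS: "(\<lambda>N. S N x) \<longlonglongrightarrow> Fz z x" if x: "x \<in> I" for x
      unfolding S_def Fz_def t_def[symmetric] using smb[OF x t] unfolding t_def[symmetric] by (rule summable_LIMSEQ)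
    have limS': "(\<lambda>N. S (Suc N) x) \<longlonglongrightarrow> Fz z x" if x: "x \<in> I" for x
      by (rule LIMSEQ_Suc[OF limS[OF x]])
    have limft: "(\<lambda>N. ft N x) \<longlonglongrightarrow> z * Fz z x + g x" if x: "x \<in> I" for x
    proof -
      have "(\<lambda>N. ft N x) \<longlonglongrightarrow> z0 * Fz z x + (g x + t * Fz z x)"
        unfolding ft_def by (intro tendsto_intros limS limS' x)
      then show ?thesis by (simp add: t_def algebra_simps)
    qed
    have Q: "qd_on I (S (Suc N)) (S1 (Suc N)) (ft N)" for N using SRN unfolding in_S_def by blast
    have b1: "energy (S (Suc N)) (S1 (Suc N)) \<le> K'" and b2: "energy (ft N) (ft1 N) \<le> K'" for N
      using order_trans[OF enS KK(1)] order_trans[OF ftH(2) KK(2)] .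
    obtain f1 where f1: "qd_on I (Fz z) f1 (\<lambda>x. z * Fz z x + g x)" "H1 (Fz z) f1" "\<And>x. x \<in> I \<Longrightarrow> (\<lambda>N. S1 (Suc N) x) \<longlonglongrightarrow> f1 x"
      by (rule qd_on_closed[OF Q SH ftH(1) b1 b2 limS' limft]; (rule that)?; assumption)
    have "L.V0 (Fz z) f1 (\<lambda>x. z * Fz z x + g x) va va1 vat" if l: L.lc
    proof -
      obtain vt1 where v: "L.Tmax_near va va1 vat vt1" using bca[OF l] unfolding L.bc_fun_def by blast
      show ?thesis
        by (rule L.V0_closed[OF v Q SH ftH(1) b1 b2 _ f1(3) limft]) (use SRN l in \<open>auto simp: in_S_def\<close>)
    qed
    moreover have "R.V0 (Fz z) f1 (\<lambda>x. z * Fz z x + g x) vb vb1 vbt" if l: R.lc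
    proof -
      obtain vt1 where v: "R.Tmax_near vb vb1 vbt vt1" using bcb[OF l] unfolding R.bc_fun_def by blast
      show ?thesis
        by (rule R.V0_closed[OF v Q SH ftH(1) b1 b2 _ f1(3) limft]) (use SRN l in \<open>auto simp: in_S_def\<close>)
    qed
    moreover have "in_H1 a b sg ch (\<lambda>x. z * Fz z x + g x)"
      by (rule H1_in[OF H1_add(1)[OF H1_cmult(1)[OF f1(2)] H meas_cmult[OF qd_on_meas(1)[OF f1(1)]] mg]])
    ultimately show "\<exists>f1. in_S (Fz z) f1 (\<lambda>x. z * Fz z x + g x)" using f1(1,2) unfolding in_S_def by blast
  qed
qed

end

section \<open>The Green function and the Weyl function\<close>

text \<open>An interval [x,y) across c splits into [x,c) and [c,y). An atom of \<open>M\<close> at c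
  thus belongs to the right piece, in agreement with the glued derivative, and equality of the
  values at c makes the increments add up.\<close>

lemma ac_on_glue:
  assumes f: "ac_on M A f h" and g: "ac_on M A g k" and c: "c \<in> A" "f c = g c" and sM: "sets M = sets borel"
  shows "ac_on M A (\<lambda>x. if x \<in> {..<c} then f x else g x) (\<lambda>x. if x \<in> {..<c} then h x else k x)"
proof (rule ac_onI)
  let ?f = "\<lambda>x. if x \<in> {..<c} then f x else g x" and ?h = "\<lambda>x. if x \<in> {..<c} then h x else k x"
  have left: "set_integrable M {x..<y} ?h" "(LINT t:{x..<y}|M. ?h t) = f y - f x"
    if "x \<in> A" "y \<in> A" "x \<le> y" "y \<le> c" for x y
  proof -
    show "set_integrable M {x..<y} ?h"
      by (rule set_integrable_congI[OF ac_onD(1)[OF f that(1-3)]]) (use that in auto)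
    have "(LINT t:{x..<y}|M. ?h t) = (LINT t:{x..<y}|M. h t)"
      by (rule set_lebesgue_integral_cong) (use that sM in auto)
    then show "(LINT t:{x..<y}|M. ?h t) = f y - f x" using ac_onD(2)[OF f that(1-3)] by simp
  qed
  have right: "set_integrable M {x..<y} ?h" "(LINT t:{x..<y}|M. ?h t) = g y - g x"
    if "x \<in> A" "y \<in> A" "x \<le> y" "c \<le> x" for x y
  proof -
    show "set_integrable M {x..<y} ?h"
      by (rule set_integrable_congI[OF ac_onD(1)[OF g that(1-3)]]) (use that in auto)
    have "(LINT t:{x..<y}|M. ?h t) = (LINT t:{x..<y}|M. k t)"
      by (rule set_lebesgue_integral_cong) (use that sM in auto)
    then show "(LINT t:{x..<y}|M. ?h t) = g y - g x" using ac_onD(2)[OF g that(1-3)] by simp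
  qed
  fix x y assume xy: "x \<in> A" "y \<in> A" "x \<le> y"
  have "set_integrable M {x..<y} ?h \<and> ?f y = ?f x + (LINT t:{x..<y}|M. ?h t)"
  proof -
    consider "y \<le> c" | "c \<le> x" | "x < c" "c < y" by linarith
    then show ?thesis
    proof cases
      case 1
      have "?f s = f s" if "s \<le> c" for s using that c(2) by (cases "s = c") auto
      then have e: "?f y = f y" "?f x = f x" using 1 xy(3) by (blast intro: order_trans)+
      show ?thesis unfolding e left(2)[OF xy 1] using left(1)[OF xy 1] by simp
    next
      case 2
      have e: "?f y = g y" "?f x = g x" using 2 xy(3) by auto
      show ?thesis unfolding e right(2)[OF xy 2] using right(1)[OF xy 2] by simp
    next
      case 3
      note l = left[OF xy(1) c(1) less_imp_le[OF 3(1)] order_refl] and r = right[OF c(1) xy(2) less_imp_le[OF 3(2)] order_refl]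
      have u: "{x..<y} = {x..<c} \<union> {c..<y}" using 3 by auto
      have "set_integrable M {x..<y} ?h" unfolding u by (rule set_integrable_Un[OF l(1) r(1)]) (simp_all add: sM)
      moreover have "(LINT t:{x..<y}|M. ?h t) = (f c - f x) + (g y - g c)"
        unfolding set_integral_split[OF calculation sM less_imp_le[OF 3(1)] less_imp_le[OF 3(2)]] l(2) r(2) ..
      ultimately show ?thesis using 3 c(2) by simp
    qed
  qed
  then show "set_integrable M {x..<y} ?h" "?f y = ?f x + (LINT t:{x..<y}|M. ?h t)" by blast+
qed

lemma L2_Un: "L2_on M A f \<Longrightarrow> L2_on M B f \<Longrightarrow> A \<in> sets M \<Longrightarrow> B \<in> sets M \<Longrightarrow> L2_on M (A \<union> B) f"
  unfolding L2_on_def by (rule set_integrable_Un)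

lemma L2_cong: "L2_on M A f \<Longrightarrow> (\<And>x. x \<in> A \<Longrightarrow> f x = g x) \<Longrightarrow> L2_on M A g"
  unfolding L2_on_def by (erule set_integrable_congI) simp

context left_definite begin

lemma qd_on_L2_compact:
  assumes Q: "qd_on I u u1 ut" and xy: "x \<in> I" "y \<in> I"
  shows "L2_on ch {x..y} u" "L2_on sg {x..y} u1"
proof -
  obtain B where B: "\<And>s. s \<in> {x..y} \<Longrightarrow> cmod (u s) \<le> B" "\<And>s. s \<in> {x..y} \<Longrightarrow> cmod (u1 s) \<le> B"
    by (rule qd_on_bounded[OF assms]; rule that; assumption)
  show "L2_on ch {x..y} u" by (rule L2_compact[OF qd_on_meas(1)[OF Q] xy lf(4) B(1)])
  show "L2_on sg {x..y} u1" by (rule L2_compact[OF qd_on_meas(2)[OF Q] xy lf(3) B(2)])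
qed

end

lemma (in left_definite_end) S_near_cong:
  assumes S: "S_near v v1 vt f f1 ft ft1"
    and e: "\<And>x. x \<in> I \<Longrightarrow> f x = g x" "\<And>x. x \<in> I \<Longrightarrow> f1 x = g1 x" "\<And>x. x \<in> I \<Longrightarrow> ft x = gt x" "\<And>x. x \<in> I \<Longrightarrow> ft1 x = gt1 x"
  shows "S_near v v1 vt g g1 gt gt1"
proof -
  have T: "qd_on I f f1 ft" "ac_on sg I ft ft1" using S unfolding S_near_def Tmax_near_def by auto
  obtain n where n: "L2_near n f f1" "L2_near n ft ft1" using S unfolding S_near_def Tmax_near_def by blast
  have "L2_near n g g1" "L2_near n gt gt1"
    using n L2_cong[of ch "D n" f g] L2_cong[of sg "D n" f1 g1] L2_cong[of ch "D n" ft gt] L2_cong[of sg "D n" ft1 gt1]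
      e D_sub[of n] unfolding L2_near_def by (auto simp: subset_iff)
  moreover have "qd_on I g g1 gt" by (rule qd_on_cong[OF T(1) I_co e(1-3)])
  moreover have "ac_on sg I gt gt1" by (rule ac_on_cong[OF T(2) sets_borel(3) I_co e(3,4)])
  ultimately have "Tmax_near g g1 gt gt1" unfolding Tmax_near_def by blast
  then show ?thesis using S V0_cong[of f1 g1 ft gt f v v1 vt g, OF e(2,3)] unfolding S_near_def by blast
qed

context left_definite_bc begin

text \<open>Square integrability near the endpoint extends up to any c: by \<open>cover\<close> the
  missing part lies in a compact interval, on which u and u1 are bounded.\<close>

lemma L2_left:
  assumes Q: "qd_on I u u1 ut" and L: "L.L2_near n u u1" and c: "c \<in> I"
  shows "L2_on ch {x \<in> I. x < c} u" "L2_on sg {x \<in> I. x < c} u1"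
proof -
  obtain m where m: "\<And>y. y \<in> Db m \<Longrightarrow> c \<le> y" using to_right[OF c] by blast
  obtain x y where xy: "x \<in> I" "y \<in> I" "I \<subseteq> Da n \<union> {x..y} \<union> Db m" using cover by blast
  have sub: "{x \<in> I. x < c} \<subseteq> Da n \<union> {x..y}" using xy(3) m by fastforce
  have "{x \<in> I. x < c} = I \<inter> {..<c}" by auto
  then have b: "{x \<in> I. x < c} \<in> sets borel" by simp
  show "L2_on ch {x \<in> I. x < c} u"
    by (rule L2_mono[OF L2_Un[OF _ qd_on_L2_compact(1)[OF Q xy(1,2)]] sub b sets_borel(4)])
      (use L L.D_borel sets_borel in \<open>auto simp: L.L2_near_def\<close>)
  show "L2_on sg {x \<in> I. x < c} u1"
    by (rule L2_mono[OF L2_Un[OF _ qd_on_L2_compact(2)[OF Q xy(1,2)]] sub b sets_borel(3)])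
      (use L L.D_borel sets_borel in \<open>auto simp: L.L2_near_def\<close>)
qed

lemma L2_right:
  assumes Q: "qd_on I u u1 ut" and L: "R.L2_near m u u1" and c: "c \<in> I"
  shows "L2_on ch {x \<in> I. \<not> x < c} u" "L2_on sg {x \<in> I. \<not> x < c} u1"
proof -
  obtain n where n: "\<And>y. y \<in> Da n \<Longrightarrow> y \<le> c" using to_left[OF c] by blast
  obtain x y where xy: "x \<in> I" "y \<in> I" "I \<subseteq> Da n \<union> {x..y} \<union> Db m" using cover by blast
  have mm: "min x c \<in> I" "max y c \<in> I" using xy c by (auto simp: min_def max_def)
  have sub: "{x \<in> I. \<not> x < c} \<subseteq> Db m \<union> {min x c..max y c}"
  proof
    fix s assume s: "s \<in> {x \<in> I. \<not> x < c}"
    then consider "s \<in> Da n" | "s \<in> {x..y}" | "s \<in> Db m" using xy(3) by auto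
    then show "s \<in> Db m \<union> {min x c..max y c}"
    proof cases
      \<comment> \<open>The estimate near the left endpoint is not strict, so c itself may occur;
        the enlarged compact interval contains it.\<close>
      case 1 then have "s = c" using n s by force then show ?thesis by simp
    qed (use s in auto)
  qed
  have "{x \<in> I. \<not> x < c} = I \<inter> {c..}" by auto
  then have b: "{x \<in> I. \<not> x < c} \<in> sets borel" by simp
  show "L2_on ch {x \<in> I. \<not> x < c} u"
    by (rule L2_mono[OF L2_Un[OF _ qd_on_L2_compact(1)[OF Q mm]] sub b sets_borel(4)])
      (use L R.D_borel sets_borel in \<open>auto simp: R.L2_near_def\<close>)
  show "L2_on sg {x \<in> I. \<not> x < c} u1"
    by (rule L2_mono[OF L2_Un[OF _ qd_on_L2_compact(2)[OF Q mm]] sub b sets_borel(3)])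
      (use L R.D_borel sets_borel in \<open>auto simp: R.L2_near_def\<close>)
qed

lemma H1_glue:
  assumes p: "qd_on I p p1 pt" "L.L2_near n p p1" and s: "qd_on I s s1 st" "R.L2_near m s s1" and c: "c \<in> I" "p c = s c"
  shows "H1 (\<lambda>x. if x \<in> {..<c} then p x else s x) (\<lambda>x. if x \<in> {..<c} then p1 x else s1 x)"
proof -
  have L2: "L2_on M I (\<lambda>x. if x \<in> {..<c} then f x else g x)"
    if "L2_on M {x \<in> I. x < c} f" "L2_on M {x \<in> I. \<not> x < c} g" "sets M = sets borel" for M f g
  proof -
    have "{x \<in> I. x < c} = I \<inter> {..<c}" "{x \<in> I. \<not> x < c} = I \<inter> {c..}" by auto
    then have b: "{x \<in> I. x < c} \<in> sets M" "{x \<in> I. \<not> x < c} \<in> sets M" using that(3) by simp_all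
    have "L2_on M ({x \<in> I. x < c} \<union> {x \<in> I. \<not> x < c}) (\<lambda>x. if x \<in> {..<c} then f x else g x)"
      by (rule L2_Un[OF L2_cong[OF that(1)] L2_cong[OF that(2)] b]) auto
    moreover have "{x \<in> I. x < c} \<union> {x \<in> I. \<not> x < c} = I" by auto
    ultimately show ?thesis by simp
  qed
  show ?thesis unfolding H1_def
    using ac_on_glue[OF qd_onD(1)[OF p(1)] qd_onD(1)[OF s(1)] c sets_borel(3)]
      L2[OF L2_left(1)[OF p c(1)] L2_right(1)[OF s c(1)] sets_borel(4)]
      L2[OF L2_left(2)[OF p c(1)] L2_right(2)[OF s c(1)] sets_borel(3)] by blast
qed

lemma eigenfunction_in_S:
  assumes a: "sola z p p1" and b: "solb z p p1" and c: "c \<in> I"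
  shows "in_S p p1 (\<lambda>x. z * p x)"
proof -
  have Q: "qd_on I p p1 (\<lambda>x. z * p x)" using a unfolding L.S_near_def L.Tmax_near_def by simp
  obtain n where n: "L.L2_near n p p1" using a unfolding L.S_near_def L.Tmax_near_def by blast
  obtain m where m: "R.L2_near m p p1" using b unfolding R.S_near_def R.Tmax_near_def by blast
  \<comment> \<open>Glueing p to itself combines integrability near the two endpoints into
    integrability on the whole interval.\<close>
  have "H1 (\<lambda>x. if x \<in> {..<c} then p x else p x) (\<lambda>x. if x \<in> {..<c} then p1 x else p1 x)"
    by (rule H1_glue[OF Q n Q m c refl])
  then have H: "H1 p p1" by simp
  then show ?thesis using Q H1_in[OF H1_cmult(1)[OF H, of z]] a b unfolding in_S_def L.S_near_def R.S_near_def by blast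
qed

text \<open>The glued function below is, up to a constant, the Green function of S at the point i
  with pole c. Adding (z - i) times its resolvent yields the Green function at z, whose right
  half is a multiple of the Weyl solution.\<close>

lemma weyl_coefficient:
  fixes z :: complex and p p1 t t1 pi pi1 si si1 F F1 :: "real \<Rightarrow> complex" and c :: real
  defines "ut \<equiv> \<lambda>x. if x \<in> {..<c} then si c * pi x else pi c * si x"
  assumes z: "z \<noteq> 0" and c: "c \<in> I" and pc: "p c \<noteq> 0"
    and p: "sola z p p1" and t: "qd_on I t t1 (\<lambda>x. z * t x)"
    and W: "\<And>x. x \<in> I \<Longrightarrow> Vw t t1 (\<lambda>x. z * t x) p p1 (\<lambda>x. z * p x) x = 1"
    and pi: "sola \<i> pi pi1" and si: "solb \<i> si si1"
    and Wi: "Vw si si1 (\<lambda>x. \<i> * si x) pi pi1 (\<lambda>x. \<i> * pi x) c = 1"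
    and F: "in_S F F1 (\<lambda>x. z * F x + ut x)"
    and noneig: "\<And>f f1. in_S f f1 (\<lambda>x. z * f x) \<Longrightarrow> f c = 0"
  shows "solb z (\<lambda>x. t x + m * p x) (\<lambda>x. t1 x + m * p1 x) \<longleftrightarrow>
     m = ((ut c + (z - \<i>) * F c) / (- \<i> * z * p c) - t c) / p c"
proof -
  define d where "d = z - \<i>"
  have Qp: "qd_on I p p1 (\<lambda>x. z * p x)" using p unfolding L.S_near_def L.Tmax_near_def by simp
  have Qpi: "qd_on I pi pi1 (\<lambda>x. \<i> * pi x)" using pi unfolding L.S_near_def L.Tmax_near_def by simp
  have Qsi: "qd_on I si si1 (\<lambda>x. \<i> * si x)" using si unfolding R.S_near_def R.Tmax_near_def by simp
  have QF: "qd_on I F F1 (\<lambda>x. z * F x + ut x)" using F unfolding in_S_def by simp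
  obtain ft1 where ft1: "H1 (\<lambda>x. z * F x + ut x) ft1" using F unfolding in_S_def by (blast elim: in_H1E)
  note FL = in_S_imp_near(1)[OF F ft1] and FR = in_S_imp_near(2)[OF F ft1]
  \<comment> \<open>Each half of F times z - i plus the Green function is continued to all of
    \<open>I\<close> by its own formula. The continuation is in the domain of tau everywhere but
    satisfies tau u = z u only on its side of c. Both sides include c, because the two formulas for
    \<open>ut\<close> agree there.\<close>
  define ul where "ul = (\<lambda>x. d * F x + si c * pi x)"
  define ul1 where "ul1 = (\<lambda>x. d * F1 x + si c * pi1 x)"
  define ult where "ult = (\<lambda>x. d * (z * F x + ut x) + si c * (\<i> * pi x))"
  define ur where "ur = (\<lambda>x. d * F x + pi c * si x)"
  define ur1 where "ur1 = (\<lambda>x. d * F1 x + pi c * si1 x)"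
  define urt where "urt = (\<lambda>x. d * (z * F x + ut x) + pi c * (\<i> * si x))"
  define Al where "Al = {x \<in> I. x \<le> c}"
  define Ar where "Ar = {x \<in> I. c \<le> x}"
  have Al_co: "{x..y} \<subseteq> Al" if "x \<in> Al" "y \<in> Al" for x y
    using that Icc_subset[of x y] unfolding Al_def by (auto simp: subset_iff)
  have Ar_co: "{x..y} \<subseteq> Ar" if "x \<in> Ar" "y \<in> Ar" for x y
    using that Icc_subset[of x y] unfolding Ar_def by (auto simp: subset_iff)
  have co: "{x..<y} \<subseteq> A" if "{x..y} \<subseteq> A" for A and x y :: real using that by auto
  have ult: "ult x = z * ul x" if "x \<in> Al" for x
    using that unfolding ult_def ul_def ut_def Al_def d_def by (auto simp: algebra_simps)
  have urt: "urt x = z * ur x" if "x \<in> Ar" for x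
    using that unfolding urt_def ur_def ut_def Ar_def d_def by (auto simp: algebra_simps)
  have Ql0: "qd_on I ul ul1 ult" unfolding ul_def ul1_def ult_def
    by (rule qd_on_add[OF qd_on_cmult[OF QF] qd_on_cmult[OF Qpi]])
  have Qr0: "qd_on I ur ur1 urt" unfolding ur_def ur1_def urt_def
    by (rule qd_on_add[OF qd_on_cmult[OF QF] qd_on_cmult[OF Qsi]])
  have sub: "Al \<subseteq> I" "Ar \<subseteq> I" by (auto simp: Al_def Ar_def)
  have Ql: "qd_on Al ul ul1 (\<lambda>x. z * ul x)"
    by (rule qd_on_cong[OF qd_on_subset[OF Ql0 sub(1)] co[OF Al_co]]) (use ult in auto)
  have Qr: "qd_on Ar ur ur1 (\<lambda>x. z * ur x)"
    by (rule qd_on_cong[OF qd_on_subset[OF Qr0 sub(2)] co[OF Ar_co]]) (use urt in auto)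
  have cm: "c \<in> Al" "c \<in> Ar" using c by (auto simp: Al_def Ar_def)
  \<comment> \<open>F, pi and p all satisfy the condition at a, so the form of \<open>ul\<close> and
    p tends to 0 there; being constant up to c, it is 0.\<close>
  have V0c: "Vw ul ul1 (\<lambda>x. z * ul x) p p1 (\<lambda>x. z * p x) c = 0"
  proof -
    have "((\<lambda>x. Vw ul ul1 ult p p1 (\<lambda>x. z * p x) x) \<longlongrightarrow> d * 0 + si c * 0) Fa"
      unfolding ul_def ul1_def ult_def Vw_add_left Vw_cmult_left
      by (intro tendsto_intros L.S_near_orthogonal[OF bca FL p] L.S_near_orthogonal[OF bca pi p])
    moreover have "eventually (\<lambda>x. Vw ul ul1 ult p p1 (\<lambda>x. z * p x) x = Vw ul ul1 (\<lambda>x. z * ul x) p p1 (\<lambda>x. z * p x) c) Fa"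
    proof -
      obtain n where n: "\<And>y. y \<in> Da n \<Longrightarrow> y \<le> c" using to_left[OF c] by blast
      have "Vw ul ul1 ult p p1 (\<lambda>x. z * p x) x = Vw ul ul1 (\<lambda>x. z * ul x) p p1 (\<lambda>x. z * p x) c" if x: "x \<in> Da n" for x
      proof -
        have xl: "x \<in> Al" "x \<le> c" using x n L.D_sub unfolding Al_def by auto
        have "Vw ul ul1 ult p p1 (\<lambda>x. z * p x) x = Vw ul ul1 (\<lambda>x. z * ul x) p p1 (\<lambda>x. z * p x) x"
          using ult[OF xl(1)] by (simp add: Vw_def)
        also have "\<dots> = Vw ul ul1 (\<lambda>x. z * ul x) p p1 (\<lambda>x. z * p x) c"
          by (rule Vw_const_le[OF Ql qd_on_subset[OF Qp sub(1)] xl(2) Al_co[OF xl(1) cm(1)], symmetric])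
        finally show ?thesis .
      qed
      then show ?thesis unfolding L.ev_iff by blast
    qed
    ultimately have "((\<lambda>x. Vw ul ul1 (\<lambda>x. z * ul x) p p1 (\<lambda>x. z * p x) c) \<longlongrightarrow> 0) Fa"
      using tendsto_cong by fastforce
    then show ?thesis using tendsto_unique[OF L.F_ne tendsto_const] by blast
  qed
  define A where "A = Vw ur ur1 (\<lambda>x. z * ur x) p p1 (\<lambda>x. z * p x) c"
  define B where "B = - Vw ur ur1 (\<lambda>x. z * ur x) t t1 (\<lambda>x. z * t x) c"
  \<comment> \<open>The normalisation \<open>Wi\<close> makes the quasi-derivative jump by i at c,
    and only this jump contributes to the form on the right.\<close>
  have A: "A = - \<i> * z * p c"
  proof -
    have j: "pi c * si1 c - si c * pi1 c = \<i>"
    proof -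
      have "\<i> * (si c * pi1 c - si1 c * pi c) = 1" using Wi by (simp add: Vw_def algebra_simps)
      then have "\<i> * (\<i> * (si c * pi1 c - si1 c * pi c)) = \<i>" by simp
      then show ?thesis by (simp add: algebra_simps)
    qed
    have e: "ur c = ul c" "ur1 c = ul1 c + \<i>" 
      using j by (auto simp: ur_def ul_def ur1_def ul1_def algebra_simps)
    have "A = Vw ul ul1 (\<lambda>x. z * ul x) p p1 (\<lambda>x. z * p x) c - \<i> * z * p c"
      unfolding A_def Vw_def e by (simp add: algebra_simps)
    then show ?thesis using V0c by simp
  qed
  have A0: "A \<noteq> 0" unfolding A using z pc by simp
  \<comment> \<open>As V(t,p) = 1, the pair t, p is a basis of solutions, and the coefficients of
    \<open>ur\<close> are its constant forms with p and t.\<close>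
  have cram: "ur x = A * t x + B * p x" "ur1 x = A * t1 x + B * p1 x" if x: "x \<in> Ar" for x
  proof -
    have cx: "c \<le> x" "x \<in> I" using x by (auto simp: Ar_def)
    have a1: "Vw ur ur1 (\<lambda>x. z * ur x) p p1 (\<lambda>x. z * p x) x = A" unfolding A_def
      by (rule Vw_const_le[OF Qr qd_on_subset[OF Qp sub(2)] cx(1) Ar_co[OF cm(2) x]])
    have b1: "Vw ur ur1 (\<lambda>x. z * ur x) t t1 (\<lambda>x. z * t x) x = - B" unfolding B_def
      using Vw_const_le[OF Qr qd_on_subset[OF t sub(2)] cx(1) Ar_co[OF cm(2) x]] by simp
    have "ur x * Vw t t1 (\<lambda>x. z * t x) p p1 (\<lambda>x. z * p x) x =
      t x * Vw ur ur1 (\<lambda>x. z * ur x) p p1 (\<lambda>x. z * p x) x - p x * Vw ur ur1 (\<lambda>x. z * ur x) t t1 (\<lambda>x. z * t x) x"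
      unfolding Vw_def by algebra
    then show "ur x = A * t x + B * p x" unfolding W[OF cx(2)] a1 b1 by (simp add: algebra_simps)
    have "ur1 x * Vw t t1 (\<lambda>x. z * t x) p p1 (\<lambda>x. z * p x) x =
      t1 x * Vw ur ur1 (\<lambda>x. z * ur x) p p1 (\<lambda>x. z * p x) x - p1 x * Vw ur ur1 (\<lambda>x. z * ur x) t t1 (\<lambda>x. z * t x) x"
      unfolding Vw_def by algebra
    then show "ur1 x = A * t1 x + B * p1 x" unfolding W[OF cx(2)] a1 b1 by (simp add: algebra_simps)
  qed
  \<comment> \<open>The solution on all of \<open>I\<close> that agrees with \<open>ur\<close> to
    the right of c. It inherits the behaviour near b, and division by A, which is not 0, gives the
    normalised form t + m p.\<close>
  define U where "U = (\<lambda>x. A * t x + B * p x)"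
  define U1 where "U1 = (\<lambda>x. A * t1 x + B * p1 x)"
  have QU: "qd_on I U U1 (\<lambda>x. z * U x)"
  proof (rule qd_on_cong[OF qd_on_add[OF qd_on_cmult[OF t, of A] qd_on_cmult[OF Qp, of B]] I_co])
    show "A * (z * t x) + B * (z * p x) = z * U x" for x by (simp add: U_def algebra_simps)
  qed (simp_all add: U_def U1_def)
  have rS: "R.S_near vb vb1 vbt ur ur1 urt (\<lambda>x. d * ft1 x + pi c * (\<i> * si1 x))"
    unfolding ur_def ur1_def urt_def by (rule R.S_near_add[OF R.S_near_cmult[OF FR] R.S_near_cmult[OF si]])
  obtain n0 where n0: "\<And>y. y \<in> Db n0 \<Longrightarrow> c \<le> y" using to_right[OF c] by blast
  have UU: "ur x = U x" "ur1 x = U1 x" "urt x = z * U x" if x: "x \<in> Db n0" for x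
  proof -
    have xr: "x \<in> Ar" using x n0 R.D_sub unfolding Ar_def by auto
    show "ur x = U x" "ur1 x = U1 x" "urt x = z * U x"
      using cram[OF xr] urt[OF xr] by (simp_all add: U_def U1_def)
  qed
  have solU: "solb z U U1"
  proof -
    obtain n1 where "R.L2_near n1 ur ur1" using rS unfolding R.S_near_def R.Tmax_near_def by blast
    then have "R.L2_near (max n0 n1) ur ur1" by (rule R.L2_near_mono) simp
    then have "R.L2_near (max n0 n1) U U1"
      using L2_cong[of ch "Db (max n0 n1)" ur U] L2_cong[of sg "Db (max n0 n1)" ur1 U1] UU R.D_mono[of n0 "max n0 n1"]
      unfolding R.L2_near_def by (auto simp: subset_iff)
    then have T: "R.Tmax_near U U1 (\<lambda>x. z * U x) (\<lambda>x. z * U1 x)" by (rule solb_from_L2[OF QU])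
    have "R.V0 U U1 (\<lambda>x. z * U x) vb vb1 vbt" if R.lc
    proof -
      have "R.V0 ur ur1 urt vb vb1 vbt" using rS that unfolding R.S_near_def by simp
      moreover have "eventually (\<lambda>x. Vw ur ur1 urt (cnj \<circ> vb) (cnj \<circ> vb1) (cnj \<circ> vbt) x
          = Vw U U1 (\<lambda>x. z * U x) (cnj \<circ> vb) (cnj \<circ> vb1) (cnj \<circ> vbt) x) Fb"
        unfolding R.ev_iff using UU by (intro exI[of _ n0]) (simp add: Vw_def)
      ultimately show ?thesis unfolding R.V0_def using tendsto_cong by blast
    qed
    then show ?thesis using T unfolding R.S_near_def by blast
  qed
  have sol: "solb z (\<lambda>x. t x + B / A * p x) (\<lambda>x. t1 x + B / A * p1 x)"
    by (rule R.S_near_cong[OF R.S_near_cmult[OF solU, of "1 / A"]])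
      (use A0 in \<open>simp_all add: U_def U1_def field_simps\<close>)
  \<comment> \<open>Evaluating the expansion of \<open>ur\<close> at c expresses the quotient
    through values at c alone, where the dependence on z is known.\<close>
  have val: "B / A = ((ut c + (z - \<i>) * F c) / (- \<i> * z * p c) - t c) / p c"
  proof -
    have "ut c + (z - \<i>) * F c = ur c" by (simp add: ut_def ur_def d_def)
    also have "\<dots> = A * t c + B * p c" by (rule cram(1)[OF cm(2)])
    finally have "(ut c + (z - \<i>) * F c) / A - t c = B / A * p c" using A0 by (simp add: field_simps)
    then show ?thesis using pc unfolding A by simp
  qed
  \<comment> \<open>Two admissible values of m would make p itself satisfy the condition at b, so p
    would be an eigenfunction of S, which \<open>noneig\<close> excludes because p does not vanish
    at c.\<close>
  have uniq: "m = B / A" if m: "solb z (\<lambda>x. t x + m * p x) (\<lambda>x. t1 x + m * p1 x)"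
  proof (rule ccontr)
    assume ne: "m \<noteq> B / A"
    define k where "k = m - B / A"
    have k: "k \<noteq> 0" using ne by (simp add: k_def)
    have "solb z p p1"
      by (rule R.S_near_cong[OF R.S_near_cmult[OF R.S_near_add[OF m R.S_near_cmult[OF sol, of "- 1"]], of "1 / k"]])
        (use k in \<open>simp_all add: k_def field_simps\<close>)
    then have "in_S p p1 (\<lambda>x. z * p x)" by (rule eigenfunction_in_S[OF p _ c])
    then show False using noneig pc by blast
  qed
  show ?thesis using sol uniq unfolding val by blast
qed

end

context left_definite_bc begin

text \<open>The equivalence with m = G z contains existence, uniqueness and holomorphy at once. The
  Green function at i is constructed before z varies, so one application of the Neumann series
  covers a whole ball.\<close>

lemma weyl_function_local:
  fixes \<phi> \<phi>1 \<theta> \<theta>1 :: "complex \<Rightarrow> real \<Rightarrow> complex"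
  assumes phi: "\<And>z. z \<noteq> 0 \<Longrightarrow> sola z (\<phi> z) (\<phi>1 z)" and nt: "\<And>z. z \<noteq> 0 \<Longrightarrow> \<exists>x\<in>I. \<phi> z x \<noteq> 0"
    and theta: "\<And>z. z \<noteq> 0 \<Longrightarrow> qd_on I (\<theta> z) (\<theta>1 z) (\<lambda>x. z * \<theta> z x)"
    and W: "\<And>z x. z \<noteq> 0 \<Longrightarrow> x \<in> I \<Longrightarrow> Vw (\<theta> z) (\<theta>1 z) (\<lambda>x. z * \<theta> z x) (\<phi> z) (\<phi>1 z) (\<lambda>x. z * \<phi> z x) x = 1"
    and an: "\<And>c. c \<in> I \<Longrightarrow> (\<lambda>z. \<phi> z c) analytic_on - {0}" "\<And>c. c \<in> I \<Longrightarrow> (\<lambda>z. \<theta> z c) analytic_on - {0}"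
    and z0: "z0 \<noteq> 0" "in_resolvent z0"
  obtains e and G :: "complex \<Rightarrow> complex" where "0 < e" "G holomorphic_on ball z0 e"
    "\<And>z m. z \<in> ball z0 e \<Longrightarrow> solb z (\<lambda>x. \<theta> z x + m * \<phi> z x) (\<lambda>x. \<theta>1 z x + m * \<phi>1 z x) \<longleftrightarrow> m = G z"
proof -
  have i0: "\<i> \<noteq> 0" by simp
  obtain mi where mi: "solb \<i> (\<lambda>x. \<theta> \<i> x + mi * \<phi> \<i> x) (\<lambda>x. \<theta>1 \<i> x + mi * \<phi>1 \<i> x)"
    by (rule weyl_solution[OF phi[OF i0] nt[OF i0] theta[OF i0]])
  define si where "si = (\<lambda>x. \<theta> \<i> x + mi * \<phi> \<i> x)"
  define si1 where "si1 = (\<lambda>x. \<theta>1 \<i> x + mi * \<phi>1 \<i> x)"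
  have S: "solb \<i> si si1" using mi unfolding si_def si1_def .
  \<comment> \<open>Nontriviality of the solution at \<open>z0\<close> provides a pole at which the
    denominators of \<open>G\<close> do not vanish.\<close>
  obtain c where c: "c \<in> I" "\<phi> z0 c \<noteq> 0" using nt[OF z0(1)] by blast
  have Wi: "Vw si si1 (\<lambda>x. \<i> * si x) (\<phi> \<i>) (\<phi>1 \<i>) (\<lambda>x. \<i> * \<phi> \<i> x) c = 1"
    using W[OF i0 c(1)] unfolding Vw_def si_def si1_def by (simp add: algebra_simps)
  define ut where "ut = (\<lambda>x. if x \<in> {..<c} then si c * \<phi> \<i> x else \<phi> \<i> c * si x)"
  define ut1 where "ut1 = (\<lambda>x. if x \<in> {..<c} then si c * \<phi>1 \<i> x else \<phi> \<i> c * si1 x)"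
  have Qp: "qd_on I (\<phi> \<i>) (\<phi>1 \<i>) (\<lambda>x. \<i> * \<phi> \<i> x)" using phi[OF i0] unfolding L.S_near_def L.Tmax_near_def by simp
  have Qs: "qd_on I si si1 (\<lambda>x. \<i> * si x)" using S unfolding R.S_near_def R.Tmax_near_def by simp
  obtain n where n: "L.L2_near n (\<phi> \<i>) (\<phi>1 \<i>)" using phi[OF i0] unfolding L.S_near_def L.Tmax_near_def by blast
  obtain k where k: "R.L2_near k si si1" using S unfolding R.S_near_def R.Tmax_near_def by blast
  have H: "H1 ut ut1" unfolding ut_def ut1_def
    by (rule H1_glue[OF qd_on_cmult[OF Qp] L.L2_near_cmult[OF n] qd_on_cmult[OF Qs] R.L2_near_cmult[OF k] c(1)]) simp
  have m: "meas ut" unfolding ut_def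
    by (rule meas_if[OF meas_cmult[OF qd_on_meas(1)[OF Qp]] meas_cmult[OF qd_on_meas(1)[OF Qs]]]) simp
  obtain e Fz where e: "0 < e" and Fz: "\<And>z. z \<in> ball z0 e \<Longrightarrow> \<exists>f1. in_S (Fz z) f1 (\<lambda>x. z * Fz z x + ut x)"
    and hol: "\<And>x. x \<in> I \<Longrightarrow> (\<lambda>z. Fz z x) holomorphic_on ball z0 e"
    and noneig: "\<And>z f f1 x. z \<in> ball z0 e \<Longrightarrow> in_S f f1 (\<lambda>x. z * f x) \<Longrightarrow> x \<in> I \<Longrightarrow> f x = 0"
    by (rule neumann[OF z0(2) H m]; rule that; assumption)
  \<comment> \<open>An open set around \<open>z0\<close> in which the resolvent series converges, z
    is not 0 and \<phi> z does not vanish at the fixed pole.\<close>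
  define X where "X = (ball z0 e \<inter> - {0}) \<inter> (\<lambda>z. \<phi> z c) -` (- {0})"
  have hp: "(\<lambda>z. \<phi> z c) holomorphic_on - {0}" and ht: "(\<lambda>z. \<theta> z c) holomorphic_on - {0}"
    using an[OF c(1)] by (auto intro: analytic_imp_holomorphic)
  have opX: "open X" unfolding X_def
    by (rule continuous_open_preimage)
      (auto intro!: continuous_on_subset[OF holomorphic_on_imp_continuous_on[OF hp]] open_Int open_Compl)
  have "z0 \<in> X" using e z0 c by (simp add: X_def)
  then obtain e' where e': "0 < e'" "ball z0 e' \<subseteq> X" using opX open_contains_ball by blast
  define G where "G = (\<lambda>z. ((ut c + (z - \<i>) * Fz z c) / (- \<i> * z * \<phi> z c) - \<theta> z c) / \<phi> z c)"
  have sub: "X \<subseteq> ball z0 e" "X \<subseteq> - {0}" and ne: "\<And>z. z \<in> X \<Longrightarrow> \<phi> z c \<noteq> 0" by (auto simp: X_def)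
  have "G holomorphic_on X" unfolding G_def
    by (intro holomorphic_intros holomorphic_on_subset[OF hol[OF c(1)] sub(1)] holomorphic_on_subset[OF hp sub(2)]
       holomorphic_on_subset[OF ht sub(2)]) (use ne sub in auto)
  then have "G holomorphic_on ball z0 e'" using e'(2) by (rule holomorphic_on_subset)
  moreover have "solb z (\<lambda>x. \<theta> z x + m * \<phi> z x) (\<lambda>x. \<theta>1 z x + m * \<phi>1 z x) \<longleftrightarrow> m = G z" if zb: "z \<in> ball z0 e'" for z m
  proof -
    have zX: "z \<in> X" using zb e' by blast
    have z: "z \<noteq> 0" "z \<in> ball z0 e" "\<phi> z c \<noteq> 0" using zX sub ne by auto
    obtain f1 where f1: "in_S (Fz z) f1 (\<lambda>x. z * Fz z x + ut x)" using Fz[OF z(2)] by blast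
    show ?thesis unfolding G_def ut_def
      by (rule weyl_coefficient[OF z(1) c(1) z(3) phi[OF z(1)] theta[OF z(1)] W[OF z(1)] phi[OF i0] S Wi f1[unfolded ut_def]])
        (use noneig[OF z(2)] c(1) in blast)+
  qed
  ultimately show ?thesis using that e'(1) by blast
qed

end

section \<open>Comparison of the local notions with the given definitions\<close>

context left_definite_end begin

lemma Tmax_imp_near:
  assumes "Tmax a b rp rn sg ch f f1 ft"
  shows "\<exists>ft1. Tmax_near f f1 ft ft1"
proof -
  have Q: "qd_on I f f1 ft" using assms unfolding Tmax_def sol_iff by simp
  have H: "H1 f f1" using assms in_H1_iff[OF qd_onD(1)[OF Q]] unfolding Tmax_def by simp
  obtain ft1 where H': "H1 ft ft1" using assms unfolding Tmax_def by (blast elim: in_H1E)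
  have "L2_near 0 p q" if "H1 p q" for p q
    using that L2_mono[OF _ D_sub D_borel] sets_borel unfolding H1_def L2_near_def by blast
  then show ?thesis using Q H H' unfolding Tmax_near_def H1_def by blast
qed

lemma bc_funI:
  assumes "Tmax a b rp rn sg ch v v1 vt" "V0 v v1 vt v v1 vt" "Tmax a b rp rn sg ch f f1 ft" "\<not> V0 f f1 ft v v1 vt"
  shows "bc_fun v v1 vt"
  using Tmax_imp_near[OF assms(1)] Tmax_imp_near[OF assms(3)] assms(2,4) unfolding bc_fun_def by blast

text \<open>\<open>NP\<close> is a placeholder for \<open>H1_near_a\<close> or
  \<open>H1_near_b\<close>, so that one proof translates the limit-circle condition at either
  end.\<close>

lemma lc_near_iff:
  assumes near: "\<And>f k. ac_on sg I f k \<Longrightarrow> NP f \<longleftrightarrow> (\<exists>n. L2_near n f k)"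
  shows "lc \<longleftrightarrow> (\<forall>z. z \<noteq> 0 \<longrightarrow> (\<forall>u u1. sol u u1 (\<lambda>x. z * u x) \<longrightarrow> NP u))"
  unfolding lc_def sol_iff using near qd_onD(1) by blast

lemma S_near_near_iff:
  assumes near: "\<And>f k. ac_on sg I f k \<Longrightarrow> NP f \<longleftrightarrow> (\<exists>n. L2_near n f k)"
  shows "S_near v v1 vt u u1 (\<lambda>x. z * u x) (\<lambda>x. z * u1 x) \<longleftrightarrow>
    sol u u1 (\<lambda>x. z * u x) \<and> NP u \<and> NP (\<lambda>x. z * u x) \<and> (lc \<longrightarrow> V0 u u1 (\<lambda>x. z * u x) v v1 vt)"
proof (cases "qd_on I u u1 (\<lambda>x. z * u x)")
  case True
  have a: "ac_on sg I u u1" "ac_on sg I (\<lambda>x. z * u x) (\<lambda>x. z * u1 x)"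
    using qd_onD(1)[OF True] ac_on_cmult[OF qd_onD(1)[OF True]] by blast+
  show ?thesis unfolding S_near_def Tmax_near_def sol_iff near[OF a(1)] near[OF a(2)] using True a L2_near_cmult by blast
next
  case False
  then show ?thesis unfolding S_near_def Tmax_near_def sol_iff by blast
qed

end

theorem theorem4p3:
  fixes a b :: ereal and rp rn sg ch :: "real measure"
    and va va1 vat vb vb1 vbt :: "real \<Rightarrow> complex"
    and \<phi> \<phi>1 \<theta> \<theta>1 :: "complex \<Rightarrow> real \<Rightarrow> complex"
  assumes std: "standing a b rp rn sg ch"
    and va: "lc_a a b rp rn sg ch \<Longrightarrow> bc_fun_a a b rp rn sg ch va va1 vat"
    and vb: "lc_b a b rp rn sg ch \<Longrightarrow> bc_fun_b a b rp rn sg ch vb vb1 vbt"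
    and phi_sol: "\<And>z. z \<noteq> 0 \<Longrightarrow> qd a b rp rn sg ch (\<phi> z) (\<phi>1 z) (\<lambda>x. z * \<phi> z x)"
    and phi_nontriv: "\<And>z. z \<noteq> 0 \<Longrightarrow> \<exists>x \<in> Ivl a b. \<phi> z x \<noteq> 0"
    and phi_a: "\<And>z. z \<noteq> 0 \<Longrightarrow> sol_in_S_near_a a b rp rn sg ch va va1 vat z (\<phi> z) (\<phi>1 z)"
    and phi_an: "\<And>c. c \<in> Ivl a b \<Longrightarrow>
                   real_analytic_pole0 (\<lambda>z. \<phi> z c) \<and> real_analytic_pole0 (\<lambda>z. \<phi>1 z c)"
    and theta_sol: "\<And>z. z \<noteq> 0 \<Longrightarrow> qd a b rp rn sg ch (\<theta> z) (\<theta>1 z) (\<lambda>x. z * \<theta> z x)"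
    and V_theta_phi: "\<And>z x. z \<noteq> 0 \<Longrightarrow> x \<in> Ivl a b \<Longrightarrow>
                   Vw (\<theta> z) (\<theta>1 z) (\<lambda>x. z * \<theta> z x) (\<phi> z) (\<phi>1 z) (\<lambda>x. z * \<phi> z x) x = 1"
    and theta_an: "\<And>c. c \<in> Ivl a b \<Longrightarrow>
                   real_analytic_pole0 (\<lambda>z. \<theta> z c) \<and> real_analytic_pole0 (\<lambda>z. \<theta>1 z c)"
  defines "R \<equiv> resolvent_set a b sg ch (S_rel a b rp rn sg ch va va1 vat vb vb1 vbt) - {0}"
    and "P \<equiv> \<lambda>z m. sol_in_S_near_b a b rp rn sg ch vb vb1 vbt z
                     (\<lambda>x. \<theta> z x + m * \<phi> z x) (\<lambda>x. \<theta>1 z x + m * \<phi>1 z x)"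
  shows "(\<forall>z \<in> R. \<exists>!m. P z m) \<and> (\<lambda>z. THE m. P z m) analytic_on R \<and>
         (\<forall>z \<in> R. (THE m. P z m) = cnj (THE m. P (cnj z) m))"
proof -
  interpret left_definite a b rp rn sg ch by unfold_locales (rule std)
  obtain Da where Da: "left_definite_end a b rp rn sg ch Da (at_a a)" "\<And>n. \<exists>\<alpha>\<in>I. Da n = {x \<in> I. x < \<alpha>}"
    "\<And>\<alpha>. \<alpha> \<in> I \<Longrightarrow> \<exists>n. Da n \<subseteq> {x \<in> I. x < \<alpha>}"
    by (rule left_end; rule that; assumption)
  obtain Db where Db: "left_definite_end a b rp rn sg ch Db (at_b b)" "\<And>n. \<exists>\<beta>\<in>I. Db n = {x \<in> I. \<beta> < x}"
    "\<And>\<beta>. \<beta> \<in> I \<Longrightarrow> \<exists>n. Db n \<subseteq> {x \<in> I. \<beta> < x}"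
    by (rule right_end; rule that; assumption)
  interpret A: left_definite_end a b rp rn sg ch Da "at_a a" by (rule Da(1))
  interpret B: left_definite_end a b rp rn sg ch Db "at_b b" by (rule Db(1))
  have "{x \<in> I. x < \<alpha>} = I \<inter> {..<\<alpha>}" "{x \<in> I. \<alpha> < x} = I \<inter> {\<alpha><..}" for \<alpha> by auto
  then have bor: "{x \<in> I. x < \<alpha>} \<in> sets borel" "{x \<in> I. \<alpha> < x} \<in> sets borel" for \<alpha> by simp_all
  have near_a: "H1_near_a a b sg ch f \<longleftrightarrow> (\<exists>n. A.L2_near n f k)" if "ac_on sg I f k" for f k
    unfolding H1_near_a_def by (rule A.near_iff[OF Da(2,3) bor(1) _ that]) auto
  have near_b: "H1_near_b a b sg ch f \<longleftrightarrow> (\<exists>n. B.L2_near n f k)" if "ac_on sg I f k" for f k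
    unfolding H1_near_b_def by (rule B.near_iff[OF Db(2,3) bor(2) _ that]) auto
  have lca: "lc_a a b rp rn sg ch \<longleftrightarrow> A.lc" unfolding lc_a_def by (rule A.lc_near_iff[OF near_a, symmetric])
  have lcb: "lc_b a b rp rn sg ch \<longleftrightarrow> B.lc" unfolding lc_b_def by (rule B.lc_near_iff[OF near_b, symmetric])
  have V0a: "V0_a a f f1 ft v v1 vt \<longleftrightarrow> A.V0 f f1 ft v v1 vt" for f f1 ft v v1 vt unfolding V0_a_def A.V0_def ..
  have V0b: "V0_b b f f1 ft v v1 vt \<longleftrightarrow> B.V0 f f1 ft v v1 vt" for f f1 ft v v1 vt unfolding V0_b_def B.V0_def ..
  interpret left_definite_bc a b rp rn sg ch Da "at_a a" Db "at_b b" va va1 vat vb vb1 vbt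
  proof unfold_locales
    show "\<exists>n. \<forall>y\<in>Da n. y \<le> x" if "x \<in> I" for x using Da(3)[OF that] by fastforce
    show "\<exists>n. \<forall>y\<in>Db n. x \<le> y" if "x \<in> I" for x using Db(3)[OF that] by fastforce
    show "\<exists>x\<in>I. \<exists>y\<in>I. I \<subseteq> Da n \<union> {x..y} \<union> Db m" for n m
    proof -
      obtain \<alpha> where \<alpha>: "\<alpha> \<in> I" "Da n = {x \<in> I. x < \<alpha>}" using Da(2) by blast
      obtain \<beta> where \<beta>: "\<beta> \<in> I" "Db m = {x \<in> I. \<beta> < x}" using Db(2) by blast
      have "I \<subseteq> Da n \<union> {\<alpha>..\<beta>} \<union> Db m" unfolding \<alpha>(2) \<beta>(2) by auto
      then show ?thesis using \<alpha>(1) \<beta>(1) by blast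
    qed
    show "A.bc_fun va va1 vat" if "A.lc"
      using va that unfolding lca bc_fun_a_def V0a by (blast intro: A.bc_funI)
    show "B.bc_fun vb vb1 vbt" if "B.lc"
      using vb that unfolding lcb bc_fun_b_def V0b by (blast intro: B.bc_funI)
  qed
  have P: "P z m \<longleftrightarrow> solb z (\<lambda>x. \<theta> z x + m * \<phi> z x) (\<lambda>x. \<theta>1 z x + m * \<phi>1 z x)" for z m
    unfolding P_def sol_in_S_near_b_def lcb V0b by (rule B.S_near_near_iff[OF near_b, symmetric])
  have phi: "sola z (\<phi> z) (\<phi>1 z)" if "z \<noteq> 0" for z
    using phi_a[OF that] A.S_near_near_iff[OF near_a, where u = "\<phi> z" and ?u1.0 = "\<phi>1 z" and z = z]
    unfolding sol_in_S_near_a_def lca V0a by blast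
  have theta: "qd_on I (\<theta> z) (\<theta>1 z) (\<lambda>x. z * \<theta> z x)" if "z \<noteq> 0" for z
    using theta_sol[OF that] unfolding sol_iff .
  have SRel: "(f, ft) \<in> S_rel a b rp rn sg ch va va1 vat vb vb1 vbt \<longleftrightarrow> (\<exists>f1. in_S f f1 ft)" for f ft
    unfolding S_rel_def in_S_def Tmax_def sol_iff lca lcb V0a V0b using in_H1_iff[OF qd_onD(1)] by blast
  have RS: "z \<in> R \<longleftrightarrow> z \<noteq> 0 \<and> in_resolvent z" for z
    unfolding R_def resolvent_set_def in_resolvent_def SRel by blast
  have an: "(\<lambda>z. \<phi> z c) analytic_on - {0}" "(\<lambda>z. \<theta> z c) analytic_on - {0}" if "c \<in> I" for c
    using phi_an[OF that] theta_an[OF that] unfolding real_analytic_pole0_def by auto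
  have conj: "\<phi> (cnj z) x = cnj (\<phi> z x)" "\<phi>1 (cnj z) x = cnj (\<phi>1 z x)"
    "\<theta> (cnj z) x = cnj (\<theta> z x)" "\<theta>1 (cnj z) x = cnj (\<theta>1 z x)" if "x \<in> I" "z \<noteq> 0" for x z
    using phi_an[OF that(1)] theta_an[OF that(1)] that(2) unfolding real_analytic_pole0_def by auto
  have loc: "\<exists>e G. 0 < e \<and> G holomorphic_on ball z e \<and> (\<forall>w\<in>ball z e. \<forall>m. P w m \<longleftrightarrow> m = G w)" if zR: "z \<in> R" for z
  proof -
    obtain e G where "0 < e" "G holomorphic_on ball z e"
      "\<And>w m. w \<in> ball z e \<Longrightarrow> solb w (\<lambda>x. \<theta> w x + m * \<phi> w x) (\<lambda>x. \<theta>1 w x + m * \<phi>1 w x) \<longleftrightarrow> m = G w"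
      by (rule weyl_function_local[OF phi phi_nontriv theta V_theta_phi an, of z]) (use zR RS in auto)
    then show ?thesis unfolding P by blast
  qed
  have ex1: "\<exists>!m. P z m" if zR: "z \<in> R" for z
  proof -
    obtain e G where "0 < e" "\<forall>w\<in>ball z e. \<forall>m. P w m \<longleftrightarrow> m = G w" using loc[OF zR] by blast
    then have "P z m \<longleftrightarrow> m = G z" for m by simp
    then show ?thesis by simp
  qed
  have analytic: "(\<lambda>z. THE m. P z m) analytic_on R"
    unfolding analytic_on_def
  proof
    fix z assume "z \<in> R"
    then obtain e G where e: "0 < e" "G holomorphic_on ball z e" "\<forall>w\<in>ball z e. \<forall>m. P w m \<longleftrightarrow> m = G w"
      using loc by blast
    have "(THE m. P w m) = G w" if "w \<in> ball z e" for w using e(3) that by simp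
    then have "(\<lambda>z. THE m. P z m) holomorphic_on ball z e" using holomorphic_transform[OF e(2)] by metis
    then show "\<exists>e>0. (\<lambda>z. THE m. P z m) holomorphic_on ball z e" using e(1) by blast
  qed
  \<comment> \<open>The real-analytic families satisfy \<phi> (cnj z) = cnj (\<phi> z), and likewise
    for the rest, so the conjugate of theta + m phi at z is theta + cnj m phi at cnj z. The boundary
    condition is invariant under conjugation.\<close>
  have Pcnj: "P (cnj z) (cnj m)" if z: "z \<noteq> 0" and m: "P z m" for z m
    unfolding P
    by (rule B.S_near_cong[OF B.S_near_cnj[OF bcb m[unfolded P]]]) (use conj z in simp_all)
  have "(THE m. P z m) = cnj (THE m. P (cnj z) m)" if z: "z \<in> R" for z
  proof -
    have z0: "z \<noteq> 0" using z RS by simp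
    obtain m where m: "P z m" "\<And>m'. P z m' \<Longrightarrow> m' = m" using ex1[OF z] by blast
    \<comment> \<open>Unique existence at cnj z is carried over from z by conjugating in both
      directions.\<close>
    have "P (cnj z) m' \<longleftrightarrow> m' = cnj m" for m'
    proof
      assume "P (cnj z) m'"
      then have "P z (cnj m')" using Pcnj[of "cnj z" m'] z0 by simp
      then have "cnj m' = m" by (rule m(2))
      then show "m' = cnj m" by auto
    qed (use Pcnj[OF z0 m(1)] in simp)
    then have "(THE m. P (cnj z) m) = cnj m" by simp
    moreover have "(THE m. P z m) = m" using m by (rule the_equality)
    ultimately show ?thesis by simp
  qed
  then show ?thesis using ex1 analytic by blast
qed

end
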